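(* Consider the well-posed single-input single-output port-Hamiltonian system $$\frac{\partial}{\partial t}z(\zeta,t)=-\frac{\partial}{\partial\zeta}\big(\lambda_0(\zeta)z(\zeta,t)\big),$$ $$0=K_0(\lambda_0(0)z(0,t))+L_0(\lambda_0(1)z(1,t)),$$ $$u(t)=K_u(\lambda_0(0)z(0,t))+L_u(\lambda_0(1)z(1,t)),$$ $$y(t)=K_y(\lambda_0(0)z(0,t))+L_y(\lambda_0(1)z(1,t)),$$ on the state space $L^2(0,1;\mathbb{C}^n)$, as described in the context, and let $G$ be its transfer function. Suppose that $G(s)\not\equiv0$. Then the zero dynamics of this system are again a well-posed port-Hamiltonian system with wave speed $-\lambda_0$ and possibly a smaller state space. More precisely, there exists $k\in\{0,\dots,n\}$ such that the zero dynamics is described by the port-Hamiltonian system $$\frac{\partial}{\partial t}w(\zeta,t)=-\frac{\partial}{\partial\zeta}\big(\lambda_0(\zeta)w(\zeta,t)\big),\qquad 0=K_w(\lambda_0(0)w(0,t))+L_w(\lambda_0(1)w(1,t)),$$ with state space $L^2(0,1;\mathbb{C}^k)$, where $K_w,L_w\in\mathbb{C}^{k\times k}$ and the $k\times k$ matrix $K_w$ is invertible.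
   Context: Here $K_0,L_0\in\mathbb{C}^{(n-1)\times n}$, $K_u,K_y,L_u,L_y\in\mathbb{C}^{1\times n}$, and $\lambda_0\in L^\infty(0,1)$ satisfies $0<m\le\lambda_0(\zeta)\le M$ for a.e. $\zeta\in(0,1)$ with constants $m,M>0$. The expressions $\lambda_0(0)z(0,t)$ and $\lambda_0(1)z(1,t)$ denote the boundary values of the function $\lambda_0z(\cdot,t)$ at $\zeta=0,1$. It is assumed that the system is well-posed on $L^2(0,1;\mathbb{C}^n)$, equivalently that the $n\times n$ matrix $\begin{bmatrix}K_0\\ K_u\end{bmatrix}$ is invertible. Solutions are mild solutions: $z\in C([0,\infty);L^2(0,1;\mathbb{C}^n))$ such that $Z(t)=\int_0^tz(\cdot,\tau)\,d\tau$ satisfies $\lambda_0Z(t)\in H^1(0,1;\mathbb{C}^n)$, $z(\cdot,t)-z(\cdot,0)=-(\lambda_0Z(t))'$, and the boundary/input/output equations hold in time-integrated form. The generator $A$ of the homogeneous system ($u=0$) is $$Af=-(\lambda_0f)',\qquad D(A)=\Big\{f:\ \lambda_0f\in H^1(0,1;\mathbb{C}^n),\ \begin{bmatrix}0\\ 0\end{bmatrix}=\begin{bmatrix}K_0\\ K_u\end{bmatrix}(\lambda_0f)(0)+\begin{bmatrix}L_0\\ L_u\end{bmatrix}(\lambda_0f)(1)\Big\}.$$ With $p=\int_0^1\lambda_0^{-1}(\zeta)\,d\zeta$, the transfer function $G$ is given for $s\in\rho(A)$ (the resolvent set) as follows: for $u\in\mathbb{C}$, the number $G(s)u$ is uniquely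 determined by $$0=(K_0+L_0e^{-sp})v,\qquad u=(K_u+L_ue^{-sp})v,\qquad G(s)u=(K_y+L_ye^{-sp})v$$ for some $v\in\mathbb{C}^n$. It is analytic and bounded on some right half-plane $\{s\in\mathbb{C}:\operatorname{Re}s>\alpha\}$. The zero dynamics are the pairs $(z_0,u)\in L^2(0,1;\mathbb{C}^n)\times L^2_{loc}(0,\infty;\mathbb{C})$ for which the mild solution with initial state $z_0$ and input $u$ satisfies $y=0$; their state trajectories $z$ are the solutions of the partial differential equation with $$\begin{bmatrix}0\\ 0\end{bmatrix}=\begin{bmatrix}K_0\\ K_y\end{bmatrix}(\lambda_0(0)z(0,t))+\begin{bmatrix}L_0\\ L_y\end{bmatrix}(\lambda_0(1)z(1,t)).$$ The zero dynamics being described by a system with state $w\in L^2(0,1;\mathbb{C}^k)$ means that, after a constant linear change of state coordinates, the trajectories $z$ are exactly those given by the solutions $w$: there is an injective matrix $Q\in\mathbb{C}^{n\times k}$ such that the trajectories $z$ of the zero dynamics are exactly the functions $z=Qw$ with $w$ a mild solution of the system for $w$. For $k=0$ the zero dynamics are trivial. A port-Hamiltonian system of the displayed form for $w$ is well-posed on $L^2(0,1;\mathbb{C}^k)$ if and only if $K_w$ is invertible. *)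

theory Defs
  imports "HOL-Analysis.Analysis" "Jordan_Normal_Form.Matrix"
begin

unbundle no vec_syntax

text \<open>
  Since the dimension of the zero dynamics is existentially quantified, \<open>\<complex>\<^sup>n\<close> is rendered by the
  carriers \<open>carrier_vec n\<close> and \<open>carrier_mat n m\<close>. Elements of \<open>L\<^sup>2(0,1;\<complex>\<^sup>n)\<close> are represented by
  functions, to be identified when they agree almost everywhere.
\<close>

abbreviation unit_measure :: "real measure" where
  "unit_measure \<equiv> lebesgue_on {0<..<1}"

definition L2 :: "nat \<Rightarrow> (real \<Rightarrow> complex vec) set" where
  "L2 n = {f. (AE x in unit_measure. f x \<in> carrier_vec n) \<and>
     (\<forall>i<n. (\<lambda>x. f x $ i) \<in> borel_measurable unit_measure \<and>
            integrable unit_measure (\<lambda>x. (cmod (f x $ i))\<^sup>2))}"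

definition L2_norm :: "nat \<Rightarrow> (real \<Rightarrow> complex vec) \<Rightarrow> real" where
  "L2_norm n f = sqrt (\<integral>x. (\<Sum>i<n. (cmod (f x $ i))\<^sup>2) \<partial>unit_measure)"

text \<open>Square integrability on bounded intervals \<open>(0,T)\<close>, so up to and including the initial time.\<close>

definition L2_loc :: "(real \<Rightarrow> complex) set" where
  "L2_loc = {u. \<forall>T>0. u \<in> borel_measurable (lebesgue_on {0<..<T}) \<and>
                      integrable (lebesgue_on {0<..<T}) (\<lambda>t. (cmod (u t))\<^sup>2)}"

text \<open>Membership in \<open>C([0,\<infinity>); L\<^sup>2(0,1;\<complex>\<^sup>n))\<close>. The first argument of \<open>z\<close> is time.\<close>

definition L2_continuous :: "nat \<Rightarrow> (real \<Rightarrow> real \<Rightarrow> complex vec) \<Rightarrow> bool" where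
  "L2_continuous n z \<longleftrightarrow> (\<forall>t\<ge>0. z t \<in> L2 n) \<and>
     (\<forall>t\<ge>0. ((\<lambda>s. L2_norm n (\<lambda>x. z s x - z t x)) \<longlongrightarrow> 0) (at t within {0..}))"

text \<open>
  \<open>Z = \<integral>\<^sub>0\<^sup>t z(\<cdot>,\<tau>) d\<tau>\<close> as an \<open>L\<^sup>2\<close>-valued Riemann integral (\<open>z\<close> will be continuous): the Riemann
  sums converge in the \<open>L\<^sup>2\<close>-norm as the mesh tends to zero.
\<close>

definition L2_has_integral ::
    "nat \<Rightarrow> (real \<Rightarrow> real \<Rightarrow> complex vec) \<Rightarrow> real \<Rightarrow> (real \<Rightarrow> complex vec) \<Rightarrow> bool" where
  "L2_has_integral n z t Z \<longleftrightarrow> Z \<in> L2 n \<and>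
     (\<forall>\<epsilon>>0. \<exists>\<delta>>0. \<forall>P. P tagged_division_of {0..t} \<and> (\<forall>(\<tau>, J)\<in>P. diameter J < \<delta>) \<longrightarrow>
        L2_norm n (\<lambda>x. vec n (\<lambda>i. Z x $ i -
          (\<Sum>(\<tau>, J)\<in>P. of_real (measure lborel J) * z \<tau> x $ i))) < \<epsilon>)"

text \<open>
  \<open>H1 n g gc h\<close>: \<open>g \<in> H\<^sup>1(0,1;\<complex>\<^sup>n)\<close>, with absolutely continuous representative \<open>gc\<close> on \<open>[0,1]\<close> and
  derivative \<open>h \<in> L\<^sup>2\<close>. Absolute continuity with derivative \<open>h\<close> is expressed by
  \<open>gc(x) = gc(0) + \<integral>\<^sub>0\<^sup>x h\<close>. The boundary values of \<open>g\<close> are \<open>gc 0\<close> and \<open>gc 1\<close>.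
\<close>

definition H1 ::
    "nat \<Rightarrow> (real \<Rightarrow> complex vec) \<Rightarrow> (real \<Rightarrow> complex vec) \<Rightarrow> (real \<Rightarrow> complex vec) \<Rightarrow> bool" where
  "H1 n g gc h \<longleftrightarrow> g \<in> L2 n \<and> h \<in> L2 n \<and>
     (\<forall>x\<in>{0..1}. gc x \<in> carrier_vec n \<and>
        (\<forall>i<n. gc x $ i = gc 0 $ i + (\<integral>y. h y $ i \<partial>lebesgue_on {0<..<x}))) \<and>
     (AE x in unit_measure. g x = gc x)"

text \<open>
  Mild solutions of \<open>\<partial>\<^sub>t z = -\<partial>\<^sub>\<zeta> (lam0 z)\<close>, before boundary conditions are imposed. \<open>B0 t\<close> and
  \<open>B1 t\<close> are the boundary values at \<open>0\<close> and \<open>1\<close> of \<open>lam0 Z(t)\<close>, \<open>Z(t) = \<integral>\<^sub>0\<^sup>t z(\<cdot>,\<tau>) d\<tau>\<close>, that is, the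
  time integrals of the boundary values of \<open>lam0 z\<close>.
\<close>

definition mild_transport ::
    "nat \<Rightarrow> (real \<Rightarrow> real) \<Rightarrow> (real \<Rightarrow> real \<Rightarrow> complex vec) \<Rightarrow>
     (real \<Rightarrow> complex vec) \<Rightarrow> (real \<Rightarrow> complex vec) \<Rightarrow> bool" where
  "mild_transport n lam0 z B0 B1 \<longleftrightarrow> L2_continuous n z \<and>
     (\<forall>t\<ge>0. \<exists>Z gc h. L2_has_integral n z t Z \<and>
        H1 n (\<lambda>x. of_real (lam0 x) \<cdot>\<^sub>v Z x) gc h \<and>
        (AE x in unit_measure. z t x - z 0 x = - h x) \<and>
        B0 t = gc 0 \<and> B1 t = gc 1)"

text \<open>
  Mild solutions with initial state \<open>z0\<close>, input \<open>u\<close> and output \<open>y\<close>. The input and output matrices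
  have one row, hence the component at index \<open>0\<close>.
\<close>

definition mild_solution ::
    "nat \<Rightarrow> (real \<Rightarrow> real) \<Rightarrow> complex mat \<Rightarrow> complex mat \<Rightarrow> complex mat \<Rightarrow> complex mat \<Rightarrow>
     complex mat \<Rightarrow> complex mat \<Rightarrow>
     (real \<Rightarrow> complex vec) \<Rightarrow> (real \<Rightarrow> complex) \<Rightarrow> (real \<Rightarrow> real \<Rightarrow> complex vec) \<Rightarrow>
     (real \<Rightarrow> complex) \<Rightarrow> bool" where
  "mild_solution n lam0 K0 L0 Ku Lu Ky Ly z0 u z y \<longleftrightarrow>
     z0 \<in> L2 n \<and> u \<in> L2_loc \<and> y \<in> L2_loc \<and>
     (AE x in unit_measure. z 0 x = z0 x) \<and>
     (\<exists>B0 B1. mild_transport n lam0 z B0 B1 \<and>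
       (\<forall>t\<ge>0.
         0\<^sub>v (n - 1) = K0 *\<^sub>v B0 t + L0 *\<^sub>v B1 t \<and>
         (\<integral>\<tau>. u \<tau> \<partial>lebesgue_on {0<..<t}) = (Ku *\<^sub>v B0 t + Lu *\<^sub>v B1 t) $ 0 \<and>
         (\<integral>\<tau>. y \<tau> \<partial>lebesgue_on {0<..<t}) = (Ky *\<^sub>v B0 t + Ly *\<^sub>v B1 t) $ 0))"

definition autonomous_mild_solution ::
    "nat \<Rightarrow> (real \<Rightarrow> real) \<Rightarrow> complex mat \<Rightarrow> complex mat \<Rightarrow> (real \<Rightarrow> real \<Rightarrow> complex vec) \<Rightarrow> bool" where
  "autonomous_mild_solution k lam0 Kw Lw w \<longleftrightarrow>
     (\<exists>B0 B1. mild_transport k lam0 w B0 B1 \<and>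
       (\<forall>t\<ge>0. 0\<^sub>v k = Kw *\<^sub>v B0 t + Lw *\<^sub>v B1 t))"

definition zero_dynamics ::
    "nat \<Rightarrow> (real \<Rightarrow> real) \<Rightarrow> complex mat \<Rightarrow> complex mat \<Rightarrow> complex mat \<Rightarrow> complex mat \<Rightarrow>
     complex mat \<Rightarrow> complex mat \<Rightarrow> ((real \<Rightarrow> complex vec) \<times> (real \<Rightarrow> complex)) set" where
  "zero_dynamics n lam0 K0 L0 Ku Lu Ky Ly =
     {(z0, u). \<exists>z. mild_solution n lam0 K0 L0 Ku Lu Ky Ly z0 u z (\<lambda>t. 0)}"

definition zero_dynamics_trajectories ::
    "nat \<Rightarrow> (real \<Rightarrow> real) \<Rightarrow> complex mat \<Rightarrow> complex mat \<Rightarrow> complex mat \<Rightarrow> complex mat \<Rightarrow>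
     complex mat \<Rightarrow> complex mat \<Rightarrow> (real \<Rightarrow> real \<Rightarrow> complex vec) set" where
  "zero_dynamics_trajectories n lam0 K0 L0 Ku Lu Ky Ly =
     {z. \<exists>(z0, u) \<in> zero_dynamics n lam0 K0 L0 Ku Lu Ky Ly.
           mild_solution n lam0 K0 L0 Ku Lu Ky Ly z0 u z (\<lambda>t. 0)}"

text \<open>The graph of \<open>A\<close>: \<open>f \<in> D(A)\<close> and \<open>A f = Af\<close> almost everywhere.\<close>

definition generator ::
    "nat \<Rightarrow> (real \<Rightarrow> real) \<Rightarrow> complex mat \<Rightarrow> complex mat \<Rightarrow> complex mat \<Rightarrow> complex mat \<Rightarrow>
     (real \<Rightarrow> complex vec) \<Rightarrow> (real \<Rightarrow> complex vec) \<Rightarrow> bool" where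
  "generator n lam0 K0 L0 Ku Lu f Af \<longleftrightarrow> f \<in> L2 n \<and>
     (\<exists>gc h. H1 n (\<lambda>x. of_real (lam0 x) \<cdot>\<^sub>v f x) gc h \<and>
        (AE x in unit_measure. Af x = - h x) \<and>
        0\<^sub>v n = (K0 @\<^sub>r Ku) *\<^sub>v gc 0 + (L0 @\<^sub>r Lu) *\<^sub>v gc 1)"

text \<open>
  \<open>s \<in> \<rho>(A)\<close>: \<open>s I - A\<close> is onto, and bounded below (hence one-to-one with bounded inverse).
\<close>

definition resolvent_set ::
    "nat \<Rightarrow> (real \<Rightarrow> real) \<Rightarrow> complex mat \<Rightarrow> complex mat \<Rightarrow> complex mat \<Rightarrow> complex mat \<Rightarrow>
     complex set" where
  "resolvent_set n lam0 K0 L0 Ku Lu = {s.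
     (\<forall>g\<in>L2 n. \<exists>f Af. generator n lam0 K0 L0 Ku Lu f Af \<and>
        (AE x in unit_measure. s \<cdot>\<^sub>v f x - Af x = g x)) \<and>
     (\<exists>C. \<forall>f Af. generator n lam0 K0 L0 Ku Lu f Af \<longrightarrow>
        L2_norm n f \<le> C * L2_norm n (\<lambda>x. s \<cdot>\<^sub>v f x - Af x))}"

definition travel_time :: "(real \<Rightarrow> real) \<Rightarrow> real" where
  "travel_time lam0 = (\<integral>x. 1 / lam0 x \<partial>unit_measure)"

text \<open>\<open>G(s)u\<close>; meaningful for \<open>s\<close> in the resolvent set.\<close>

definition transfer_function ::
    "nat \<Rightarrow> (real \<Rightarrow> real) \<Rightarrow> complex mat \<Rightarrow> complex mat \<Rightarrow> complex mat \<Rightarrow> complex mat \<Rightarrow>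
     complex mat \<Rightarrow> complex mat \<Rightarrow> complex \<Rightarrow> complex \<Rightarrow> complex" where
  "transfer_function n lam0 K0 L0 Ku Lu Ky Ly s u =
     (let q = exp (- s * of_real (travel_time lam0)) in
      THE y. \<exists>v\<in>carrier_vec n.
        0\<^sub>v (n - 1) = (K0 + q \<cdot>\<^sub>m L0) *\<^sub>v v \<and>
        u = ((Ku + q \<cdot>\<^sub>m Lu) *\<^sub>v v) $ 0 \<and>
        y = ((Ky + q \<cdot>\<^sub>m Ly) *\<^sub>v v) $ 0)"

end

theory Submission
  imports Defs "Jordan_Normal_Form.Determinant"
begin

text \<open>
  Write \<open>B0(t)\<close>, \<open>B1(t)\<close> for the boundary values at \<open>0\<close> and \<open>1\<close> of \<open>lam0 Z(t)\<close>, that is, for the time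
  integrals of inflow and outflow, and let \<open>\<tau>(x) = \<integral>\<^sub>0\<^sup>x 1/lam0\<close>, \<open>p = \<tau>(1)\<close>. The equation
  \<open>\<partial>\<^sub>t z = -\<partial>\<^sub>\<zeta>(lam0 z)\<close> transports every component along the characteristics with travel time \<open>\<tau>\<close>, so the
  outflow alone determines everything:
  \<open>B0(t) = B1(t + p) - B1(p)\<close> and \<open>\<integral>\<^sub>0\<^sup>x z(\<cdot>,t) = B1(t + p) - B1(t + p - \<tau>(x))\<close>
  (lemmas \<open>B0_advanced\<close> and \<open>state_primitive\<close>). They come from an integrated form of d'Alembert's
  formula, \<open>constant_along_characteristics\<close>, which suits the merely measurable wave speed.

  Put \<open>K = [K0; Ky]\<close> and \<open>L = [L0; Ly]\<close>. A trajectory with zero output satisfies \<open>K B0(t) + L B1(t) = 0\<close>,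
  and by the first formula the increments \<open>d\<^sub>j = B1(t + j p) - B1(j p)\<close> satisfy the difference equation
  \<open>K d\<^sub>j\<^sub>+\<^sub>1 + L d\<^sub>j = 0\<close>. Let \<open>W\<close> be the subspace of all \<open>d\<^sub>0\<close> that start an infinite solution of it; thus
  \<open>L W \<subseteq> K W\<close>, while \<open>K\<close> itself may be singular. The transfer function is nonzero at some point \<open>s\<close> of
  the resolvent set, and this makes \<open>K + q L\<close> injective for \<open>q = exp(-s p)\<close>
  (\<open>resolvent_characteristic_injective\<close>, \<open>output_pencil_regular\<close>). As \<open>K + q L\<close> maps \<open>W\<close> injectively into
  \<open>K W\<close>, counting dimensions shows that \<open>K\<close> is injective on \<open>W\<close>. If the columns of \<open>Q\<close> are a basis of \<open>W\<close>,
  then \<open>L Q = K Q R\<close> for a square matrix \<open>R\<close>, and on \<open>W\<close> the difference equation reads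
  \<open>w\<^sub>j\<^sub>+\<^sub>1 + R w\<^sub>j = 0\<close> (\<open>regular_pencil_forward_space\<close>). The reduced boundary condition therefore has
  \<open>Kw = 1\<close> and \<open>Lw = R\<close>.

  The traces of a zero-output trajectory \<open>z\<close> lie in \<open>W\<close>. A projection that annihilates \<open>W\<close> turns \<open>z\<close> into a
  mild solution without outflow, which vanishes by the second formula; hence \<open>z = Q w\<close>. Conversely, for a
  solution \<open>w\<close> of the reduced system, \<open>z = Q w\<close> has zero output, and what remains is to find an input in
  \<open>L2_loc\<close>. It exists because the second formula, read on the windows \<open>[j p, (j + 1) p]\<close>, shows that the
  outflow \<open>B1\<close> is the primitive of a locally square integrable function (\<open>outflow_trace_density\<close>).
\<close>

section \<open>Regular matrix pencils\<close>

text \<open>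
  Padding with zeros to square matrices turns the one-sided inverse into a two-sided one, although
  the padded factor \<open>Q\<close> has a zero row.
\<close>

lemma full_rank_section_le:
  fixes P :: "'a::field mat"
  assumes P: "P \<in> carrier_mat k n" and Q: "Q \<in> carrier_mat n k" and PQ: "P * Q = 1\<^sub>m k"
  shows "k \<le> n"
proof (rule ccontr)
  assume "\<not> k \<le> n"
  then have nk: "n < k" by simp
  define P' where "P' = mat k k (\<lambda>(i,j). if j < n then P $$ (i,j) else 0)"
  define Q' where "Q' = mat k k (\<lambda>(i,j). if i < n then Q $$ (i,j) else 0)"
  have P': "P' \<in> carrier_mat k k" and Q': "Q' \<in> carrier_mat k k" by (auto simp: P'_def Q'_def)
  have "P' * Q' = P * Q"
  proof (rule eq_matI)
    fix i j assume "i < dim_row (P * Q)" "j < dim_col (P * Q)"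
    then have i: "i < k" and j: "j < k" using P Q by auto
    have "(P' * Q') $$ (i,j) = (\<Sum>l\<in>{0..<k}. P' $$ (i,l) * Q' $$ (l,j))"
      using i j by (simp add: P'_def Q'_def scalar_prod_def)
    also have "\<dots> = (\<Sum>l\<in>{0..<n}. P' $$ (i,l) * Q' $$ (l,j))"
      using nk i j by (intro sum.mono_neutral_right) (auto simp: P'_def Q'_def)
    also have "\<dots> = (\<Sum>l\<in>{0..<n}. P $$ (i,l) * Q $$ (l,j))"
      using nk i j by (intro sum.cong) (auto simp: P'_def Q'_def)
    also have "\<dots> = (P * Q) $$ (i,j)" using i j P Q by (simp add: scalar_prod_def)
    finally show "(P' * Q') $$ (i,j) = (P * Q) $$ (i,j)" .
  qed (use P Q in \<open>auto simp: P'_def Q'_def\<close>)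
  then have "Q' * P' = 1\<^sub>m k" using mat_mult_left_right_inverse[OF P' Q'] PQ by simp
  moreover have "(Q' * P') $$ (n,n) = 0"
    using nk by (simp add: P'_def Q'_def scalar_prod_def)
  ultimately show False using nk by simp
qed

lemma injective_imp_right_inverse:
  fixes A :: "'a::field mat"
  assumes A: "A \<in> carrier_mat n n"
    and inj: "\<And>v. v \<in> carrier_vec n \<Longrightarrow> A *\<^sub>v v = 0\<^sub>v n \<Longrightarrow> v = 0\<^sub>v n"
  obtains B where "B \<in> carrier_mat n n" "A * B = 1\<^sub>m n"
proof -
  have "det A \<noteq> 0" using det_0_iff_vec_prod_zero_field[OF A] inj by blast
  from det_non_zero_imp_unit[OF A this]
  have "\<exists>B\<in>carrier_mat n n. A * B = 1\<^sub>m n" by (auto simp: Units_def ring_mat_def)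
  then show ?thesis using that by blast
qed

text \<open>
  A basis of a subspace of \<open>carrier_vec n\<close>, in matrix form together with coordinates \<open>P\<close>. Taking \<open>k\<close> as
  large as possible forces the columns of \<open>Q\<close> to span: a vector outside the span would give one more
  column, and a matching row of \<open>P\<close>.
\<close>

lemma subspace_basis_matrix:
  fixes W :: "'a::field vec set"
  assumes sub: "W \<subseteq> carrier_vec n" and zero: "0\<^sub>v n \<in> W"
    and add: "\<And>v w. v \<in> W \<Longrightarrow> w \<in> W \<Longrightarrow> v + w \<in> W"
    and smult: "\<And>c v. v \<in> W \<Longrightarrow> c \<cdot>\<^sub>v v \<in> W"
  obtains k P Q where "k \<le> n" "P \<in> carrier_mat k n" "Q \<in> carrier_mat n k" "P * Q = 1\<^sub>m k"
    "W = (\<lambda>c. Q *\<^sub>v c) ` carrier_vec k"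
proof -
  define good where "good k \<longleftrightarrow> (\<exists>P Q. P \<in> carrier_mat k n \<and> Q \<in> carrier_mat n k \<and> P * Q = 1\<^sub>m k \<and>
      (\<lambda>c. Q *\<^sub>v c) ` carrier_vec k \<subseteq> W)" for k
  have bound: "k \<le> n" if "good k" for k
    using that full_rank_section_le unfolding good_def by blast
  have "good 0"
  proof -
    have "(0\<^sub>m n 0 :: 'a mat) *\<^sub>v c = 0\<^sub>v n" if "c \<in> carrier_vec 0" for c
      using that by (intro eq_vecI) (auto simp: scalar_prod_def)
    then show ?thesis unfolding good_def using zero
      by (intro exI[of _ "0\<^sub>m 0 n"] exI[of _ "0\<^sub>m n 0"]) auto
  qed
  define k where "k = (GREATEST k. good k)"
  have gk: "good k" unfolding k_def using \<open>good 0\<close> bound by (rule GreatestI_nat)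
  have nk: "\<not> good (Suc k)"
    using Greatest_le_nat[of good "Suc k" n] bound unfolding k_def by auto
  from gk obtain P Q where P: "P \<in> carrier_mat k n" and Q: "Q \<in> carrier_mat n k"
    and PQ: "P * Q = 1\<^sub>m k" and ran: "(\<lambda>c. Q *\<^sub>v c) ` carrier_vec k \<subseteq> W" unfolding good_def by blast
  have "v \<in> (\<lambda>c. Q *\<^sub>v c) ` carrier_vec k" if v: "v \<in> W" for v
  proof (rule ccontr)
    assume nv: "v \<notin> (\<lambda>c. Q *\<^sub>v c) ` carrier_vec k"
    have vn: "v \<in> carrier_vec n" using v sub by auto
    \<comment> \<open>the part of \<open>v\<close> that the projection \<open>Q P\<close> misses, normalised by its entry \<open>i\<close>, extends \<open>Q\<close>\<close>
    define x where "x = v - Q *\<^sub>v (P *\<^sub>v v)"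
    have Pv: "P *\<^sub>v v \<in> carrier_vec k" using P vn by auto
    have xn: "x \<in> carrier_vec n" unfolding x_def using Q Pv vn by auto
    have x0: "x \<noteq> 0\<^sub>v n"
    proof
      assume "x = 0\<^sub>v n"
      have "v = Q *\<^sub>v (P *\<^sub>v v)"
      proof (rule eq_vecI)
        fix i assume "i < dim_vec (Q *\<^sub>v (P *\<^sub>v v))"
        then have "i < n" using Q by auto
        moreover have "x $ i = 0" using \<open>x = 0\<^sub>v n\<close> \<open>i < n\<close> by simp
        ultimately show "v $ i = (Q *\<^sub>v (P *\<^sub>v v)) $ i" unfolding x_def using Q vn by simp
      qed (use Q vn in auto)
      then show False using nv Pv by blast
    qed
    have xW: "x \<in> W"
    proof -
      have "x = v + (-1) \<cdot>\<^sub>v (Q *\<^sub>v (P *\<^sub>v v))" unfolding x_def using vn Q Pv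
        by (intro eq_vecI) auto
      moreover have "Q *\<^sub>v (P *\<^sub>v v) \<in> W" using ran Pv by blast
      ultimately show ?thesis using add smult v by simp
    qed
    have Px: "P *\<^sub>v x = 0\<^sub>v k"
    proof -
      have "P *\<^sub>v x = P *\<^sub>v v - P *\<^sub>v (Q *\<^sub>v (P *\<^sub>v v))" unfolding x_def
        using P Q Pv vn by (intro mult_minus_distrib_mat_vec) auto
      also have "P *\<^sub>v (Q *\<^sub>v (P *\<^sub>v v)) = P *\<^sub>v v"
        using assoc_mult_mat_vec[OF P Q Pv] PQ Pv by simp
      finally show ?thesis using Pv by simp
    qed
    obtain i where i: "i < n" "x $ i \<noteq> 0" using x0 xn by (metis carrier_vecD eq_vecI index_zero_vec)
    define R where "R = (1\<^sub>m n - Q * P)"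
    have R: "R \<in> carrier_mat n n" unfolding R_def using P Q by auto
    have RQ: "R * Q = 0\<^sub>m n k"
    proof -
      have "R * Q = 1\<^sub>m n * Q - Q * P * Q" unfolding R_def using P Q
        by (intro minus_mult_distrib_mat) auto
      also have "Q * P * Q = Q * (P * Q)" using P Q by (intro assoc_mult_mat) auto
      finally show ?thesis using Q PQ by simp
    qed
    have Rx: "R *\<^sub>v x = x"
    proof -
      have "R *\<^sub>v x = 1\<^sub>m n *\<^sub>v x - (Q * P) *\<^sub>v x" unfolding R_def using P Q xn
        by (intro minus_mult_distrib_mat_vec) auto
      also have "(Q * P) *\<^sub>v x = Q *\<^sub>v 0\<^sub>v k" using assoc_mult_mat_vec[OF Q P xn] Px by simp
      also have "\<dots> = 0\<^sub>v n" using Q by (intro eq_vecI) auto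
      finally show ?thesis using xn by simp
    qed
    \<comment> \<open>the new row vanishes on the old columns, as \<open>R Q = 0\<close>, and is \<open>1\<close> on \<open>x\<close>, as \<open>R x = x\<close>\<close>
    define P' where "P' = mat (Suc k) n (\<lambda>(a,b). if a < k then P $$ (a,b) else R $$ (i,b) / x $ i)"
    define Q' where "Q' = mat n (Suc k) (\<lambda>(a,b). if b < k then Q $$ (a,b) else x $ a)"
    have P': "P' \<in> carrier_mat (Suc k) n" and Q': "Q' \<in> carrier_mat n (Suc k)"
      by (auto simp: P'_def Q'_def)
    have "P' * Q' = 1\<^sub>m (Suc k)"
    proof (rule eq_matI)
      fix a b assume "a < dim_row (1\<^sub>m (Suc k) :: 'a mat)" "b < dim_col (1\<^sub>m (Suc k) :: 'a mat)"
      then have a: "a < Suc k" and b: "b < Suc k" by auto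
      have e: "(P' * Q') $$ (a,b) = (\<Sum>l\<in>{0..<n}. P' $$ (a,l) * Q' $$ (l,b))"
        using a b by (simp add: P'_def Q'_def scalar_prod_def)
      consider "a < k" "b < k" | "a < k" "b = k" | "a = k" "b < k" | "a = k" "b = k"
        using a b by linarith
      then show "(P' * Q') $$ (a,b) = 1\<^sub>m (Suc k) $$ (a,b)"
      proof cases
        case 1
        then have "(\<Sum>l\<in>{0..<n}. P' $$ (a,l) * Q' $$ (l,b)) = (P * Q) $$ (a,b)"
          using P Q by (simp add: P'_def Q'_def scalar_prod_def)
        then show ?thesis using e PQ 1 by simp
      next
        case 2
        then have "(\<Sum>l\<in>{0..<n}. P' $$ (a,l) * Q' $$ (l,b)) = (P *\<^sub>v x) $ a"
          using P xn by (simp add: P'_def Q'_def scalar_prod_def)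
        then show ?thesis using e Px 2 by simp
      next
        case 3
        then have "(\<Sum>l\<in>{0..<n}. P' $$ (a,l) * Q' $$ (l,b)) = (R * Q) $$ (i,b) / x $ i"
          using R Q i by (simp add: P'_def Q'_def scalar_prod_def sum_divide_distrib)
        then show ?thesis using e RQ 3 i by simp
      next
        case 4
        then have "(\<Sum>l\<in>{0..<n}. P' $$ (a,l) * Q' $$ (l,b)) = (R *\<^sub>v x) $ i / x $ i"
          using R xn i by (simp add: P'_def Q'_def scalar_prod_def sum_divide_distrib)
        then show ?thesis using e Rx 4 i by simp
      qed
    qed (auto simp: P'_def Q'_def)
    moreover have "Q' *\<^sub>v c \<in> W" if c: "c \<in> carrier_vec (Suc k)" for c
    proof -
      have "Q' *\<^sub>v c = Q *\<^sub>v vec k (\<lambda>j. c $ j) + c $ k \<cdot>\<^sub>v x"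
        using c Q xn by (intro eq_vecI) (auto simp: Q'_def scalar_prod_def)
      moreover have "Q *\<^sub>v vec k (\<lambda>j. c $ j) \<in> W" using ran by force
      ultimately show ?thesis using add smult xW by simp
    qed
    ultimately have "good (Suc k)" unfolding good_def using P' Q' by blast
    then show False using nk by simp
  qed
  then have "W = (\<lambda>c. Q *\<^sub>v c) ` carrier_vec k" using ran by blast
  then show ?thesis using that bound[OF gk] P Q PQ by blast
qed

lemma eq_uminus_if_add_eq_zero:
  fixes v w :: "'a::ring vec"
  assumes "v \<in> carrier_vec n" "w \<in> carrier_vec n" "0\<^sub>v n = v + w" shows "v = - w"
proof (rule eq_vecI)
  fix i assume "i < dim_vec (- w)"
  then have "i < n" using assms by simp
  moreover have "(v + w) $ i = 0" using assms(3) \<open>i < n\<close> by (metis index_zero_vec(1))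
  ultimately show "v $ i = (- w) $ i" using assms(1,2) by (simp add: eq_neg_iff_add_eq_0)
qed (use assms in auto)

text \<open>
  The forward space \<open>W\<close> of the difference equation \<open>K d\<^sub>j\<^sub>+\<^sub>1 + L d\<^sub>j = 0\<close> consists of the possible \<open>d\<^sub>0\<close>.
  Shifting a solution shows \<open>L W \<subseteq> K W\<close>, which yields \<open>R\<close>. Then \<open>(K + q L) Q = K Q (1 + q R)\<close>; as the
  left side is injective, the square matrix \<open>1 + q R\<close> is injective, hence invertible, and so \<open>K Q\<close> is
  injective as well. For singular \<open>K\<close> this is the part of the Weierstrass form of the pencil that is
  free of nilpotent blocks.
\<close>

lemma regular_pencil_forward_space:
  fixes K L :: "'a::field mat"
  assumes K: "K \<in> carrier_mat n n" and L: "L \<in> carrier_mat n n"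
    and reg: "\<And>v. v \<in> carrier_vec n \<Longrightarrow> (K + q \<cdot>\<^sub>m L) *\<^sub>v v = 0\<^sub>v n \<Longrightarrow> v = 0\<^sub>v n"
  obtains k P Q R where "k \<le> n" "P \<in> carrier_mat k n" "Q \<in> carrier_mat n k" "R \<in> carrier_mat k k"
    "P * Q = 1\<^sub>m k" "L * Q = K * Q * R"
    "\<And>c. c \<in> carrier_vec k \<Longrightarrow> (K * Q) *\<^sub>v c = 0\<^sub>v n \<Longrightarrow> c = 0\<^sub>v k"
    "\<And>d. (\<And>j. d j \<in> carrier_vec n) \<Longrightarrow> (\<And>j. K *\<^sub>v d (Suc j) + L *\<^sub>v d j = 0\<^sub>v n) \<Longrightarrow>
        Q *\<^sub>v (P *\<^sub>v d 0) = d 0"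
proof -
  define traj where "traj d \<longleftrightarrow> (\<forall>j. d j \<in> carrier_vec n) \<and> (\<forall>j. K *\<^sub>v d (Suc j) + L *\<^sub>v d j = 0\<^sub>v n)"
    for d :: "nat \<Rightarrow> 'a vec"
  define W where "W = {d 0 | d. traj d}"
  have sub: "W \<subseteq> carrier_vec n" unfolding W_def traj_def by auto
  have Kz: "K *\<^sub>v 0\<^sub>v n = 0\<^sub>v n" and Lz: "L *\<^sub>v 0\<^sub>v n = 0\<^sub>v n" using K L by (auto intro!: eq_vecI)
  have zero: "0\<^sub>v n \<in> W"
    unfolding W_def traj_def by (rule CollectI, rule exI[of _ "\<lambda>_. 0\<^sub>v n"]) (simp add: Kz Lz)
  have add: "v + w \<in> W" if "v \<in> W" "w \<in> W" for v w
  proof -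
    from that obtain d e where d: "traj d" "v = d 0" and e: "traj e" "w = e 0" unfolding W_def by auto
    have dc: "d j \<in> carrier_vec n" and ec: "e j \<in> carrier_vec n" for j
      using d e by (auto simp: traj_def)
    have "traj (\<lambda>j. d j + e j)" unfolding traj_def
    proof (intro conjI allI)
      fix j
      have "K *\<^sub>v (d (Suc j) + e (Suc j)) + L *\<^sub>v (d j + e j)
          = (K *\<^sub>v d (Suc j) + L *\<^sub>v d j) + (K *\<^sub>v e (Suc j) + L *\<^sub>v e j)"
        using mult_add_distrib_mat_vec[OF K dc ec] mult_add_distrib_mat_vec[OF L dc ec] K L
        by (intro eq_vecI) auto
      also have "\<dots> = 0\<^sub>v n" using d e by (simp add: traj_def)
      finally show "K *\<^sub>v (d (Suc j) + e (Suc j)) + L *\<^sub>v (d j + e j) = 0\<^sub>v n" .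
    qed (use dc ec in auto)
    then show ?thesis unfolding W_def using d e by (intro CollectI exI[of _ "\<lambda>j. d j + e j"]) simp
  qed
  have smult: "c \<cdot>\<^sub>v v \<in> W" if "v \<in> W" for c v
  proof -
    from that obtain d where d: "traj d" "v = d 0" unfolding W_def by auto
    have dc: "d j \<in> carrier_vec n" for j using d by (auto simp: traj_def)
    have "traj (\<lambda>j. c \<cdot>\<^sub>v d j)" unfolding traj_def
    proof (intro conjI allI)
      fix j
      have "K *\<^sub>v (c \<cdot>\<^sub>v d (Suc j)) + L *\<^sub>v (c \<cdot>\<^sub>v d j) = c \<cdot>\<^sub>v (K *\<^sub>v d (Suc j) + L *\<^sub>v d j)"
        using mult_mat_vec[OF K dc] mult_mat_vec[OF L dc] K L
        by (intro eq_vecI) (auto simp: distrib_left)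
      also have "\<dots> = 0\<^sub>v n" using d by (auto simp: traj_def intro!: eq_vecI)
      finally show "K *\<^sub>v (c \<cdot>\<^sub>v d (Suc j)) + L *\<^sub>v (c \<cdot>\<^sub>v d j) = 0\<^sub>v n" .
    qed (use dc in auto)
    then show ?thesis unfolding W_def using d by (intro CollectI exI[of _ "\<lambda>j. c \<cdot>\<^sub>v d j"]) simp
  qed
  obtain k P Q where k: "k \<le> n" and P: "P \<in> carrier_mat k n" and Q: "Q \<in> carrier_mat n k"
    and PQ: "P * Q = 1\<^sub>m k" and W: "W = (\<lambda>c. Q *\<^sub>v c) ` carrier_vec k"
    by (rule subspace_basis_matrix[OF sub zero add smult]) blast
  have step: "\<exists>r\<in>carrier_vec k. L *\<^sub>v v = K *\<^sub>v (Q *\<^sub>v r)" if "v \<in> W" for v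
  proof -
    from that obtain d where d: "traj d" "v = d 0" unfolding W_def by auto
    have "traj (\<lambda>j. d (Suc j))" using d unfolding traj_def by blast
    then have "d 1 \<in> W" unfolding W_def by (intro CollectI exI[of _ "\<lambda>j. d (Suc j)"]) simp
    then have "(-1) \<cdot>\<^sub>v d 1 \<in> W" by (rule smult)
    then obtain r where r: "r \<in> carrier_vec k" "(-1) \<cdot>\<^sub>v d 1 = Q *\<^sub>v r" unfolding W by auto
    have dc: "d j \<in> carrier_vec n" for j using d by (auto simp: traj_def)
    have e: "0\<^sub>v n = L *\<^sub>v d 0 + K *\<^sub>v d 1"
      using d(1) comm_add_vec[of "K *\<^sub>v d 1" n "L *\<^sub>v d 0"] K L dc by (simp add: traj_def)
    have "L *\<^sub>v d 0 = - (K *\<^sub>v d 1)"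
      by (rule eq_uminus_if_add_eq_zero[OF _ _ e]) (use K L dc in auto)
    also have "\<dots> = (-1) \<cdot>\<^sub>v (K *\<^sub>v d 1)" by (intro eq_vecI) auto
    also have "\<dots> = K *\<^sub>v ((-1) \<cdot>\<^sub>v d 1)" using mult_mat_vec[OF K dc] by simp
    finally show ?thesis using r d by auto
  qed
  have "\<exists>r\<in>carrier_vec k. L *\<^sub>v col Q j = K *\<^sub>v (Q *\<^sub>v r)" if "j < k" for j
  proof -
    have "col Q j = Q *\<^sub>v unit_vec k j" using Q that col_mult2[OF Q one_carrier_mat that] by simp
    then have "col Q j \<in> W" unfolding W by auto
    then show ?thesis by (rule step)
  qed
  then obtain r where r: "\<And>j. j < k \<Longrightarrow> r j \<in> carrier_vec k"
    "\<And>j. j < k \<Longrightarrow> L *\<^sub>v col Q j = K *\<^sub>v (Q *\<^sub>v r j)" by metis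
  define R where "R = mat k k (\<lambda>(i,j). r j $ i)"
  have R: "R \<in> carrier_mat k k" by (simp add: R_def)
  have colR: "col R j = r j" if "j < k" for j using r(1)[OF that] that by (intro eq_vecI) (auto simp: R_def)
  have KQ: "K * Q \<in> carrier_mat n k" using K Q by auto
  have LQ: "L * Q = K * Q * R"
  proof (rule mat_col_eqI)
    fix j assume "j < dim_col (K * Q * R)"
    then have j: "j < k" using R by simp
    have "col (L * Q) j = L *\<^sub>v col Q j" by (rule col_mult2[OF L Q j])
    also have "\<dots> = (K * Q) *\<^sub>v col R j"
      using r(2)[OF j] colR[OF j] assoc_mult_mat_vec[OF K Q r(1)[OF j]] by simp
    also have "\<dots> = col (K * Q * R) j" by (rule col_mult2[OF KQ R j, symmetric])
    finally show "col (L * Q) j = col (K * Q * R) j" .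
  qed (use K L Q R in auto)
  define S0 where "S0 = 1\<^sub>m k + q \<cdot>\<^sub>m R"
  have S0: "S0 \<in> carrier_mat k k" unfolding S0_def using R by auto
  have fact: "(K + q \<cdot>\<^sub>m L) * Q = K * Q * S0"
  proof -
    have "(K + q \<cdot>\<^sub>m L) * Q = K * Q + (q \<cdot>\<^sub>m L) * Q" using K L Q by (intro add_mult_distrib_mat) auto
    also have "(q \<cdot>\<^sub>m L) * Q = q \<cdot>\<^sub>m (K * Q * R)" using mult_smult_assoc_mat[OF L Q] LQ by simp
    also have "\<dots> = K * Q * (q \<cdot>\<^sub>m R)" using mult_smult_distrib[OF KQ R] by simp
    also have "K * Q + \<dots> = K * Q * 1\<^sub>m k + K * Q * (q \<cdot>\<^sub>m R)" by (simp only: right_mult_one_mat[OF KQ])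
    also have "\<dots> = K * Q * S0" unfolding S0_def
      using KQ R by (intro mult_add_distrib_mat[symmetric]) auto
    finally show ?thesis .
  qed
  have KqL: "K + q \<cdot>\<^sub>m L \<in> carrier_mat n n" using K L by auto
  have Qinj: "c = 0\<^sub>v k" if "c \<in> carrier_vec k" "(K + q \<cdot>\<^sub>m L) *\<^sub>v (Q *\<^sub>v c) = 0\<^sub>v n" for c
  proof -
    have "Q *\<^sub>v c = 0\<^sub>v n" using reg that Q by auto
    then have "P *\<^sub>v (Q *\<^sub>v c) = 0\<^sub>v k" using P by (auto intro!: eq_vecI)
    then show ?thesis using assoc_mult_mat_vec[OF P Q that(1)] PQ that(1) by simp
  qed
  have "c = 0\<^sub>v k" if c: "c \<in> carrier_vec k" "S0 *\<^sub>v c = 0\<^sub>v k" for c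
  proof (rule Qinj[OF c(1)])
    have "(K + q \<cdot>\<^sub>m L) *\<^sub>v (Q *\<^sub>v c) = (K * Q) *\<^sub>v (S0 *\<^sub>v c)"
      using assoc_mult_mat_vec[OF KqL Q c(1)] assoc_mult_mat_vec[OF KQ S0 c(1)] fact by simp
    also have "\<dots> = 0\<^sub>v n" using c(2) KQ by (intro eq_vecI) (auto simp: scalar_prod_def)
    finally show "(K + q \<cdot>\<^sub>m L) *\<^sub>v (Q *\<^sub>v c) = 0\<^sub>v n" .
  qed
  then obtain S where S: "S \<in> carrier_mat k k" "S0 * S = 1\<^sub>m k"
    using injective_imp_right_inverse[OF S0] by blast
  have KQinj: "c = 0\<^sub>v k" if c: "c \<in> carrier_vec k" "(K * Q) *\<^sub>v c = 0\<^sub>v n" for c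
  proof -
    have Sc: "S *\<^sub>v c \<in> carrier_vec k" using S c by auto
    have SSc: "S0 *\<^sub>v (S *\<^sub>v c) = c" using assoc_mult_mat_vec[OF S0 S(1) c(1)] S c by simp
    have "(K + q \<cdot>\<^sub>m L) *\<^sub>v (Q *\<^sub>v (S *\<^sub>v c)) = (K * Q) *\<^sub>v (S0 *\<^sub>v (S *\<^sub>v c))"
      using assoc_mult_mat_vec[OF KqL Q Sc] assoc_mult_mat_vec[OF KQ S0 Sc] fact by simp
    then have "S *\<^sub>v c = 0\<^sub>v k" using Qinj[OF Sc] SSc c(2) by simp
    then show ?thesis using SSc S0 by (auto intro!: eq_vecI)
  qed
  have range: "Q *\<^sub>v (P *\<^sub>v d 0) = d 0"
    if "\<And>j. d j \<in> carrier_vec n" "\<And>j. K *\<^sub>v d (Suc j) + L *\<^sub>v d j = 0\<^sub>v n" for d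
  proof -
    have "d 0 \<in> W" unfolding W_def traj_def using that by blast
    then obtain c where c: "c \<in> carrier_vec k" "d 0 = Q *\<^sub>v c" unfolding W by auto
    have "P *\<^sub>v d 0 = c" using c assoc_mult_mat_vec[OF P Q c(1)] PQ by simp
    then show ?thesis using c by simp
  qed
  show ?thesis by (rule that[OF k P Q R PQ LQ]) (use KQinj range in blast)+
qed

section \<open>Travel time\<close>

text \<open>
  A function on an interval is constant if its difference quotients tend to zero uniformly. This is how
  identities between integrals with the merely measurable weight \<open>1/lam0\<close> are verified below: such
  integrals need not be differentiable in the classical sense, but small increments can be estimated.
\<close>

lemma eq_if_vanishing_difference_quotients:
  fixes f :: "real \<Rightarrow> complex"
  assumes ab: "a \<le> b"
    and small: "\<And>\<epsilon>. \<epsilon> > 0 \<Longrightarrow> \<exists>d>0. \<forall>x y. a \<le> x \<and> x \<le> y \<and> y \<le> b \<and> y - x < d \<longrightarrow> norm (f y - f x) \<le> \<epsilon> * (y - x)"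
  shows "f a = f b"
proof -
  have "(f has_derivative (\<lambda>h. 0)) (at x within {a..b})" if x: "x \<in> {a..b}" for x
  proof -
    have "\<exists>d>0. \<forall>y\<in>{a..b}. norm (y - x) < d \<longrightarrow> norm (f y - f x - 0) \<le> \<epsilon> * norm (y - x)"
      if "\<epsilon> > 0" for \<epsilon> :: real
    proof -
      obtain d where d: "d > 0" "\<And>x y. a \<le> x \<Longrightarrow> x \<le> y \<Longrightarrow> y \<le> b \<Longrightarrow> y - x < d \<Longrightarrow> norm (f y - f x) \<le> \<epsilon> * (y - x)"
        using small[OF \<open>\<epsilon> > 0\<close>] by blast
      have "norm (f y - f x - 0) \<le> \<epsilon> * norm (y - x)" if "y \<in> {a..b}" "norm (y - x) < d" for y
      proof (cases "x \<le> y")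
        case True then show ?thesis using d(2)[of x y] that x by simp
      next
        case False then show ?thesis using d(2)[of y x] that x by (simp add: norm_minus_commute)
      qed
      then show ?thesis using d(1) by blast
    qed
    then show ?thesis unfolding has_derivative_within_alt by simp
  qed
  then obtain c where "\<And>x. x \<in> {a..b} \<Longrightarrow> f x = c"
    using has_derivative_zero_constant[of "{a..b}" f] by auto
  then show ?thesis using ab by simp
qed

lemma continuous_primitive_zero_imp_zero:
  fixes f :: "real \<Rightarrow> complex"
  assumes cont: "continuous_on {0..} f" and zero: "\<And>u. u \<ge> 0 \<Longrightarrow> integral {0..u} f = 0" and t: "t \<ge> 0"
  shows "f t = 0"
proof -
  have c: "continuous_on {0..t+1} f" by (rule continuous_on_subset[OF cont]) auto
  have "((\<lambda>u. integral {0..u} f) has_vector_derivative f t) (at t within {0..t+1})"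
    by (rule integral_has_vector_derivative[OF c]) (use t in auto)
  moreover have "((\<lambda>u. integral {0..u} f) has_vector_derivative 0) (at t within {0..t+1})"
    by (rule has_vector_derivative_transform[where f="\<lambda>_. 0"]) (use t zero in auto)
  ultimately show ?thesis
    using vector_derivative_unique_within_closed_interval[of 0 "t+1" t "\<lambda>u. integral {0..u} f" "f t" 0] t
    by simp
qed

text \<open>
  The slowness \<open>\<kappa> = 1/lam0\<close>. Passing to a Borel representative on the whole line with bounds everywhere,
  instead of almost everywhere on \<open>(0,1)\<close>, makes the travel time \<open>\<tau>\<close> a bi-Lipschitz homeomorphism of the
  line, so that the change of variables by \<open>\<tau>\<close> is an identity between Borel measures.
\<close>

locale slowness =
  fixes \<kappa> :: "real \<Rightarrow> real" and \<alpha> \<beta> :: real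
  assumes kappa_borel[measurable]: "\<kappa> \<in> borel_measurable borel"
    and alpha_pos: "0 < \<alpha>" and kappa_ge: "\<And>x. \<alpha> \<le> \<kappa> x" and kappa_le: "\<And>x. \<kappa> x \<le> \<beta>"
begin

lemma beta_pos: "0 < \<beta>" using alpha_pos kappa_ge[of 0] kappa_le[of 0] by linarith

lemma kappa_pos: "0 < \<kappa> x" using alpha_pos kappa_ge[of x] by linarith

lemma kappa_abs_integrable: "\<kappa> absolutely_integrable_on {x..y}"
proof (rule measurable_bounded_by_integrable_imp_absolutely_integrable)
  show "\<kappa> \<in> borel_measurable (lebesgue_on {x..y})"
    by (intro measurable_restrict_space1 measurable_completion) simp
  show "norm (\<kappa> u) \<le> \<beta>" for u using kappa_pos[of u] kappa_le[of u] by simp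
qed auto

lemma kappa_integrable: "\<kappa> integrable_on {x..y}"
  using kappa_abs_integrable absolutely_integrable_on_def by blast

definition \<tau> :: "real \<Rightarrow> real" where
  "\<tau> x = (if 0 \<le> x then integral {0..x} \<kappa> else - integral {x..0} \<kappa>)"

lemma tau_diff: "x \<le> y \<Longrightarrow> \<tau> y - \<tau> x = integral {x..y} \<kappa>"
  using Henstock_Kurzweil_Integration.integral_combine[of 0 x y \<kappa>]
    Henstock_Kurzweil_Integration.integral_combine[of x 0 y \<kappa>]
    Henstock_Kurzweil_Integration.integral_combine[of x y 0 \<kappa>] kappa_integrable
  by (auto simp: \<tau>_def)

lemma tau_zero [simp]: "\<tau> 0 = 0" by (simp add: \<tau>_def)

lemma tau_lower: "x \<le> y \<Longrightarrow> \<alpha> * (y - x) \<le> \<tau> y - \<tau> x"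
  using integral_le[OF integrable_const_ivl kappa_integrable kappa_ge, of x y]
  by (simp add: tau_diff mult.commute)

lemma tau_upper: "x \<le> y \<Longrightarrow> \<tau> y - \<tau> x \<le> \<beta> * (y - x)"
  using integral_le[OF kappa_integrable integrable_const_ivl kappa_le, of x y]
  by (simp add: tau_diff mult.commute)

lemma tau_less: "x < y \<Longrightarrow> \<tau> x < \<tau> y"
  using tau_lower[of x y] alpha_pos by (smt (verit) mult_pos_pos)

lemma tau_less_iff [simp]: "\<tau> x < \<tau> y \<longleftrightarrow> x < y"
  using tau_less by (metis linorder_neqE order_less_asym less_irrefl)

lemma tau_le_iff [simp]: "\<tau> x \<le> \<tau> y \<longleftrightarrow> x \<le> y"
  by (metis not_less tau_less_iff)

lemma tau_dist: "\<bar>\<tau> y - \<tau> x\<bar> \<le> \<beta> * \<bar>y - x\<bar>"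
  using tau_upper[of x y] tau_upper[of y x] tau_le_iff[of x y] tau_le_iff[of y x]
  by (cases "x \<le> y") (auto simp del: tau_le_iff)

lemma tau_continuous: "continuous_on S \<tau>"
proof -
  have "\<beta>-lipschitz_on UNIV \<tau>"
    using tau_dist beta_pos by (intro lipschitz_onI) (auto simp: dist_real_def)
  then show ?thesis using lipschitz_on_continuous_on continuous_on_subset by blast
qed

lemma tau_borel [measurable]: "\<tau> \<in> borel_measurable borel"
  by (rule borel_measurable_continuous_onI[OF tau_continuous])

lemma tau_surj: "\<exists>x. \<tau> x = r"
proof -
  define c where "c = \<bar>r\<bar> / \<alpha>"
  have c: "0 \<le> c" "\<alpha> * c = \<bar>r\<bar>" using alpha_pos by (auto simp: c_def)
  have "\<tau> (-c) \<le> r" "r \<le> \<tau> c" using tau_lower[of "-c" 0] tau_lower[of 0 c] c by auto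
  then show ?thesis using IVT'[of \<tau> "-c" r c] tau_continuous c by auto
qed

definition \<sigma> :: "real \<Rightarrow> real" where "\<sigma> r = (THE x. \<tau> x = r)"

lemma tau_inj: "\<tau> x = \<tau> y \<longleftrightarrow> x = y"
  by (metis tau_less_iff linorder_neqE less_irrefl)

lemma tau_sigma [simp]: "\<tau> (\<sigma> r) = r"
proof -
  obtain x where "\<tau> x = r" using tau_surj by blast
  then have "(THE x. \<tau> x = r) = x" using tau_inj by (intro the_equality) auto
  then show ?thesis unfolding \<sigma>_def using \<open>\<tau> x = r\<close> by simp
qed

lemma sigma_tau [simp]: "\<sigma> (\<tau> x) = x"
  using tau_inj tau_sigma by blast

lemma sigma_borel [measurable]: "\<sigma> \<in> borel_measurable borel"
  by (rule borel_measurable_mono) (metis monoI tau_le_iff tau_sigma)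

text \<open>
  Both measures agree on intervals, by the definition of \<open>\<tau>\<close>. As \<open>\<tau>\<close> is only
  Lipschitz, substitution is done through this identity of measures.
\<close>

lemma pushforward: "distr (density lborel (\<lambda>x. ennreal (\<kappa> x))) borel \<tau> = lborel"
proof (rule sym, rule lborel_eqI)
  fix l u :: real assume "\<And>b. b \<in> Basis \<Longrightarrow> l \<bullet> b \<le> u \<bullet> b"
  then have lu: "l \<le> u" by simp
  have "emeasure (distr (density lborel (\<lambda>x. ennreal (\<kappa> x))) borel \<tau>) (box l u)
      = emeasure (density lborel (\<lambda>x. ennreal (\<kappa> x))) (\<tau> -` {l<..<u})"
    by (subst emeasure_distr) auto
  also have "\<tau> -` {l<..<u} = {\<sigma> l<..<\<sigma> u}"
    using tau_less_iff[of "\<sigma> l"] tau_less_iff[of _ "\<sigma> u"] by auto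
  also have "emeasure (density lborel (\<lambda>x. ennreal (\<kappa> x))) {\<sigma> l<..<\<sigma> u}
      = (\<integral>\<^sup>+ x. ennreal (\<kappa> x) * indicator {\<sigma> l<..<\<sigma> u} x \<partial>lborel)"
    by (subst emeasure_density) auto
  also have "\<dots> = ennreal (integral {\<sigma> l<..<\<sigma> u} \<kappa>)"
  proof -
    have "(\<integral>\<^sup>+ x. ennreal (\<kappa> x) * indicator {\<sigma> l<..<\<sigma> u} x \<partial>lborel)
        = (\<integral>\<^sup>+ x. ennreal (\<kappa> x * indicator {\<sigma> l<..<\<sigma> u} x) \<partial>lborel)"
      by (intro nn_integral_cong) (auto simp: indicator_def)
    also have "\<dots> = ennreal (integral {\<sigma> l<..<\<sigma> u} \<kappa>)"
    proof (rule nn_integral_has_integral_lborel)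
      have "(\<kappa> has_integral integral {\<sigma> l<..<\<sigma> u} \<kappa>) {\<sigma> l<..<\<sigma> u}"
        using kappa_integrable integrable_on_Icc_iff_Ioo by blast
      then have "((\<lambda>x. if x \<in> {\<sigma> l<..<\<sigma> u} then \<kappa> x else 0) has_integral integral {\<sigma> l<..<\<sigma> u} \<kappa>) UNIV"
        by (simp only: has_integral_restrict_UNIV)
      then show "((\<lambda>x. \<kappa> x * indicator {\<sigma> l<..<\<sigma> u} x) has_integral integral {\<sigma> l<..<\<sigma> u} \<kappa>) UNIV"
        by (rule has_integral_eq[rotated]) (auto simp: indicator_def)
      show "0 \<le> \<kappa> x * indicator {\<sigma> l<..<\<sigma> u} x" for x using kappa_pos[of x] by (simp add: indicator_def)
    qed simp
    finally show ?thesis .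
  qed
  also have "integral {\<sigma> l<..<\<sigma> u} \<kappa> = u - l"
    using tau_diff[of "\<sigma> l" "\<sigma> u"] lu tau_le_iff[of "\<sigma> l" "\<sigma> u"]
    by (simp add: integral_open_interval_real)
  finally show "emeasure (distr (density lborel (\<lambda>x. ennreal (\<kappa> x))) borel \<tau>) (box l u)
      = ennreal (\<Prod>b\<in>Basis. (u - l) \<bullet> b)" by simp
qed simp

lemma lborel_integral_tau:
  fixes F :: "real \<Rightarrow> 'a::euclidean_space"
  assumes [measurable]: "F \<in> borel_measurable borel"
  shows "(\<integral>y. \<kappa> y *\<^sub>R F (\<tau> y) \<partial>lborel) = (\<integral>r. F r \<partial>lborel)"
    and "integrable lborel (\<lambda>y. \<kappa> y *\<^sub>R F (\<tau> y)) \<longleftrightarrow> integrable lborel F"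
proof -
  have "(\<integral>r. F r \<partial>lborel) = (\<integral>y. F (\<tau> y) \<partial>density lborel (\<lambda>x. ennreal (\<kappa> x)))"
    by (subst pushforward[symmetric], subst integral_distr) auto
  also have "\<dots> = (\<integral>y. \<kappa> y *\<^sub>R F (\<tau> y) \<partial>lborel)"
    by (subst integral_density) (auto intro: less_imp_le kappa_pos)
  finally show "(\<integral>y. \<kappa> y *\<^sub>R F (\<tau> y) \<partial>lborel) = (\<integral>r. F r \<partial>lborel)" ..
  have "integrable lborel F \<longleftrightarrow> integrable (density lborel (\<lambda>x. ennreal (\<kappa> x))) (\<lambda>y. F (\<tau> y))"
    by (subst pushforward[symmetric], subst integrable_distr_eq) auto
  also have "\<dots> \<longleftrightarrow> integrable lborel (\<lambda>y. \<kappa> y *\<^sub>R F (\<tau> y))"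
    by (subst integrable_density) (auto intro: less_imp_le kappa_pos)
  finally show "integrable lborel (\<lambda>y. \<kappa> y *\<^sub>R F (\<tau> y)) \<longleftrightarrow> integrable lborel F" ..
qed

end

section \<open>Constancy along characteristics\<close>

context slowness begin

lemma kappa_continuous_abs_integrable:
  fixes f :: "real \<Rightarrow> complex"
  assumes f: "continuous_on {x..y} f"
  shows "(\<lambda>\<eta>. \<kappa> \<eta> *\<^sub>R f \<eta>) absolutely_integrable_on {x..y}"
proof -
  have "compact (f ` {x..y})" using f by (intro compact_continuous_image) auto
  then obtain C where C: "\<And>\<eta>. \<eta> \<in> {x..y} \<Longrightarrow> norm (f \<eta>) \<le> C"
    using compact_imp_bounded bounded_iff by (metis imageI)
  show ?thesis
  proof (rule measurable_bounded_by_integrable_imp_absolutely_integrable)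
    have "\<kappa> \<in> borel_measurable (lebesgue_on {x..y})"
      by (intro measurable_restrict_space1 measurable_completion) simp
    moreover have "f \<in> borel_measurable (lebesgue_on {x..y})"
      by (rule continuous_imp_measurable_on_sets_lebesgue[OF f]) simp
    ultimately show "(\<lambda>\<eta>. \<kappa> \<eta> *\<^sub>R f \<eta>) \<in> borel_measurable (lebesgue_on {x..y})"
      by (rule borel_measurable_scaleR)
    show "norm (\<kappa> \<eta> *\<^sub>R f \<eta>) \<le> \<beta> * C" if "\<eta> \<in> {x..y}" for \<eta>
      using mult_mono[OF kappa_le[of \<eta>] C[OF that]] beta_pos kappa_pos[of \<eta>] by simp
  qed auto
qed

lemma kappa_continuous_integrable:
  fixes f :: "real \<Rightarrow> complex"
  assumes f: "continuous_on {x..y} f"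
  shows "(\<lambda>\<eta>. \<kappa> \<eta> *\<^sub>R f \<eta>) integrable_on {x..y}"
  using kappa_continuous_abs_integrable[OF f] absolutely_integrable_on_def by blast

lemma integral_kappa_scaleR_const:
  "x \<le> y \<Longrightarrow> ((\<lambda>\<eta>. \<kappa> \<eta> *\<^sub>R c) has_integral (\<tau> y - \<tau> x) *\<^sub>R c) {x..y}" for c :: complex
  using has_integral_scaleR_left[of \<kappa> "integral {x..y} \<kappa>" "{x..y}" c] kappa_integrable[of x y]
  by (simp add: tau_diff has_integral_integral)

text \<open>
  A step of travel time \<open>\<tau> y' - \<tau> y\<close> in space and the same step in time contribute almost equally if both
  integrands are close to one constant.
\<close>

lemma corner_estimate:
  fixes f g :: "real \<Rightarrow> complex"
  assumes yy: "y \<le> y'" and p': "p' = p + (\<tau> y' - \<tau> y)"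
    and f: "continuous_on {y..y'} f" and g: "continuous_on {p..p'} g"
    and fc: "\<And>\<eta>. \<eta> \<in> {y..y'} \<Longrightarrow> norm (f \<eta> - c) \<le> \<epsilon>"
    and gc: "\<And>s. s \<in> {p..p'} \<Longrightarrow> norm (g s - c) \<le> \<epsilon>"
  shows "norm (integral {y..y'} (\<lambda>\<eta>. \<kappa> \<eta> *\<^sub>R f \<eta>) - integral {p..p'} g) \<le> 2 * \<epsilon> * (\<tau> y' - \<tau> y)"
proof -
  have pp: "p \<le> p'" using p' yy by simp
  have k: "((\<lambda>\<eta>. \<kappa> \<eta> *\<^sub>R (f \<eta> - c)) has_integral
      (integral {y..y'} (\<lambda>\<eta>. \<kappa> \<eta> *\<^sub>R f \<eta>) - (\<tau> y' - \<tau> y) *\<^sub>R c)) {y..y'}"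
    unfolding scaleR_diff_right
    by (intro has_integral_diff integrable_integral kappa_continuous_integrable f integral_kappa_scaleR_const yy)
  have ke: "((\<lambda>\<eta>. \<kappa> \<eta> * \<epsilon>) has_integral (\<tau> y' - \<tau> y) * \<epsilon>) {y..y'}"
    using has_integral_mult_left[of \<kappa> "integral {y..y'} \<kappa>" "{y..y'}" \<epsilon>] kappa_integrable[of y y'] yy
    by (simp add: tau_diff has_integral_integral)
  have 1: "norm (integral {y..y'} (\<lambda>\<eta>. \<kappa> \<eta> *\<^sub>R f \<eta>) - (\<tau> y' - \<tau> y) *\<^sub>R c) \<le> (\<tau> y' - \<tau> y) * \<epsilon>"
  proof -
    have "norm (integral {y..y'} (\<lambda>\<eta>. \<kappa> \<eta> *\<^sub>R (f \<eta> - c))) \<le> integral {y..y'} (\<lambda>\<eta>. \<kappa> \<eta> * \<epsilon>)"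
      using k ke by (intro integral_norm_bound_integral)
        (auto simp: abs_of_pos[OF kappa_pos] intro!: mult_left_mono fc less_imp_le[OF kappa_pos])
    then show ?thesis unfolding integral_unique[OF k] integral_unique[OF ke] .
  qed
  have g': "((\<lambda>s. g s - c) has_integral (integral {p..p'} g - (p' - p) *\<^sub>R c)) {p..p'}"
    using has_integral_const_real[of c p p'] pp
    by (intro has_integral_diff integrable_integral integrable_continuous_real g) simp
  have 2: "norm (integral {p..p'} g - (p' - p) *\<^sub>R c) \<le> (p' - p) * \<epsilon>"
  proof -
    have "norm (integral {p..p'} (\<lambda>s. g s - c)) \<le> integral {p..p'} (\<lambda>s. \<epsilon>)"
      using g' by (intro integral_norm_bound_integral) (auto intro: gc)
    then show ?thesis using integral_unique[OF g'] pp by simp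
  qed
  have "norm (integral {y..y'} (\<lambda>\<eta>. \<kappa> \<eta> *\<^sub>R f \<eta>) - integral {p..p'} g)
     = norm ((integral {y..y'} (\<lambda>\<eta>. \<kappa> \<eta> *\<^sub>R f \<eta>) - (\<tau> y' - \<tau> y) *\<^sub>R c) - (integral {p..p'} g - (p' - p) *\<^sub>R c))"
    using p' by simp
  also have "\<dots> \<le> (\<tau> y' - \<tau> y) * \<epsilon> + (p' - p) * \<epsilon>" using norm_triangle_ineq4 1 2 by (meson add_mono order_trans)
  also have "\<dots> = 2 * \<epsilon> * (\<tau> y' - \<tau> y)" using p' by simp
  finally show ?thesis .
qed

text \<open>
  For smooth \<open>E\<close> the hypothesis \<open>rect\<close> is the integral over a rectangle of \<open>\<partial>\<^sub>t E + \<partial>\<^sub>\<tau> E = 0\<close>, whose solutions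
  are functions of \<open>t - \<tau>(x)\<close>. In the given generality, integrate \<open>E\<close> over the time window of length \<open>u\<close>
  that moves along the characteristic through \<open>(0,x)\<close>, giving \<open>\<Psi> y\<close> at position \<open>y\<close>. By the hypothesis,
  \<open>\<Psi> y' - \<Psi> y\<close> is a difference of two quantities estimated in \<open>corner_estimate\<close>, one for each end of the
  window, and is thus small compared to \<open>y' - y\<close>. So \<open>\<Psi>\<close> is constant for every \<open>u\<close>.
\<close>

lemma constant_along_characteristics:
  fixes E :: "real \<Rightarrow> real \<Rightarrow> complex"
  assumes cont: "continuous_on ({0..} \<times> {0..1}) (\<lambda>q. E (fst q) (snd q))"
    and rect: "\<And>t x. 0 \<le> t \<Longrightarrow> x \<in> {0..1} \<Longrightarrow>
      integral {0..x} (\<lambda>y. \<kappa> y *\<^sub>R (E 0 y - E t y)) = integral {0..t} (\<lambda>s. E s x - E s 0)"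
    and t: "0 \<le> t" and x: "x \<in> {0..1}"
  shows "E t x = E (t + (\<tau> 1 - \<tau> x)) 1"
proof -
  have cs: "continuous_on {0..} (\<lambda>s. E s y)" if "y \<in> {0..1}" for y
    by (rule continuous_on_compose2[OF cont, of _ "\<lambda>s. (s, y)", simplified]) (use that in \<open>auto intro!: continuous_intros\<close>)
  have cx: "continuous_on {0..1} (E s)" if "0 \<le> s" for s
    by (rule continuous_on_compose2[OF cont, of _ "\<lambda>y. (s, y)", simplified]) (use that in \<open>auto intro!: continuous_intros\<close>)
  have cs': "continuous_on {p..q} (\<lambda>s. E s y)" if "y \<in> {0..1}" "0 \<le> p" for y p q
    by (rule continuous_on_subset[OF cs]) (use that in auto)
  have cx': "continuous_on {y..y'} (E s)" if "0 \<le> s" "0 \<le> y" "y' \<le> 1" for s y y'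
    by (rule continuous_on_subset[OF cx]) (use that in auto)
  have ints: "(\<lambda>s. E s y) integrable_on {p..q}" if "y \<in> {0..1}" "0 \<le> p" for y p q
    by (rule integrable_continuous_real[OF cs'[OF that]])
  have intx: "(\<lambda>\<eta>. \<kappa> \<eta> *\<^sub>R E s \<eta>) integrable_on {y..y'}" if "0 \<le> s" "0 \<le> y" "y' \<le> 1" for s y y'
    by (rule kappa_continuous_integrable[OF cx'[OF that]])
  have rect0: "integral {0..y} (\<lambda>\<eta>. \<kappa> \<eta> *\<^sub>R E 0 \<eta>) - integral {0..y} (\<lambda>\<eta>. \<kappa> \<eta> *\<^sub>R E s \<eta>)
      = integral {0..s} (\<lambda>s. E s y) - integral {0..s} (\<lambda>s. E s 0)" if "0 \<le> s" "y \<in> {0..1}" for s y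
    using rect[OF that] that intx[of 0 0 y] intx[of s 0 y] ints[of y 0 s] ints[of 0 0 s]
    by (simp add: scaleR_diff_right Henstock_Kurzweil_Integration.integral_diff)
  \<comment> \<open>differences of the hypothesis over arbitrary rectangles\<close>
  have R: "integral {p..q} (\<lambda>s. E s y') - integral {p..q} (\<lambda>s. E s y)
      = integral {y..y'} (\<lambda>\<eta>. \<kappa> \<eta> *\<^sub>R E p \<eta>) - integral {y..y'} (\<lambda>\<eta>. \<kappa> \<eta> *\<^sub>R E q \<eta>)"
    if "0 \<le> p" "p \<le> q" "0 \<le> y" "y \<le> y'" "y' \<le> 1" for p q y y'
  proof -
    have c: "integral {0..p} (\<lambda>s. E s z) + integral {p..q} (\<lambda>s. E s z) = integral {0..q} (\<lambda>s. E s z)"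
      if "z \<in> {0..1}" for z
      using \<open>0 \<le> p\<close> \<open>p \<le> q\<close> ints[OF that, of 0 q] by (intro Henstock_Kurzweil_Integration.integral_combine) auto
    have d: "integral {0..y} (\<lambda>\<eta>. \<kappa> \<eta> *\<^sub>R E s \<eta>) + integral {y..y'} (\<lambda>\<eta>. \<kappa> \<eta> *\<^sub>R E s \<eta>)
        = integral {0..y'} (\<lambda>\<eta>. \<kappa> \<eta> *\<^sub>R E s \<eta>)" if "0 \<le> s" for s
      using \<open>0 \<le> y\<close> \<open>y \<le> y'\<close> \<open>y' \<le> 1\<close> intx[OF that, of 0 y']
      by (intro Henstock_Kurzweil_Integration.integral_combine) auto
    have Es: "integral {p..q} (\<lambda>s. E s u) = integral {0..q} (\<lambda>s. E s u) - integral {0..p} (\<lambda>s. E s u)"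
      if "u \<in> {0..1}" for u
      using c[OF that] by (simp add: eq_diff_eq add.commute)
    have Ex: "integral {y..y'} (\<lambda>\<eta>. \<kappa> \<eta> *\<^sub>R E s \<eta>)
        = integral {0..y'} (\<lambda>\<eta>. \<kappa> \<eta> *\<^sub>R E s \<eta>) - integral {0..y} (\<lambda>\<eta>. \<kappa> \<eta> *\<^sub>R E s \<eta>)" if "0 \<le> s" for s
      using d[OF that] by (simp add: eq_diff_eq add.commute)
    have E0: "integral {0..u} (\<lambda>\<eta>. \<kappa> \<eta> *\<^sub>R E s \<eta>) = integral {0..u} (\<lambda>\<eta>. \<kappa> \<eta> *\<^sub>R E 0 \<eta>)
        - (integral {0..s} (\<lambda>s. E s u) - integral {0..s} (\<lambda>s. E s 0))" if "0 \<le> s" "u \<in> {0..1}" for s u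
      unfolding rect0[OF that, symmetric] by simp
    have q: "0 \<le> q" and y: "y \<in> {0..1}" and y': "y' \<in> {0..1}" using that by auto
    show ?thesis
      unfolding Es[OF y] Es[OF y'] Ex[OF \<open>0 \<le> p\<close>] Ex[OF q] E0[OF \<open>0 \<le> p\<close> y] E0[OF \<open>0 \<le> p\<close> y'] E0[OF q y] E0[OF q y']
      by simp
  qed
  define \<theta> where "\<theta> y = \<tau> y - \<tau> x" for y
  have th: "0 \<le> \<theta> y" if "x \<le> y" for y using that by (simp add: \<theta>_def)
  have key: "integral {0..u} (\<lambda>s. E (s + \<theta> 1) 1 - E s x) = 0" if u: "0 \<le> u" for u
  proof -
    define \<Psi> where "\<Psi> y = integral {\<theta> y..u + \<theta> y} (\<lambda>s. E s y)" for y
    have "\<Psi> x = \<Psi> 1"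
    proof (rule eq_if_vanishing_difference_quotients)
      show "x \<le> 1" using x by simp
      fix \<epsilon> :: real assume \<epsilon>: "\<epsilon> > 0"
      define \<epsilon>' where "\<epsilon>' = \<epsilon> / (4 * \<beta>)"
      have e': "\<epsilon>' > 0" using \<epsilon> beta_pos by (simp add: \<epsilon>'_def)
      define T where "T = u + \<theta> 1"
      have "uniformly_continuous_on ({0..T} \<times> {0..1}) (\<lambda>q. E (fst q) (snd q))"
        by (intro compact_uniformly_continuous continuous_on_subset[OF cont] compact_Times) auto
      then obtain d where d: "d > 0" "\<And>q q'. q \<in> {0..T} \<times> {0..1} \<Longrightarrow> q' \<in> {0..T} \<times> {0..1} \<Longrightarrow> dist q' q < d \<Longrightarrow>
          dist (E (fst q') (snd q')) (E (fst q) (snd q)) < \<epsilon>'"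
        unfolding uniformly_continuous_on_def using e' by metis
      have dE: "norm (E s' y - E s y) \<le> \<epsilon>'" if "s \<in> {0..T}" "s' \<in> {0..T}" "y \<in> {0..1}" "\<bar>s' - s\<bar> < d" for s s' y
        using d(2)[of "(s,y)" "(s',y)"] that by (simp add: dist_Pair_Pair dist_norm)
      have dE': "norm (E s y' - E s y) \<le> \<epsilon>'" if "s \<in> {0..T}" "y \<in> {0..1}" "y' \<in> {0..1}" "\<bar>y' - y\<bar> < d" for s y y'
        using d(2)[of "(s,y)" "(s,y')"] that by (simp add: dist_Pair_Pair dist_norm)
      define d' where "d' = min d (d / \<beta>)"
      have "norm (\<Psi> y' - \<Psi> y) \<le> \<epsilon> * (y' - y)" if y: "x \<le> y" "y \<le> y'" "y' \<le> 1" "y' - y < d'" for y y'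
      proof -
        let ?p = "\<theta> y" let ?p' = "\<theta> y'"
        have y01: "0 \<le> y" "y \<in> {0..1}" "y' \<in> {0..1}" using y x by auto
        have p: "0 \<le> ?p" "?p \<le> ?p'" "?p' \<le> \<theta> 1" using y th by (auto simp: \<theta>_def)
        have pd: "?p' - ?p < d"
        proof -
          have "?p' - ?p \<le> \<beta> * (y' - y)" using tau_upper[OF y(2)] by (simp add: \<theta>_def)
          also have "\<dots> < \<beta> * (d / \<beta>)" using y(4) beta_pos by (intro mult_strict_left_mono) (auto simp: d'_def)
          finally show ?thesis using beta_pos by simp
        qed
        have yd: "y' - y < d" using y(4) by (simp add: d'_def)
        have corner: "norm (integral {y..y'} (\<lambda>\<eta>. \<kappa> \<eta> *\<^sub>R E (v + ?p') \<eta>) - integral {v + ?p..v + ?p'} (\<lambda>s. E s y))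
            \<le> 2 * \<epsilon>' * (\<tau> y' - \<tau> y)" if v: "v \<in> {0..u}" for v
        proof (rule corner_estimate[where c = "E (v + ?p') y"])
          show "v + ?p' = v + ?p + (\<tau> y' - \<tau> y)" by (simp add: \<theta>_def)
          show "continuous_on {y..y'} (E (v + ?p'))" using p v y01 y by (intro cx') auto
          show "continuous_on {v + ?p..v + ?p'} (\<lambda>s. E s y)" using p v y01 by (intro cs') auto
          show "norm (E (v + ?p') \<eta> - E (v + ?p') y) \<le> \<epsilon>'" if "\<eta> \<in> {y..y'}" for \<eta>
            by (rule dE') (use p v y01 y that yd T_def in auto)
          show "norm (E s y - E (v + ?p') y) \<le> \<epsilon>'" if "s \<in> {v + ?p..v + ?p'}" for s
            by (rule dE) (use p v y01 y that pd T_def in auto)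
        qed (use y in auto)
        have c1: "integral {?p..?p'} (\<lambda>s. E s y) + integral {?p'..u + ?p'} (\<lambda>s. E s y) = integral {?p..u + ?p'} (\<lambda>s. E s y)"
          using p u y01 ints by (intro Henstock_Kurzweil_Integration.integral_combine) auto
        have c2: "integral {?p..u + ?p} (\<lambda>s. E s y) + integral {u + ?p..u + ?p'} (\<lambda>s. E s y) = integral {?p..u + ?p'} (\<lambda>s. E s y)"
          using p u y01 ints by (intro Henstock_Kurzweil_Integration.integral_combine) auto
        have "\<Psi> y' - \<Psi> y = (integral {y..y'} (\<lambda>\<eta>. \<kappa> \<eta> *\<^sub>R E (0 + ?p') \<eta>) - integral {0 + ?p..0 + ?p'} (\<lambda>s. E s y))
          - (integral {y..y'} (\<lambda>\<eta>. \<kappa> \<eta> *\<^sub>R E (u + ?p') \<eta>) - integral {u + ?p..u + ?p'} (\<lambda>s. E s y))"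
          using R[of ?p' "u + ?p'" y y'] c1 c2 p u y y01 unfolding \<Psi>_def
          by (simp add: algebra_simps)
        also have "norm \<dots> \<le> 2 * \<epsilon>' * (\<tau> y' - \<tau> y) + 2 * \<epsilon>' * (\<tau> y' - \<tau> y)"
          by (rule order_trans[OF norm_triangle_ineq4 add_mono]) (use corner[of 0] corner[of u] u in auto)
        also have "\<dots> = 4 * \<epsilon>' * (\<tau> y' - \<tau> y)" by simp
        also have "\<dots> \<le> 4 * \<epsilon>' * (\<beta> * (y' - y))" using e' by (intro mult_left_mono tau_upper y) auto
        also have "\<dots> = \<epsilon> * (y' - y)" using beta_pos by (simp add: \<epsilon>'_def)
        finally show ?thesis .
      qed
      moreover have "d' > 0" using d(1) beta_pos by (simp add: d'_def)
      ultimately show "\<exists>d>0. \<forall>y y'. x \<le> y \<and> y \<le> y' \<and> y' \<le> 1 \<and> y' - y < d \<longrightarrow> norm (\<Psi> y' - \<Psi> y) \<le> \<epsilon> * (y' - y)"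
        by blast
    qed
    moreover have "\<Psi> x = integral {0..u} (\<lambda>s. E s x)" by (simp add: \<Psi>_def \<theta>_def)
    moreover have "\<Psi> 1 = integral {0..u} (\<lambda>s. E (s + \<theta> 1) 1)"
      unfolding \<Psi>_def using integral_shift_Icc_real[of 0 u "\<lambda>s. E s 1" "\<theta> 1"]
      by (simp add: o_def add.commute)
    moreover have "(\<lambda>s. E (s + \<theta> 1) 1) integrable_on {0..u}"
      by (intro integrable_continuous_real continuous_on_compose2[OF cs[of 1], of _ "\<lambda>s. s + \<theta> 1"])
        (use th[of 1] x in \<open>auto intro!: continuous_intros\<close>)
    ultimately show ?thesis using ints[OF x, of 0 u] by (simp add: Henstock_Kurzweil_Integration.integral_diff)
  qed
  have "continuous_on {0..} (\<lambda>s. E (s + \<theta> 1) 1 - E s x)"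
    by (intro continuous_on_diff cs[OF x] continuous_on_compose2[OF cs[of 1], of _ "\<lambda>s. s + \<theta> 1"])
      (use th[of 1] x in \<open>auto intro!: continuous_intros\<close>)
  from continuous_primitive_zero_imp_zero[OF this key t] show ?thesis by (simp add: \<theta>_def)
qed

end

section \<open>Square integrable functions on the unit interval\<close>

definition sq_int :: "(real \<Rightarrow> complex) \<Rightarrow> bool" where
  "sq_int f \<longleftrightarrow> f \<in> borel_measurable unit_measure \<and>
     integrable unit_measure (\<lambda>x. (cmod (f x))\<^sup>2)"

definition energy :: "(real \<Rightarrow> complex) \<Rightarrow> real" where
  "energy f = (\<integral>x. (cmod (f x))\<^sup>2 \<partial>unit_measure)"

lemma energy_nonneg: "0 \<le> energy f" unfolding energy_def by simp

lemma unit_measure_finite: "finite_measure unit_measure"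
  by (rule finite_measure_lebesgue_on) simp

lemma measure_unit [simp]: "measure unit_measure {0<..<1} = 1"
  by (simp add: measure_restrict_space)

lemma cmod_add_squared_le: "(cmod (a + b))\<^sup>2 \<le> 2 * (cmod a)\<^sup>2 + 2 * (cmod b)\<^sup>2"
proof -
  have "(cmod (a + b))\<^sup>2 \<le> (cmod a + cmod b)\<^sup>2" by (intro power_mono norm_triangle_ineq) simp
  also have "\<dots> \<le> 2 * (cmod a)\<^sup>2 + 2 * (cmod b)\<^sup>2"
    using sum_squares_bound[of "cmod a" "cmod b"] unfolding power2_sum by linarith
  finally show ?thesis .
qed

lemma cmod_le_one_plus_squared: "cmod a \<le> norm (1 + (cmod a)\<^sup>2)"
proof -
  have "2 * cmod a \<le> 1 + (cmod a)\<^sup>2" using sum_squares_bound[of 1 "cmod a"] by simp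
  then show ?thesis by simp (smt (verit) norm_ge_zero)
qed

lemma sq_int_measurable: "sq_int f \<Longrightarrow> f \<in> borel_measurable unit_measure"
  by (simp add: sq_int_def)

lemma sq_int_cmult: "sq_int f \<Longrightarrow> sq_int (\<lambda>x. c * f x)"
  by (auto simp: sq_int_def norm_mult power_mult_distrib)

lemma sq_int_add: assumes "sq_int f" "sq_int g" shows "sq_int (\<lambda>x. f x + g x)"
proof -
  have [measurable]: "f \<in> borel_measurable unit_measure" "g \<in> borel_measurable unit_measure"
    using assms by (auto simp: sq_int_def)
  have b: "norm ((cmod (f x + g x))\<^sup>2) \<le> norm (2 * (cmod (f x))\<^sup>2 + 2 * (cmod (g x))\<^sup>2)" for x
    using cmod_add_squared_le[of "f x" "g x"] by (metis abs_of_nonneg order_trans real_norm_def zero_le_power2)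
  have "integrable unit_measure (\<lambda>x. 2 * (cmod (f x))\<^sup>2 + 2 * (cmod (g x))\<^sup>2)"
    using assms unfolding sq_int_def by (intro Bochner_Integration.integrable_add integrable_mult_right) auto
  then have "integrable unit_measure (\<lambda>x. (cmod (f x + g x))\<^sup>2)"
    by (rule Bochner_Integration.integrable_bound) (measurable, rule AE_I2, rule b)
  then show ?thesis by (simp add: sq_int_def)
qed

lemma sq_int_diff: assumes "sq_int f" "sq_int g" shows "sq_int (\<lambda>x. f x - g x)"
  using sq_int_add[OF assms(1) sq_int_cmult[OF assms(2), of "-1"]] by simp

lemma sq_int_zero: "sq_int (\<lambda>x. 0)" by (simp add: sq_int_def)

lemma sq_int_sum:
  assumes "\<And>i. i \<in> I \<Longrightarrow> sq_int (f i)" shows "sq_int (\<lambda>x. \<Sum>i\<in>I. f i x)"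
  using assms by (induct I rule: infinite_finite_induct) (auto intro: sq_int_zero sq_int_add)

lemma sq_int_integrable: assumes "sq_int f" shows "integrable unit_measure f"
proof -
  interpret finite_measure "unit_measure" by (rule unit_measure_finite)
  have "integrable unit_measure (\<lambda>x. 1 + (cmod (f x))\<^sup>2)"
    using assms by (simp add: sq_int_def)
  then show ?thesis
    by (rule Bochner_Integration.integrable_bound) (rule sq_int_measurable[OF assms], rule AE_I2, rule cmod_le_one_plus_squared)
qed

text \<open>
  The Cauchy-Schwarz inequality against the constant \<open>1\<close>, as the variance of \<open>cmod \<circ> f\<close> is nonnegative.
\<close>

lemma cmod_integral_le_energy:
  assumes f: "sq_int f"
  shows "(\<integral>x. cmod (f x) \<partial>unit_measure) \<le> sqrt (energy f)"
proof -
  interpret finite_measure "unit_measure" by (rule unit_measure_finite)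
  define a where "a = (\<integral>x. cmod (f x) \<partial>unit_measure)"
  have i1: "integrable unit_measure (\<lambda>x. cmod (f x))" using sq_int_integrable[OF f] by simp
  have i2: "integrable unit_measure (\<lambda>x. (cmod (f x))\<^sup>2)" using f by (simp add: sq_int_def)
  have "0 \<le> (\<integral>x. (cmod (f x) - a)\<^sup>2 \<partial>unit_measure)" by simp
  also have "(\<lambda>x. (cmod (f x) - a)\<^sup>2) = (\<lambda>x. (cmod (f x))\<^sup>2 - 2 * a * cmod (f x) + a\<^sup>2)"
    by (auto simp: power2_diff)
  also have "(\<integral>x. \<dots> x \<partial>unit_measure) = energy f - 2 * a * a + a\<^sup>2"
    using i1 i2 by (simp add: energy_def a_def)
  finally have "a\<^sup>2 \<le> energy f" by (simp add: power2_eq_square)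
  then show ?thesis unfolding a_def[symmetric] by (rule real_le_rsqrt)
qed

lemma unit_AE_iff_negligible:
  "(AE x in unit_measure. P x) \<longleftrightarrow> negligible {x \<in> {0<..<1::real}. \<not> P x}"
proof -
  have "(AE x in unit_measure. P x) \<longleftrightarrow> (AE x in lebesgue. x \<in> {0<..<1} \<longrightarrow> P x)"
    by (subst AE_restrict_space_iff) auto
  also have "\<dots> \<longleftrightarrow> {x. \<not> (x \<in> {0<..<1} \<longrightarrow> P x)} \<in> null_sets lebesgue"
    by (subst completion.AE_iff_null_sets) simp
  finally show ?thesis by (simp add: negligible_iff_null_sets)
qed

lemma sq_int_integrable_on:
  assumes f: "sq_int f" and x: "0 \<le> x" "y \<le> 1"
  shows "f absolutely_integrable_on {x..y}"
proof -
  have "f absolutely_integrable_on {0<..<1}"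
    using sq_int_integrable[OF f] by (simp add: integrable_restrict_space set_integrable_def)
  then have "f absolutely_integrable_on {0..1}"
    by (simp add: absolutely_integrable_on_def integrable_on_Icc_iff_Ioo)
  then show ?thesis using x by (intro absolutely_integrable_on_subinterval) auto
qed

lemma integral_open_unit:
  assumes f: "sq_int f" and x: "x \<in> {0..1}"
  shows "(\<integral>y. f y \<partial>lebesgue_on {0<..<x}) = integral {0..x} f"
proof -
  have "f absolutely_integrable_on {0<..<x}"
    using sq_int_integrable_on[OF f, of 0 x] x
    by (simp add: absolutely_integrable_on_def integrable_on_Icc_iff_Ioo)
  then have "integrable (lebesgue_on {0<..<x}) f"
    by (rule absolutely_integrable_imp_integrable) simp
  then show ?thesis
    by (subst lebesgue_integral_eq_integral) (auto simp: integral_open_interval_real)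
qed

lemma primitive_bound:
  assumes f: "sq_int f" and x: "x \<in> {0..1}"
  shows "norm (integral {0..x} f) \<le> sqrt (energy f)"
proof -
  have n: "sq_int (\<lambda>y. of_real (cmod (f y)))"
    using f by (auto simp: sq_int_def)
  have i: "(\<lambda>y. cmod (f y)) integrable_on {x..y}" if "0 \<le> x" "y \<le> 1" for x y
    using sq_int_integrable_on[OF f that] by (simp add: absolutely_integrable_on_def)
  have "norm (integral {0..x} f) \<le> integral {0..x} (\<lambda>y. cmod (f y))"
    using x i[of 0 x] sq_int_integrable_on[OF f, of 0 x]
    by (intro integral_norm_bound_integral) (auto simp: absolutely_integrable_on_def)
  also have "\<dots> \<le> integral {0..1} (\<lambda>y. cmod (f y))"
    using x i[of 0 x] i[of 0 1] by (intro integral_subset_le) auto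
  also have "\<dots> = (\<integral>x. cmod (f x) \<partial>unit_measure)"
    using sq_int_integrable[OF f] by (subst lebesgue_integral_eq_integral) (auto simp: integral_open_interval_real)
  also have "\<dots> \<le> sqrt (energy f)" by (rule cmod_integral_le_energy[OF f])
  finally show ?thesis .
qed

lemma integral_cong_unit_AE:
  fixes f g :: "real \<Rightarrow> complex"
  assumes "AE y in unit_measure. f y = g y" and x: "0 \<le> x" "x' \<le> 1"
  shows "integral {x..x'} f = integral {x..x'} g"
proof (rule integral_spike)
  show "negligible ({y \<in> {0<..<1}. f y \<noteq> g y} \<union> {0,1})"
    using assms(1) unfolding unit_AE_iff_negligible by simp
qed (use x in auto)

lemma measurable_lebesgue_AE:
  assumes f: "f \<in> measurable lebesgue N" and ae: "AE x in lebesgue. f x = g x"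
    and g: "g \<in> UNIV \<rightarrow> space N"
  shows "g \<in> measurable lebesgue N"
proof (rule measurableI)
  fix A assume A: "A \<in> sets N"
  have "f -` A \<inter> space lebesgue \<in> sets lebesgue" by (rule measurable_sets[OF f A])
  moreover have "AE x in lebesgue. x \<in> f -` A \<inter> space lebesgue \<longleftrightarrow> x \<in> g -` A \<inter> space lebesgue"
    using ae by eventually_elim simp
  ultimately show "g -` A \<inter> space lebesgue \<in> sets lebesgue"
    using completion.in_sets_AE[of "f -` A \<inter> space lebesgue" "g -` A \<inter> space lebesgue" lborel] by simp
qed (use g in auto)

lemma sq_int_cong_AE:
  assumes f: "sq_int f" and ae: "AE x in unit_measure. f x = g x"
  shows "sq_int g"
proof -
  have m: "g \<in> borel_measurable unit_measure"
  proof -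
    have S: "{0<..<1::real} \<in> sets lebesgue" by simp
    have "(\<lambda>x. if x \<in> {0<..<1} then f x else 0) \<in> borel_measurable lebesgue"
      using f S by (intro borel_measurable_if_I) (auto simp: sq_int_def)
    moreover have "AE x in lebesgue. (if x \<in> {0<..<1} then f x else 0) = (if x \<in> {0<..<1} then g x else 0)"
    proof -
      have "AE x in lebesgue. x \<in> {0<..<1} \<longrightarrow> f x = g x"
        using ae by (subst (asm) AE_restrict_space_iff) auto
      then show ?thesis by eventually_elim simp
    qed
    ultimately have "(\<lambda>x. if x \<in> {0<..<1} then g x else 0) \<in> borel_measurable lebesgue"
      by (rule measurable_lebesgue_AE) simp
    then show ?thesis by (rule borel_measurable_if_D)
  qed
  have "integrable unit_measure (\<lambda>x. (cmod (g x))\<^sup>2)"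
  proof (rule integrable_cong_AE[THEN iffD1])
    show "integrable unit_measure (\<lambda>x. (cmod (f x))\<^sup>2)"
      "(\<lambda>x. (cmod (f x))\<^sup>2) \<in> borel_measurable unit_measure"
      using f by (auto simp: sq_int_def)
    show "(\<lambda>x. (cmod (g x))\<^sup>2) \<in> borel_measurable unit_measure" using m by measurable
    show "AE x in unit_measure. (cmod (f x))\<^sup>2 = (cmod (g x))\<^sup>2" using ae by eventually_elim simp
  qed
  then show ?thesis using m by (simp add: sq_int_def)
qed

section \<open>The scalar transport equation\<close>

text \<open>
  One component of a mild solution. The defining condition \<open>mild\<close> is that of \<open>mild_transport\<close> for a single
  component, with the \<open>L\<^sup>2\<close>-norms expressed by \<open>energy\<close>.
\<close>

locale scalar_transport = slowness +
  fixes lam :: "real \<Rightarrow> real" and z :: "real \<Rightarrow> real \<Rightarrow> complex" and B0 B1 :: "real \<Rightarrow> complex"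
  assumes lam_kappa: "AE x in unit_measure. \<kappa> x * lam x = 1"
    and state_sq: "\<And>t. 0 \<le> t \<Longrightarrow> sq_int (z t)"
    and state_cont: "\<And>t. 0 \<le> t \<Longrightarrow> ((\<lambda>s. energy (\<lambda>x. z s x - z t x)) \<longlongrightarrow> 0) (at t within {0..})"
    and mild: "\<And>t. 0 \<le> t \<Longrightarrow> \<exists>Z g h. sq_int Z \<and> sq_int h \<and>
      (\<forall>\<epsilon>>0. \<exists>\<delta>>0. \<forall>P. P tagged_division_of {0..t} \<and> (\<forall>(s, J)\<in>P. diameter J < \<delta>) \<longrightarrow>
        energy (\<lambda>x. Z x - (\<Sum>(s, J)\<in>P. of_real (measure lborel J) * z s x)) < \<epsilon>) \<and>
      (\<forall>x\<in>{0..1}. g x = g 0 + (\<integral>y. h y \<partial>lebesgue_on {0<..<x})) \<and>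
      (AE x in unit_measure. of_real (lam x) * Z x = g x) \<and>
      (AE x in unit_measure. z t x - z 0 x = - h x) \<and> B0 t = g 0 \<and> B1 t = g 1"
begin

definition G :: "real \<Rightarrow> real \<Rightarrow> complex" where "G t x = integral {0..x} (z t)"

text \<open>
  Up to sign, \<open>E t x\<close> is the time integral of the flux \<open>lam0 z\<close> at \<open>x\<close>, corrected by the function \<open>G 0 x\<close> of the
  initial state. The correction is chosen so that \<open>E\<close> depends on \<open>t - \<tau>(x)\<close> only.
\<close>

definition E :: "real \<Rightarrow> real \<Rightarrow> complex" where "E t x = G t x - B0 t"

lemma G_zero [simp]: "G t 0 = 0" by (simp add: G_def)

lemma G_diff_bound:
  assumes "0 \<le> t" "0 \<le> s" "x \<in> {0..1}"
  shows "norm (G s x - G t x) \<le> sqrt (energy (\<lambda>x. z s x - z t x))"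
proof -
  have "G s x - G t x = integral {0..x} (\<lambda>y. z s y - z t y)"
    unfolding G_def using assms state_sq[OF assms(1)] state_sq[OF assms(2)]
      sq_int_integrable_on[of "z s" 0 x] sq_int_integrable_on[of "z t" 0 x]
    by (subst Henstock_Kurzweil_Integration.integral_diff) (auto simp: absolutely_integrable_on_def)
  then show ?thesis using primitive_bound[OF sq_int_diff[OF state_sq state_sq], of s t x] assms by simp
qed

lemma G_dist:
  assumes t: "0 \<le> t" and \<epsilon>: "\<epsilon> > 0"
  obtains d where "d > 0" "\<And>s x. 0 \<le> s \<Longrightarrow> \<bar>s - t\<bar> < d \<Longrightarrow> x \<in> {0..1} \<Longrightarrow> norm (G s x - G t x) < \<epsilon>"
proof -
  have "\<forall>\<^sub>F s in at t within {0..}. dist (energy (\<lambda>x. z s x - z t x)) 0 < \<epsilon>\<^sup>2"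
    using state_cont[OF t] \<epsilon> by (intro tendstoD) auto
  then obtain d where d: "d > 0" "\<And>s. s \<ge> 0 \<Longrightarrow> s \<noteq> t \<Longrightarrow> \<bar>s - t\<bar> < d \<Longrightarrow> energy (\<lambda>x. z s x - z t x) < \<epsilon>\<^sup>2"
    unfolding eventually_at using energy_nonneg by (auto simp: dist_real_def)
  have "norm (G s x - G t x) < \<epsilon>" if "0 \<le> s" "\<bar>s - t\<bar> < d" "x \<in> {0..1}" for s x
  proof (cases "s = t")
    case False
    have "norm (G s x - G t x) \<le> sqrt (energy (\<lambda>x. z s x - z t x))" using G_diff_bound t that by simp
    also have "\<dots> < sqrt (\<epsilon>\<^sup>2)" using d(2)[OF that(1) False that(2)] by (rule real_sqrt_less_mono)
    finally show ?thesis using \<epsilon> by simp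
  qed (use \<epsilon> in simp)
  then show ?thesis using that d(1) by blast
qed

lemma G_cont_x: "0 \<le> t \<Longrightarrow> continuous_on {0..1} (G t)"
  unfolding G_def using sq_int_integrable_on[OF state_sq, of t 0 1]
  by (intro indefinite_integral_continuous_1) (auto simp: absolutely_integrable_on_def)

lemma G_cont: "continuous_on ({0..} \<times> {0..1}) (\<lambda>q. G (fst q) (snd q))"
  unfolding continuous_on_iff
proof (intro ballI allI impI)
  fix q :: "real \<times> real" and \<epsilon> :: real assume q: "q \<in> {0..} \<times> {0..1}" and \<epsilon>: "\<epsilon> > 0"
  obtain t x where q_eq: "q = (t, x)" by (cases q)
  have t: "0 \<le> t" and x: "x \<in> {0..1}" using q q_eq by auto
  obtain d1 where d1: "d1 > 0" "\<And>s y. 0 \<le> s \<Longrightarrow> \<bar>s - t\<bar> < d1 \<Longrightarrow> y \<in> {0..1} \<Longrightarrow> norm (G s y - G t y) < \<epsilon>/2"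
    using G_dist[OF t, of "\<epsilon>/2"] \<epsilon> by auto
  obtain d2 where d2: "d2 > 0" "\<And>y. y \<in> {0..1} \<Longrightarrow> dist y x < d2 \<Longrightarrow> dist (G t y) (G t x) < \<epsilon>/2"
    using G_cont_x[OF t] x \<epsilon> unfolding continuous_on_iff by (meson half_gt_zero)
  have "dist (G (fst q') (snd q')) (G (fst q) (snd q)) < \<epsilon>"
    if "q' \<in> {0..} \<times> {0..1}" "dist q' q < min d1 d2" for q'
  proof -
    obtain s y where q': "q' = (s, y)" by (cases q')
    have "dist s t \<le> dist q' q" "dist y x \<le> dist q' q" using dist_fst_le[of q' q] dist_snd_le[of q' q] by (auto simp: q' q_eq)
    then have near: "\<bar>s - t\<bar> < d1" "dist y x < d2" "0 \<le> s" "y \<in> {0..1}"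
      using that q' by (auto simp: dist_real_def)
    have "dist (G s y) (G t x) \<le> dist (G s y) (G t y) + dist (G t y) (G t x)" by (rule dist_triangle)
    also have "\<dots> < \<epsilon>/2 + \<epsilon>/2"
      using d1(2)[OF near(3,1,4)] d2(2)[OF near(4,2)] by (intro add_strict_mono) (auto simp: dist_norm)
    finally show ?thesis by (simp add: q' q_eq)
  qed
  then show "\<exists>d>0. \<forall>q'\<in>{0..} \<times> {0..1}. dist q' q < d \<longrightarrow> dist (G (fst q') (snd q')) (G (fst q) (snd q)) < \<epsilon>"
    using d1(1) d2(1) by (intro exI[of _ "min d1 d2"]) auto
qed

lemma G_cont_t: "x \<in> {0..1} \<Longrightarrow> continuous_on {0..} (\<lambda>s. G s x)"
  by (rule continuous_on_compose2[OF G_cont, of _ "\<lambda>s. (s, x)", simplified]) (auto intro!: continuous_intros)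

text \<open>
  Integrating over \<open>(0,x)\<close> is bounded on \<open>L\<^sup>2\<close>, so it maps the Riemann sums of the state to those of \<open>G\<close>.
\<close>

lemma primitive_time_integral:
  assumes t: "0 \<le> t" and x: "x \<in> {0..1}" and Z: "sq_int Z"
    and riemann: "\<forall>\<epsilon>>0. \<exists>\<delta>>0. \<forall>P. P tagged_division_of {0..t} \<and> (\<forall>(s, J)\<in>P. diameter J < \<delta>) \<longrightarrow>
        energy (\<lambda>x. Z x - (\<Sum>(s, J)\<in>P. of_real (measure lborel J) * z s x)) < \<epsilon>"
  shows "((\<lambda>s. G s x) has_integral integral {0..x} Z) {0..t}"
proof -
  have "\<exists>\<gamma>. gauge \<gamma> \<and> (\<forall>P. P tagged_division_of cbox 0 t \<and> \<gamma> fine P \<longrightarrow>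
      norm ((\<Sum>(s, J)\<in>P. measure lborel J *\<^sub>R G s x) - integral {0..x} Z) < \<epsilon>)" if \<epsilon>: "\<epsilon> > 0" for \<epsilon>
  proof -
    obtain \<delta> where \<delta>: "\<delta> > 0" "\<And>P. P tagged_division_of {0..t} \<Longrightarrow> \<forall>(s, J)\<in>P. diameter J < \<delta> \<Longrightarrow>
        energy (\<lambda>x. Z x - (\<Sum>(s, J)\<in>P. of_real (measure lborel J) * z s x)) < \<epsilon>\<^sup>2"
      using riemann[rule_format, OF zero_less_power[OF \<epsilon>, of 2]] by blast
    have "norm ((\<Sum>(s, J)\<in>P. measure lborel J *\<^sub>R G s x) - integral {0..x} Z) < \<epsilon>"
      if P: "P tagged_division_of cbox 0 t" and fine: "(\<lambda>s. ball s (\<delta>/3)) fine P" for P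
    proof -
      have P': "P tagged_division_of {0..t}" using P by simp
      have fin: "finite P" using P by (rule tagged_division_of_finite)
      have tag: "0 \<le> s" if "(s, J) \<in> P" for s J
        using tagged_division_ofD(2,3)[OF P' that] by auto
      have "\<forall>(s, J)\<in>P. diameter J < \<delta>"
      proof clarify
        fix s J assume "(s, J) \<in> P"
        then have "J \<subseteq> ball s (\<delta>/3)" using fine by (auto simp: fine_def)
        then have "diameter J \<le> diameter (ball s (\<delta>/3))" by (intro diameter_subset) auto
        also have "\<dots> \<le> 2 * (\<delta>/3)" using \<delta>(1) by (simp add: diameter_ball)
        finally show "diameter J < \<delta>" using \<delta>(1) by simp
      qed
      then have en: "energy (\<lambda>x. Z x - (\<Sum>(s, J)\<in>P. of_real (measure lborel J) * z s x)) < \<epsilon>\<^sup>2"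
        by (rule \<delta>(2)[OF P'])
      have sqP: "sq_int (\<lambda>x. \<Sum>(s, J)\<in>P. of_real (measure lborel J) * z s x)"
        by (rule sq_int_sum) (auto intro!: sq_int_cmult state_sq tag)
      have int: "f integrable_on {0..x}" if "sq_int f" for f
        using sq_int_integrable_on[OF that, of 0 x] x by (auto simp: absolutely_integrable_on_def)
      have "integral {0..x} (\<lambda>y. \<Sum>(s, J)\<in>P. of_real (measure lborel J) * z s y)
          = (\<Sum>(s, J)\<in>P. measure lborel J *\<^sub>R G s x)"
      proof -
        have i: "(\<lambda>y. of_real (measure lborel (snd p)) * z (fst p) y) integrable_on {0..x}" if "p \<in> P" for p
          using tag[of "fst p" "snd p"] that by (intro int sq_int_cmult state_sq) simp
        have "integral {0..x} (\<lambda>y. \<Sum>p\<in>P. of_real (measure lborel (snd p)) * z (fst p) y)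
            = (\<Sum>p\<in>P. integral {0..x} (\<lambda>y. of_real (measure lborel (snd p)) * z (fst p) y))"
          by (rule Henstock_Kurzweil_Integration.integral_sum[OF fin i])
        then show ?thesis by (simp add: G_def case_prod_beta scaleR_conv_of_real)
      qed
      then have "integral {0..x} (\<lambda>y. Z y - (\<Sum>(s, J)\<in>P. of_real (measure lborel J) * z s y))
          = integral {0..x} Z - (\<Sum>(s, J)\<in>P. measure lborel J *\<^sub>R G s x)"
        using int[OF Z] int[OF sqP] by (subst Henstock_Kurzweil_Integration.integral_diff) auto
      then have "norm ((\<Sum>(s, J)\<in>P. measure lborel J *\<^sub>R G s x) - integral {0..x} Z)
          \<le> sqrt (energy (\<lambda>x. Z x - (\<Sum>(s, J)\<in>P. of_real (measure lborel J) * z s x)))"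
        using primitive_bound[OF sq_int_diff[OF Z sqP] x] by (simp add: norm_minus_commute)
      also have "\<dots> < sqrt (\<epsilon>\<^sup>2)" using en by (rule real_sqrt_less_mono)
      finally show ?thesis using \<epsilon> by simp
    qed
    then show ?thesis using gauge_ball[of "\<delta>/3"] \<delta>(1) by (intro exI[of _ "\<lambda>s. ball s (\<delta>/3)"] conjI allI impI) simp_all
  qed
  then have "((\<lambda>s. G s x) has_integral integral {0..x} Z) (cbox 0 t)"
    unfolding has_integral by simp
  then show ?thesis by simp
qed

lemma kappa_G_integrable: "0 \<le> t \<Longrightarrow> x \<in> {0..1} \<Longrightarrow> (\<lambda>y. \<kappa> y *\<^sub>R G t y) integrable_on {0..x}"
  by (rule kappa_continuous_integrable, rule continuous_on_subset[OF G_cont_x]) auto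

text \<open>
  The two halves of the mild formulation: the first integrates \<open>z(t) - z(0) = -(lam0 Z)'\<close> in space, the second
  integrates \<open>Z = \<kappa> (lam0 Z)\<close> in space and uses \<open>primitive_time_integral\<close>.
\<close>

lemma mass_balance:
  assumes t: "0 \<le> t"
  shows "B1 t = B0 t - G t 1 + G 0 1"
    and "x \<in> {0..1} \<Longrightarrow> integral {0..x} (\<lambda>y. \<kappa> y *\<^sub>R (B0 t - G t y + G 0 y)) = integral {0..t} (\<lambda>s. G s x)"
proof -
  obtain Z g h where Z: "sq_int Z" and h: "sq_int h"
    and riemann: "\<forall>\<epsilon>>0. \<exists>\<delta>>0. \<forall>P. P tagged_division_of {0..t} \<and> (\<forall>(s, J)\<in>P. diameter J < \<delta>) \<longrightarrow>
        energy (\<lambda>x. Z x - (\<Sum>(s, J)\<in>P. of_real (measure lborel J) * z s x)) < \<epsilon>"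
    and g0: "\<forall>x\<in>{0..1}. g x = g 0 + (\<integral>y. h y \<partial>lebesgue_on {0<..<x})"
    and Zg: "AE x in unit_measure. of_real (lam x) * Z x = g x"
    and zh: "AE x in unit_measure. z t x - z 0 x = - h x"
    and B: "B0 t = g 0" "B1 t = g 1"
    using mild[OF t] by (elim exE conjE) (rule that; assumption)
  have g: "g x = g 0 + (\<integral>y. h y \<partial>lebesgue_on {0<..<x})" if "x \<in> {0..1}" for x
    using g0 that by (rule bspec)
  have int: "f integrable_on {0..x}" if "sq_int f" "x \<in> {0..1}" for f x
    using sq_int_integrable_on[OF that(1), of 0 x] that(2) by (auto simp: absolutely_integrable_on_def)
  have g': "g x = B0 t - G t x + G 0 x" if x: "x \<in> {0..1}" for x
  proof -
    have "G t x - G 0 x = integral {0..x} (\<lambda>y. z t y - z 0 y)"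
      unfolding G_def using int[OF state_sq x] t
      by (subst Henstock_Kurzweil_Integration.integral_diff) auto
    also have "\<dots> = integral {0..x} (\<lambda>y. - h y)" using zh x by (intro integral_cong_unit_AE) auto
    also have "\<dots> = - (g x - g 0)" using g[OF x] integral_open_unit[OF h x] by simp
    finally show ?thesis using B by (simp add: algebra_simps)
  qed
  show "B1 t = B0 t - G t 1 + G 0 1" using g'[of 1] B by simp
  show "integral {0..x} (\<lambda>y. \<kappa> y *\<^sub>R (B0 t - G t y + G 0 y)) = integral {0..t} (\<lambda>s. G s x)" if x: "x \<in> {0..1}"
  proof -
    have "integral {0..t} (\<lambda>s. G s x) = integral {0..x} Z"
      using primitive_time_integral[OF t x Z riemann] by (rule integral_unique)
    also have "\<dots> = integral {0..x} (\<lambda>y. \<kappa> y *\<^sub>R g y)"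
    proof (rule integral_cong_unit_AE)
      show "AE y in unit_measure. Z y = \<kappa> y *\<^sub>R g y"
        using Zg lam_kappa
      proof eventually_elim
        case (elim y)
        have "\<kappa> y *\<^sub>R g y = of_real (\<kappa> y * lam y) * Z y" unfolding elim(1)[symmetric] by (simp add: scaleR_conv_of_real)
        then show ?case using elim(2) by simp
      qed
    qed (use x in auto)
    also have "\<dots> = integral {0..x} (\<lambda>y. \<kappa> y *\<^sub>R (B0 t - G t y + G 0 y))"
      using g' x by (intro integral_cong) auto
    finally show ?thesis ..
  qed
qed

lemma B0_zero: "B0 0 = 0"
proof -
  have "integral {0..1} (\<lambda>y. \<kappa> y *\<^sub>R B0 0) = 0" using mass_balance(2)[of 0 1] by simp
  moreover have "integral {0..1} (\<lambda>y. \<kappa> y *\<^sub>R B0 0) = \<tau> 1 *\<^sub>R B0 0"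
    using integral_unique[OF integral_kappa_scaleR_const[of 0 1 "B0 0"]] by simp
  moreover have "\<tau> 1 > 0" using tau_less[of 0 1] by simp
  ultimately show ?thesis by simp
qed

text \<open>
  Nothing in the mild formulation says that the trace \<open>B0\<close> is continuous. The mass balance over the whole
  interval expresses it by integrals that are.
\<close>

lemma B0_cont: "continuous_on {0..} B0"
proof -
  have pos: "\<tau> 1 > 0" using tau_less[of 0 1] by simp
  define \<Phi> where "\<Phi> t = integral {0..1} (\<lambda>y. \<kappa> y *\<^sub>R G t y)" for t
  have c: "integral {0..1} (\<lambda>y. \<kappa> y *\<^sub>R B0 t) = \<tau> 1 *\<^sub>R B0 t" for t
    using integral_unique[OF integral_kappa_scaleR_const[of 0 1 "B0 t"]] by simp
  have eq: "B0 t = (\<Phi> t - \<Phi> 0 + integral {0..t} (\<lambda>s. G s 1)) /\<^sub>R \<tau> 1" if t: "0 \<le> t" for t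
  proof -
    have i: "(\<lambda>y. \<kappa> y *\<^sub>R B0 t) integrable_on {0..1}" using integral_kappa_scaleR_const[of 0 1 "B0 t"] by auto
    have "integral {0..1} (\<lambda>y. \<kappa> y *\<^sub>R (B0 t - G t y + G 0 y)) = \<tau> 1 *\<^sub>R B0 t - \<Phi> t + \<Phi> 0"
      unfolding scaleR_add_right scaleR_diff_right \<Phi>_def c[symmetric]
      using i kappa_G_integrable[of t 1] kappa_G_integrable[of 0 1] t
      by (simp add: Henstock_Kurzweil_Integration.integral_add Henstock_Kurzweil_Integration.integral_diff
        Henstock_Kurzweil_Integration.integrable_diff)
    then have "\<tau> 1 *\<^sub>R B0 t = \<Phi> t - \<Phi> 0 + integral {0..t} (\<lambda>s. G s 1)"
      using mass_balance(2)[OF t, of 1] by (simp add: algebra_simps)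
    then have "(\<Phi> t - \<Phi> 0 + integral {0..t} (\<lambda>s. G s 1)) /\<^sub>R \<tau> 1 = (\<tau> 1 *\<^sub>R B0 t) /\<^sub>R \<tau> 1" by simp
    also have "\<dots> = B0 t" using pos by simp
    finally show ?thesis ..
  qed
  have "continuous_on {0..} \<Phi>"
    unfolding continuous_on_iff
  proof (intro ballI allI impI)
    fix t \<epsilon> :: real assume t: "t \<in> {0..}" and \<epsilon>: "\<epsilon> > 0"
    obtain d where d: "d > 0" "\<And>s x. 0 \<le> s \<Longrightarrow> \<bar>s - t\<bar> < d \<Longrightarrow> x \<in> {0..1} \<Longrightarrow> norm (G s x - G t x) < \<epsilon> / (2 * \<tau> 1)"
      using G_dist[of t "\<epsilon> / (2 * \<tau> 1)"] t \<epsilon> pos by auto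
    have "dist (\<Phi> s) (\<Phi> t) < \<epsilon>" if s: "s \<in> {0..}" "dist s t < d" for s
    proof -
      have "\<Phi> s - \<Phi> t = integral {0..1} (\<lambda>y. \<kappa> y *\<^sub>R (G s y - G t y))"
        unfolding \<Phi>_def scaleR_diff_right using kappa_G_integrable[of t 1] kappa_G_integrable[of s 1] t s
        by (simp add: Henstock_Kurzweil_Integration.integral_diff)
      also have "norm \<dots> \<le> integral {0..1} (\<lambda>y. \<kappa> y * (\<epsilon> / (2 * \<tau> 1)))"
      proof (rule integral_norm_bound_integral)
        show "(\<lambda>y. \<kappa> y *\<^sub>R (G s y - G t y)) integrable_on {0..1}"
          unfolding scaleR_diff_right using kappa_G_integrable[of t 1] kappa_G_integrable[of s 1] t s
          by (intro Henstock_Kurzweil_Integration.integrable_diff) auto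
        show "(\<lambda>y. \<kappa> y * (\<epsilon> / (2 * \<tau> 1))) integrable_on {0..1}"
          by (rule integrable_on_mult_left[OF kappa_integrable])
        show "norm (\<kappa> y *\<^sub>R (G s y - G t y)) \<le> \<kappa> y * (\<epsilon> / (2 * \<tau> 1))" if "y \<in> {0..1}" for y
        proof -
          have "norm (G s y - G t y) \<le> \<epsilon> / (2 * \<tau> 1)"
            using d(2)[of s y] s that by (intro less_imp_le) (auto simp: dist_real_def)
          then have "\<kappa> y * norm (G s y - G t y) \<le> \<kappa> y * (\<epsilon> / (2 * \<tau> 1))"
            by (rule mult_left_mono) (rule less_imp_le[OF kappa_pos])
          then show ?thesis using kappa_pos[of y] by simp
        qed
      qed
      also have "\<dots> = \<tau> 1 * (\<epsilon> / (2 * \<tau> 1))"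
        using tau_diff[of 0 1] by (simp only: Henstock_Kurzweil_Integration.integral_mult_left) simp
      also have "\<dots> < \<epsilon>" using pos \<epsilon> by simp
      finally show ?thesis by (simp add: dist_norm)
    qed
    then show "\<exists>d>0. \<forall>s\<in>{0..}. dist s t < d \<longrightarrow> dist (\<Phi> s) (\<Phi> t) < \<epsilon>" using d(1) by blast
  qed
  moreover have "continuous_on {0..} (\<lambda>t. integral {0..t} (\<lambda>s. G s 1))"
  proof -
    have "continuous_on {0..T} (\<lambda>t. integral {0..t} (\<lambda>s. G s 1))" for T
      by (intro indefinite_integral_continuous_1 integrable_continuous_real continuous_on_subset[OF G_cont_t]) auto
    then show ?thesis unfolding continuous_on_eq_continuous_within
    proof clarsimp
      fix t :: real assume t: "0 \<le> t" and *: "\<And>T. \<forall>x\<in>{0..T}. continuous (at x within {0..T}) (\<lambda>t. integral {0..t} (\<lambda>s. G s 1))"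
      have "continuous (at t within {0..t+1}) (\<lambda>t. integral {0..t} (\<lambda>s. G s 1))" using *[of "t+1"] t by auto
      moreover have "at t within {0..t+1} = at t within {0..}"
        by (rule at_within_nhd[where S="{..<t+1}"]) auto
      ultimately show "continuous (at t within {0..}) (\<lambda>t. integral {0..t} (\<lambda>s. G s 1))" by simp
    qed
  qed
  ultimately have "continuous_on {0..} (\<lambda>t. (\<Phi> t - \<Phi> 0 + integral {0..t} (\<lambda>s. G s 1)) /\<^sub>R \<tau> 1)"
    by (intro continuous_intros)
  then show ?thesis using eq by (subst continuous_on_cong[OF refl]) auto
qed

text \<open>For \<open>E\<close>, the hypothesis of \<open>constant_along_characteristics\<close> is the second half of \<open>mass_balance\<close>.\<close>

lemma E_characteristics:
  assumes t: "0 \<le> t" and x: "x \<in> {0..1}"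
  shows "E t x = E (t + (\<tau> 1 - \<tau> x)) 1"
proof (rule constant_along_characteristics[OF _ _ t x])
  show "continuous_on ({0..} \<times> {0..1}) (\<lambda>q. E (fst q) (snd q))"
    unfolding E_def by (intro continuous_on_diff G_cont continuous_on_compose2[OF B0_cont])
      (auto intro!: continuous_intros)
  show "integral {0..x} (\<lambda>y. \<kappa> y *\<^sub>R (E 0 y - E t y)) = integral {0..t} (\<lambda>s. E s x - E s 0)"
    if "0 \<le> t" "x \<in> {0..1}" for t x
    using mass_balance(2)[OF that] by (simp add: E_def B0_zero algebra_simps)
qed

lemma B1_zero: "B1 0 = 0"
  using mass_balance(1)[of 0] B0_zero by simp

lemma B1_eq_E: "0 \<le> t \<Longrightarrow> B1 t = G 0 1 - E t 1"
  using mass_balance(1)[of t] by (simp add: E_def)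

text \<open>What leaves at \<open>x = 1\<close> entered at \<open>x = 0\<close> one travel time earlier.\<close>

lemma B0_advanced: "0 \<le> t \<Longrightarrow> B0 t = B1 (t + \<tau> 1) - B1 (\<tau> 1)"
proof -
  have a: "- B0 t = G 0 1 - (G 0 1 - E (t + \<tau> 1) 1)" if "0 \<le> t" for t
    using E_characteristics[of t 0] that by (simp add: E_def)
  have "0 \<le> \<tau> 1" using tau_le_iff[of 0 1] by simp
  then have "- B0 t = G 0 1 - B1 (t + \<tau> 1)" if "0 \<le> t" for t
    using a[OF that] B1_eq_E[of "t + \<tau> 1"] that by simp
  from this[of t] this[of 0] show "0 \<le> t \<Longrightarrow> B0 t = B1 (t + \<tau> 1) - B1 (\<tau> 1)"
    using B0_zero by (simp add: algebra_simps)
qed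

lemma state_primitive:
  assumes t: "0 \<le> t" and x: "x \<in> {0..1}"
  shows "integral {0..x} (z t) = B1 (t + \<tau> 1) - B1 (t + \<tau> 1 - \<tau> x)"
proof -
  have "0 \<le> t + (\<tau> 1 - \<tau> x)" using tau_le_iff[of x 1] t x by simp
  moreover have "0 \<le> \<tau> 1" using tau_le_iff[of 0 1] by simp
  ultimately have "E t x = G 0 1 - B1 (t + \<tau> 1 - \<tau> x)" "E t 0 = G 0 1 - B1 (t + \<tau> 1)"
    using E_characteristics[OF t x] E_characteristics[OF t, of 0] B1_eq_E[of "t + (\<tau> 1 - \<tau> x)"] B1_eq_E[of "t + \<tau> 1"] t
    by (auto simp: algebra_simps)
  then show ?thesis by (simp add: E_def G_def algebra_simps)
qed

end

section \<open>Regularity of the boundary traces\<close>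

lemma sq_int_borel_version:
  assumes v: "sq_int v"
  obtains v1 :: "real \<Rightarrow> complex" where "v1 \<in> borel_measurable borel" "\<And>y. y \<notin> {0<..<1} \<Longrightarrow> v1 y = 0"
    "AE y in unit_measure. v y = v1 y" "integrable lborel v1" "integrable lborel (\<lambda>y. (cmod (v1 y))\<^sup>2)"
proof -
  define v0 where "v0 y = (if y \<in> {0<..<1} then v y else 0)" for y :: real
  have v0: "v0 \<in> borel_measurable lebesgue"
    unfolding v0_def using v by (intro borel_measurable_if_I) (auto simp: sq_int_def)
  have "(\<lambda>y. Re (v0 y)) \<in> borel_measurable lebesgue" "(\<lambda>y. Im (v0 y)) \<in> borel_measurable lebesgue"
    using v0 by simp_all
  then obtain re im where ri: "re \<in> borel_measurable lborel" "im \<in> borel_measurable lborel"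
    and re: "AE y in lborel. Re (v0 y) = re y" and im: "AE y in lborel. Im (v0 y) = im y"
    using completion_ex_borel_measurable_real by metis
  define v1 where "v1 y = indicator {0<..<1} y *\<^sub>R Complex (re y) (im y)" for y
  have [measurable]: "re \<in> borel_measurable borel" "im \<in> borel_measurable borel" using ri by simp_all
  have v1m [measurable]: "v1 \<in> borel_measurable borel"
    unfolding v1_def Complex_eq by measurable
  have supp: "v1 y = 0" if "y \<notin> {0<..<1}" for y using that by (simp add: v1_def)
  have "AE y in lborel. v0 y = v1 y"
    using re im
  proof eventually_elim
    case (elim y) then show ?case
      by (cases "0 < y"; cases "y < 1") (simp_all add: v1_def v0_def complex_eq_iff)
  qed
  then have "AE y in lebesgue. v0 y = v1 y" by (rule AE_completion)
  then have "AE y in lebesgue. y \<in> {0<..<1} \<longrightarrow> v y = v1 y"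
    by eventually_elim (auto simp: v0_def)
  then have ae: "AE y in unit_measure. v y = v1 y" by (subst AE_restrict_space_iff) auto
  have v1: "sq_int v1" by (rule sq_int_cong_AE[OF v ae])
  have ind: "indicator {0<..<1} y *\<^sub>R v1 y = v1 y" "indicator {0<..<1} y *\<^sub>R (cmod (v1 y))\<^sup>2 = (cmod (v1 y))\<^sup>2" for y
    using supp[of y] by (auto simp: indicator_def)
  have "integrable lebesgue v1" "integrable lebesgue (\<lambda>y. (cmod (v1 y))\<^sup>2)"
    using sq_int_integrable[OF v1] v1 unfolding sq_int_def by (simp_all add: integrable_restrict_space ind del: real_scaleR_def)
  then have "integrable lborel v1" "integrable lborel (\<lambda>y. (cmod (v1 y))\<^sup>2)"
    by (simp_all add: integrable_completion)
  then show ?thesis using that[OF v1m supp ae] by blast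
qed

text \<open>The measures with densities \<open>g\<^sup>+\<close> and \<open>g\<^sup>-\<close> agree on half lines, hence coincide.\<close>

lemma zero_tail_integrals_imp_AE_zero:
  fixes g :: "real \<Rightarrow> real"
  assumes [measurable]: "g \<in> borel_measurable borel" and int: "integrable lborel g"
    and zero: "\<And>x. (\<integral>y. indicator {x<..} y * g y \<partial>lborel) = 0"
  shows "AE y in lborel. g y = 0"
proof -
  have i: "integrable lborel (\<lambda>y. indicator {x<..} y * max 0 (c * g y))" if "c \<in> {1,-1}" for x c
    by (rule Bochner_Integration.integrable_bound[OF int]) (use that in \<open>auto simp: indicator_def\<close>)
  have em: "emeasure (density lborel (\<lambda>y. ennreal (max 0 (c * g y)))) {x<..}
      = ennreal (\<integral>y. indicator {x<..} y * max 0 (c * g y) \<partial>lborel)" if "c \<in> {1,-1}" for x c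
  proof -
    have "emeasure (density lborel (\<lambda>y. ennreal (max 0 (c * g y)))) {x<..}
        = (\<integral>\<^sup>+y. ennreal (indicator {x<..} y * max 0 (c * g y)) \<partial>lborel)"
      by (subst emeasure_density) (auto intro!: nn_integral_cong simp: indicator_def)
    also have "\<dots> = ennreal (\<integral>y. indicator {x<..} y * max 0 (c * g y) \<partial>lborel)"
      by (rule nn_integral_eq_integral[OF i[OF that]]) (auto simp: indicator_def)
    finally show ?thesis .
  qed
  have "(\<integral>y. indicator {x<..} y * max 0 (1 * g y) \<partial>lborel) = (\<integral>y. indicator {x<..} y * max 0 (-1 * g y) \<partial>lborel)" for x
  proof -
    have "(\<integral>y. indicator {x<..} y * max 0 (1 * g y) \<partial>lborel) - (\<integral>y. indicator {x<..} y * max 0 (-1 * g y) \<partial>lborel)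
       = (\<integral>y. indicator {x<..} y * max 0 (1 * g y) - indicator {x<..} y * max 0 (-1 * g y) \<partial>lborel)"
      by (rule Bochner_Integration.integral_diff[symmetric]) (rule i, simp)+
    also have "\<dots> = (\<integral>y. indicator {x<..} y * g y \<partial>lborel)"
      by (rule Bochner_Integration.integral_cong) (auto simp: indicator_def max_def)
    finally show ?thesis using zero by simp
  qed
  then have "density lborel (\<lambda>y. ennreal (max 0 (1 * g y))) = density lborel (\<lambda>y. ennreal (max 0 (-1 * g y)))"
    by (intro measure_eqI_lessThan) (simp_all only: em insertI1 insertI2 sets_density sets_lborel ennreal_less_top infinity_ennreal_def)
  then have "AE y in lborel. ennreal (max 0 (1 * g y)) = ennreal (max 0 (-1 * g y))"
    by (subst (asm) sigma_finite_measure.density_unique_iff[OF sigma_finite_lborel]) auto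
  then show ?thesis by eventually_elim (auto simp: max_def split: if_splits)
qed

text \<open>
  Uniqueness of the density of a primitive; applied to the state, which is determined by its integrals
  over \<open>(0,x)\<close>.
\<close>

lemma zero_primitive_imp_AE_zero:
  assumes v: "sq_int v" and zero: "\<And>x. x \<in> {0..1} \<Longrightarrow> integral {0..x} v = 0"
  shows "AE x in unit_measure. v x = 0"
proof -
  obtain v1 where v1 [measurable]: "v1 \<in> borel_measurable borel" and supp: "\<And>y. y \<notin> {0<..<1} \<Longrightarrow> v1 y = 0"
    and ae: "AE y in unit_measure. v y = v1 y" and int: "integrable lborel v1"
    using sq_int_borel_version[OF v] by blast
  have sq: "sq_int v1" by (rule sq_int_cong_AE[OF v ae])
  have tail: "(\<integral>y. indicator {x<..} y *\<^sub>R v1 y \<partial>lborel) = 0" for x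
  proof -
    define a where "a = max 0 (min x 1)"
    have a: "a \<in> {0..1}" by (auto simp: a_def)
    have i: "v1 integrable_on {0..1}" using sq_int_integrable_on[OF sq, of 0 1] by (simp add: absolutely_integrable_on_def)
    have "integral {0..a} v1 + integral {a..1} v1 = integral {0..1} v1"
      using a i by (intro Henstock_Kurzweil_Integration.integral_combine) auto
    moreover have "integral {0..y} v1 = 0" if "y \<in> {0..1}" for y
      using integral_cong_unit_AE[OF ae, of 0 y] zero[OF that] that by simp
    ultimately have z: "integral {a..1} v1 = 0" using a by auto
    have "integrable lborel (\<lambda>y. indicator {x<..} y *\<^sub>R v1 y)"
      by (rule integrable_mult_indicator[OF _ int]) simp
    then have "((\<lambda>y. indicator {x<..} y *\<^sub>R v1 y) has_integral (\<integral>y. indicator {x<..} y *\<^sub>R v1 y \<partial>lborel)) UNIV"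
      by (rule has_integral_integral_lborel)
    moreover have "((\<lambda>y. if y \<in> {a..1} then v1 y else 0) has_integral 0) UNIV"
      unfolding has_integral_restrict_UNIV using i a z
      by (metis atLeastAtMost_iff atLeastatMost_subset_iff has_integral_integrable_integral integrable_on_subinterval order_refl)
    moreover have "((\<lambda>y. indicator {x<..} y *\<^sub>R v1 y) has_integral 0) UNIV \<longleftrightarrow>
        ((\<lambda>y. if y \<in> {a..1} then v1 y else 0) has_integral 0) UNIV"
    proof (rule has_integral_spike_finite_eq)
      show "(if y \<in> {a..1} then v1 y else 0) = indicator {x<..} y *\<^sub>R v1 y" if "y \<in> UNIV - {x}" for y
        using that supp[of y] by (auto simp: indicator_def a_def max_def min_def split: if_splits)
    qed simp
    ultimately show ?thesis by (metis has_integral_unique)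
  qed
  have iv: "integrable lborel (\<lambda>y. indicator {x<..} y *\<^sub>R v1 y)" for x
    by (rule integrable_mult_indicator[OF _ int]) simp
  have "AE y in lborel. Re (v1 y) = 0"
  proof (rule zero_tail_integrals_imp_AE_zero)
    show "(\<integral>y. indicator {x<..} y * Re (v1 y) \<partial>lborel) = 0" for x
      using integral_Re[OF iv, of x] tail[of x] by simp
  qed (use int in auto)
  moreover have "AE y in lborel. Im (v1 y) = 0"
  proof (rule zero_tail_integrals_imp_AE_zero)
    show "(\<integral>y. indicator {x<..} y * Im (v1 y) \<partial>lborel) = 0" for x
      using integral_Im[OF iv, of x] tail[of x] by simp
  qed (use int in auto)
  ultimately have "AE y in lborel. v1 y = 0" by eventually_elim (simp add: complex_eq_iff)
  then have "AE y in lebesgue. v1 y = 0" by (rule AE_completion)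
  then have "AE y in unit_measure. v1 y = 0" by (subst AE_restrict_space_iff) (auto elim: eventually_mono)
  with ae show ?thesis by eventually_elim simp
qed

context slowness begin

text \<open>
  The primitive of \<open>v\<close>, read as a function of the travel time, has the density \<open>v/\<kappa>\<close> transported by the
  inverse \<open>\<sigma>\<close> of \<open>\<tau>\<close>; its square integrability follows from \<open>\<kappa> \<ge> \<alpha>\<close>.
\<close>

lemma borel_density:
  assumes v: "sq_int v"
  obtains f :: "real \<Rightarrow> complex" where "f \<in> borel_measurable borel"
    "(\<lambda>r. (cmod (f r))\<^sup>2) integrable_on {0..\<tau> 1}"
    "\<And>x. x \<in> {0..1} \<Longrightarrow> (f has_integral (integral {0..x} v)) {0..\<tau> x}"
proof -
  obtain v1 where v1m [measurable]: "v1 \<in> borel_measurable borel" and supp: "\<And>y. y \<notin> {0<..<1} \<Longrightarrow> v1 y = 0"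
    and ae: "AE y in unit_measure. v y = v1 y" and v1i: "integrable lborel v1"
    and v1sq: "integrable lborel (\<lambda>y. (cmod (v1 y))\<^sup>2)"
    using sq_int_borel_version[OF v] by blast
  have v1: "sq_int v1" by (rule sq_int_cong_AE[OF v ae])
  define c where "c y = v1 y / of_real (\<kappa> y)" for y
  have cm [measurable]: "c \<in> borel_measurable borel" unfolding c_def by measurable
  define f where "f r = c (\<sigma> r)" for r
  have fm [measurable]: "f \<in> borel_measurable borel" unfolding f_def by measurable
  have ind: "indicator {0..\<tau> x} (\<tau> y) = (indicator {0..x} y :: real)" for x y
    using tau_le_iff[of 0 y] by (auto simp: indicator_def)
  have "(f has_integral (integral {0..x} v)) {0..\<tau> x}" if x: "x \<in> {0..1}" for x
  proof -
    have i1: "integrable lborel (\<lambda>y. indicator {0..x} y *\<^sub>R v1 y)"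
      by (rule integrable_mult_indicator[OF _ v1i]) simp
    define F where "F r = indicator {0..\<tau> x} r *\<^sub>R f r" for r
    have Fm [measurable]: "F \<in> borel_measurable borel" unfolding F_def by measurable
    have eq: "(\<lambda>y. \<kappa> y *\<^sub>R F (\<tau> y)) = (\<lambda>y. indicator {0..x} y *\<^sub>R v1 y)"
    proof
      fix y show "\<kappa> y *\<^sub>R F (\<tau> y) = indicator {0..x} y *\<^sub>R v1 y"
        using kappa_pos[of y] by (simp add: F_def f_def c_def ind scaleR_conv_of_real)
    qed
    have iF: "integrable lborel F" using lborel_integral_tau(2)[OF Fm] eq i1 by simp
    have "(F has_integral integral\<^sup>L lborel F) UNIV" by (rule has_integral_integral_lborel[OF iF])
    then have "((\<lambda>r. if r \<in> {0..\<tau> x} then f r else 0) has_integral integral\<^sup>L lborel F) UNIV"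
      by (rule has_integral_eq[rotated]) (auto simp: F_def indicator_def)
    then have A: "(f has_integral integral\<^sup>L lborel F) {0..\<tau> x}" by (simp only: has_integral_restrict_UNIV)
    have "((\<lambda>y. indicator {0..x} y *\<^sub>R v1 y) has_integral integral\<^sup>L lborel (\<lambda>y. indicator {0..x} y *\<^sub>R v1 y)) UNIV"
      by (rule has_integral_integral_lborel[OF i1])
    then have "((\<lambda>y. if y \<in> {0..x} then v1 y else 0) has_integral integral\<^sup>L lborel (\<lambda>y. indicator {0..x} y *\<^sub>R v1 y)) UNIV"
      by (rule has_integral_eq[rotated]) (auto simp: indicator_def)
    then have "(v1 has_integral integral\<^sup>L lborel (\<lambda>y. indicator {0..x} y *\<^sub>R v1 y)) {0..x}"
      by (simp only: has_integral_restrict_UNIV)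
    then have "integral {0..x} v1 = integral\<^sup>L lborel F"
      using integral_unique lborel_integral_tau(1)[OF Fm] eq by metis
    moreover have "integral {0..x} v = integral {0..x} v1" using x by (intro integral_cong_unit_AE ae) auto
    ultimately show ?thesis using A by simp
  qed
  moreover have "(\<lambda>r. (cmod (f r))\<^sup>2) integrable_on {0..\<tau> 1}"
  proof -
    have i2: "integrable lborel (\<lambda>y. (cmod (v1 y))\<^sup>2 / \<alpha>)" using v1sq by simp
    define F where "F r = indicator {0..\<tau> 1} r * (cmod (f r))\<^sup>2" for r
    have Fm [measurable]: "F \<in> borel_measurable borel" unfolding F_def by measurable
    have b: "norm (\<kappa> y *\<^sub>R F (\<tau> y)) \<le> norm ((cmod (v1 y))\<^sup>2 / \<alpha>)" for y
    proof -
      have "\<kappa> y *\<^sub>R F (\<tau> y) = indicator {0..1} y * ((cmod (v1 y))\<^sup>2 / \<kappa> y)"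
        using kappa_pos[of y]
        by (simp add: F_def f_def c_def ind norm_divide power_divide power2_eq_square)
      also have "\<dots> \<le> (cmod (v1 y))\<^sup>2 / \<kappa> y" using kappa_pos[of y] by (simp add: indicator_def)
      also have "\<dots> \<le> (cmod (v1 y))\<^sup>2 / \<alpha>" using kappa_ge[of y] alpha_pos by (intro divide_left_mono) (auto intro: mult_pos_pos kappa_pos)
      finally have "\<kappa> y *\<^sub>R F (\<tau> y) \<le> (cmod (v1 y))\<^sup>2 / \<alpha>" .
      moreover have "0 \<le> \<kappa> y *\<^sub>R F (\<tau> y)" using kappa_pos[of y] by (simp add: F_def)
      ultimately show ?thesis using alpha_pos by simp
    qed
    have "integrable lborel (\<lambda>y. \<kappa> y *\<^sub>R F (\<tau> y))"
      by (rule Bochner_Integration.integrable_bound[OF i2]) (measurable, rule AE_I2, rule b)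
    then have "integrable lborel F" using lborel_integral_tau(2)[OF Fm] by simp
    then have "F integrable_on UNIV" by (rule integrable_on_lborel)
    then have "(\<lambda>r. if r \<in> {0..\<tau> 1} then (cmod (f r))\<^sup>2 else 0) integrable_on UNIV"
      by (rule integrable_eq) (auto simp: F_def indicator_def)
    then show ?thesis by (simp only: integrable_restrict_UNIV)
  qed
  ultimately show ?thesis using that fm by blast
qed

end

context scalar_transport begin

text \<open>
  At time \<open>T\<close> the state contains everything that leaves during the next \<open>\<tau> 1\<close> units of time, in reversed
  order: what is at \<open>x\<close> leaves at time \<open>T + \<tau> 1 - \<tau> x\<close>.
\<close>

lemma window_density:
  assumes T: "0 \<le> T"
  shows "\<exists>f \<in> borel_measurable borel. (\<lambda>s. (cmod (f s))\<^sup>2) integrable_on {T..T + \<tau> 1} \<and>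
    (\<forall>t\<in>{T..T + \<tau> 1}. (f has_integral (B1 t - B1 T)) {T..t})"
proof -
  have pos: "0 < \<tau> 1" using tau_less[of 0 1] by simp
  obtain f where f [measurable]: "f \<in> borel_measurable borel" and sq: "(\<lambda>r. (cmod (f r))\<^sup>2) integrable_on {0..\<tau> 1}"
    and int: "\<And>x. x \<in> {0..1} \<Longrightarrow> (f has_integral (integral {0..x} (z T))) {0..\<tau> x}"
    using borel_density[OF state_sq[OF T]] by blast
  define c where "c = T + \<tau> 1"
  define g where "g s = f (c - s)" for s
  have gm: "g \<in> borel_measurable borel" unfolding g_def by measurable
  have mirror: "((\<lambda>s. F (c - s)) has_integral I) {c - r..c} \<longleftrightarrow> (F has_integral I) {0..r}"
    for F :: "real \<Rightarrow> 'b::euclidean_space" and I r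
    using has_integral_shift_Icc_real[of "\<lambda>s. F (c - s)" c I "-r" 0] has_integral_reflect_real[of F I r 0]
    by (simp add: o_def)
  have upper: "(g has_integral (B1 c - B1 a)) {a..c}" if a: "a \<in> {T..c}" for a
  proof -
    define x where "x = \<sigma> (c - a)"
    have tx: "\<tau> x = c - a" by (simp add: x_def)
    have x: "x \<in> {0..1}" using tau_le_iff[of 0 x] tau_le_iff[of x 1] a by (simp add: tx c_def)
    have "(f has_integral (B1 c - B1 a)) {0..c - a}"
      using int[OF x] state_primitive[OF T x] unfolding c_def[symmetric] tx by simp
    then have "((\<lambda>s. f (c - s)) has_integral (B1 c - B1 a)) {c - (c - a)..c}" by (subst mirror)
    then show ?thesis by (simp add: g_def[abs_def])
  qed
  have "(g has_integral (B1 t - B1 T)) {T..t}" if t: "t \<in> {T..c}" for t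
  proof -
    have i: "g integrable_on {T..c}" using upper[of T] pos by (auto simp: c_def)
    have "integral {T..t} g + integral {t..c} g = integral {T..c} g"
      using t i by (intro Henstock_Kurzweil_Integration.integral_combine) auto
    moreover have "integral {t..c} g = B1 c - B1 t" "integral {T..c} g = B1 c - B1 T"
      using upper[of t] upper[of T] t by (auto intro!: integral_unique)
    ultimately have "integral {T..t} g = B1 t - B1 T" by (simp add: algebra_simps)
    moreover have "g integrable_on {T..t}" using i t by (rule_tac integrable_on_subinterval) auto
    ultimately show ?thesis by (simp add: has_integral_integrable_integral)
  qed
  moreover have "(\<lambda>s. (cmod (g s))\<^sup>2) integrable_on {T..c}"
    using mirror[of "\<lambda>r. (cmod (f r))\<^sup>2" _ "\<tau> 1"] sq unfolding integrable_on_def g_def by (simp add: c_def)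
  ultimately show ?thesis using gm unfolding c_def by blast
qed

text \<open>
  The densities of the windows \<open>[j p, (j + 1) p]\<close> are glued; the window containing \<open>s\<close> has index \<open>\<lfloor>s / p\<rfloor>\<close>.
\<close>

theorem outflow_trace_density:
  obtains f :: "real \<Rightarrow> complex" where "f \<in> borel_measurable borel"
    "\<And>T. 0 \<le> T \<Longrightarrow> (\<lambda>s. (cmod (f s))\<^sup>2) integrable_on {0..T}"
    "\<And>t. 0 \<le> t \<Longrightarrow> (f has_integral B1 t) {0..t}"
proof -
  define p where "p = \<tau> 1"
  have p: "0 < p" using tau_less[of 0 1] by (simp add: p_def)
  have "\<exists>f \<in> borel_measurable borel. (\<lambda>s. (cmod (f s))\<^sup>2) integrable_on {real j * p..real j * p + p} \<and>
    (\<forall>t\<in>{real j * p..real j * p + p}. (f has_integral (B1 t - B1 (real j * p))) {real j * p..t})" for j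
    using window_density[of "real j * p"] p unfolding p_def by simp
  then obtain w where w [measurable]: "\<And>j. w j \<in> borel_measurable borel"
    and wsq: "\<And>j. (\<lambda>s. (cmod (w j s))\<^sup>2) integrable_on {real j * p..real j * p + p}"
    and wint: "\<And>j t. t \<in> {real j * p..real j * p + p} \<Longrightarrow> (w j has_integral (B1 t - B1 (real j * p))) {real j * p..t}"
    by metis
  define f where "f s = w (nat \<lfloor>s / p\<rfloor>) s" for s
  have fm: "f \<in> borel_measurable borel"
    unfolding f_def by (rule measurable_compose_countable) measurable
  have fw: "f s = w j s" if "real j * p \<le> s" "s < real j * p + p" for j s
  proof -
    have "real j \<le> s / p" "s / p < real j + 1" using that p by (auto simp: field_simps)
    then have "\<lfloor>s / p\<rfloor> = int j" by (intro floor_unique) auto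
    then show ?thesis by (simp add: f_def)
  qed
  have fint: "(f has_integral (B1 t - B1 (real j * p))) {real j * p..t}" if "t \<in> {real j * p..real j * p + p}" for j t
    by (rule has_integral_spike_finite[OF _ _ wint[OF that], of "{real j * p + p}"]) (use that fw in auto)
  have fsq: "(\<lambda>s. (cmod (f s))\<^sup>2) integrable_on {real j * p..real j * p + p}" for j
    by (rule integrable_spike_finite[OF _ _ wsq[of j], of "{real j * p + p}"]) (use fw in auto)
  have step: "(f has_integral B1 (real j * p)) {0..real j * p} \<and> (\<lambda>s. (cmod (f s))\<^sup>2) integrable_on {0..real j * p}" for j
  proof (induct j)
    case 0 show ?case using has_integral_refl(2)[of "\<lambda>s. (cmod (f s))\<^sup>2" 0]
      by (auto simp: B1_zero has_integral_refl integrable_on_def)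
  next
    case (Suc j)
    have e: "real (Suc j) * p = real j * p + p" by (simp add: algebra_simps)
    have "(f has_integral (B1 (real j * p) + (B1 (real j * p + p) - B1 (real j * p)))) {0..real j * p + p}"
      by (rule has_integral_combine[of _ "real j * p"]) (use Suc fint[of "real j * p + p" j] p in auto)
    moreover have "(\<lambda>s. (cmod (f s))\<^sup>2) integrable_on {0..real j * p + p}"
      by (rule Henstock_Kurzweil_Integration.integrable_combine[of _ "real j * p"]) (use Suc fsq[of j] p in auto)
    ultimately show ?case unfolding e by simp
  qed
  have "(f has_integral B1 t) {0..t}" if t: "0 \<le> t" for t
  proof -
    define j where "j = nat \<lfloor>t / p\<rfloor>"
    have "real j \<le> t / p" "t / p < real j + 1" using t p by (auto simp: j_def)
    then have j: "real j * p \<le> t" "t \<le> real j * p + p" using p by (auto simp: field_simps)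
    have "(f has_integral (B1 (real j * p) + (B1 t - B1 (real j * p)))) {0..t}"
      by (rule has_integral_combine[of _ "real j * p"]) (use step[of j] fint[of t j] p j in auto)
    then show ?thesis by simp
  qed
  moreover have "(\<lambda>s. (cmod (f s))\<^sup>2) integrable_on {0..T}" if "0 \<le> T" for T
  proof -
    obtain j where "T \<le> real j * p" using p by (metis ex_less_of_nat_mult less_imp_le)
    then show ?thesis using step[of j] that by (auto intro: integrable_on_subinterval)
  qed
  ultimately show ?thesis using that fm by blast
qed

end

section \<open>Vector-valued mild solutions\<close>

lemma mat_vec_index:
  assumes "A \<in> carrier_mat k n" "v \<in> carrier_vec n" "i < k"
  shows "(A *\<^sub>v v) $ i = (\<Sum>j<n. A $$ (i,j) * v $ j)"
  using assms by (simp add: scalar_prod_def lessThan_atLeast0)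

lemma L2_component: "f \<in> L2 n \<Longrightarrow> i < n \<Longrightarrow> sq_int (\<lambda>x. f x $ i)"
  by (auto simp: L2_def sq_int_def)

lemma L2_carrier: "f \<in> L2 n \<Longrightarrow> AE x in unit_measure. f x \<in> carrier_vec n"
  by (simp add: L2_def)

lemma L2I:
  "(AE x in unit_measure. f x \<in> carrier_vec n) \<Longrightarrow> (\<And>i. i < n \<Longrightarrow> sq_int (\<lambda>x. f x $ i)) \<Longrightarrow> f \<in> L2 n"
  by (auto simp: L2_def sq_int_def)

lemma L2_norm_energy:
  assumes "\<And>i. i < n \<Longrightarrow> sq_int (\<lambda>x. f x $ i)"
  shows "L2_norm n f = sqrt (\<Sum>i<n. energy (\<lambda>x. f x $ i))"
  unfolding L2_norm_def energy_def using assms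
  by (subst Bochner_Integration.integral_sum) (auto simp: sq_int_def)

lemma L2_norm_nonneg: "0 \<le> L2_norm n f"
  unfolding L2_norm_def by (auto intro!: real_sqrt_ge_zero Bochner_Integration.integral_nonneg sum_nonneg)

lemma energy_component_le:
  assumes "\<And>i. i < n \<Longrightarrow> sq_int (\<lambda>x. f x $ i)" and i: "i < n"
  shows "energy (\<lambda>x. f x $ i) \<le> (L2_norm n f)\<^sup>2"
proof -
  have "energy (\<lambda>x. f x $ i) \<le> (\<Sum>i<n. energy (\<lambda>x. f x $ i))"
    using i energy_nonneg by (intro member_le_sum) auto
  moreover have "L2_norm n f = sqrt (\<Sum>i<n. energy (\<lambda>x. f x $ i))" by (rule L2_norm_energy) (rule assms(1))
  ultimately show ?thesis by (simp add: sum_nonneg energy_nonneg)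
qed

lemma energy_cong_AE:
  assumes "sq_int f" "AE x in unit_measure. f x = g x"
  shows "energy f = energy g"
  unfolding energy_def
proof (rule integral_cong_AE)
  have "sq_int g" by (rule sq_int_cong_AE[OF assms])
  then show "(\<lambda>x. (cmod (f x))\<^sup>2) \<in> borel_measurable unit_measure"
    "(\<lambda>x. (cmod (g x))\<^sup>2) \<in> borel_measurable unit_measure"
    using assms(1) by (auto simp: sq_int_def)
  show "AE x in unit_measure. (cmod (f x))\<^sup>2 = (cmod (g x))\<^sup>2" using assms(2) by eventually_elim simp
qed

lemma energy_linear_combination:
  assumes "\<And>j. j < n \<Longrightarrow> sq_int (f j)"
  shows "energy (\<lambda>x. \<Sum>j<n. a j * f j x) \<le> (\<Sum>j<n. (cmod (a j))\<^sup>2) * (\<Sum>j<n. energy (f j))"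
proof -
  have b: "(cmod (\<Sum>j<n. a j * f j x))\<^sup>2 \<le> (\<Sum>j<n. (cmod (a j))\<^sup>2) * (\<Sum>j<n. (cmod (f j x))\<^sup>2)" for x
  proof -
    have "cmod (\<Sum>j<n. a j * f j x) \<le> (\<Sum>j<n. cmod (a j) * cmod (f j x))"
      by (rule order_trans[OF norm_sum]) (simp add: norm_mult)
    also have "\<dots> \<le> sqrt (\<Sum>j<n. (cmod (a j))\<^sup>2) * sqrt (\<Sum>j<n. (cmod (f j x))\<^sup>2)"
      using L2_set_mult_ineq[of "\<lambda>j. cmod (a j)" "\<lambda>j. cmod (f j x)" "{..<n}"] by (simp add: L2_set_def)
    finally have "(cmod (\<Sum>j<n. a j * f j x))\<^sup>2 \<le> (sqrt (\<Sum>j<n. (cmod (a j))\<^sup>2) * sqrt (\<Sum>j<n. (cmod (f j x))\<^sup>2))\<^sup>2"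
      by (rule power_mono) simp
    then show ?thesis by (simp add: power_mult_distrib sum_nonneg)
  qed
  have sq: "sq_int (\<lambda>x. \<Sum>j<n. a j * f j x)" using assms by (intro sq_int_sum sq_int_cmult) auto
  have i: "integrable unit_measure (\<lambda>x. (cmod (f j x))\<^sup>2)" if "j < n" for j using assms[OF that] by (simp add: sq_int_def)
  have "energy (\<lambda>x. \<Sum>j<n. a j * f j x)
      \<le> (\<integral>x. (\<Sum>j<n. (cmod (a j))\<^sup>2) * (\<Sum>j<n. (cmod (f j x))\<^sup>2) \<partial>unit_measure)"
    unfolding energy_def
  proof (rule Bochner_Integration.integral_mono)
    show "integrable unit_measure (\<lambda>x. (cmod (\<Sum>j<n. a j * f j x))\<^sup>2)" using sq by (simp add: sq_int_def)
    show "integrable unit_measure (\<lambda>x. (\<Sum>j<n. (cmod (a j))\<^sup>2) * (\<Sum>j<n. (cmod (f j x))\<^sup>2))"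
      using i by (intro integrable_mult_right Bochner_Integration.integrable_sum) auto
  qed (rule b)
  also have "\<dots> = (\<Sum>j<n. (cmod (a j))\<^sup>2) * (\<Sum>j<n. energy (f j))"
    unfolding energy_def using i by (simp add: Bochner_Integration.integral_sum)
  finally show ?thesis .
qed

definition frobenius_norm :: "nat \<Rightarrow> nat \<Rightarrow> complex mat \<Rightarrow> real" where
  "frobenius_norm k n A = sqrt (\<Sum>i<k. \<Sum>j<n. (cmod (A $$ (i,j)))\<^sup>2)"

text \<open>
  The matrix identity is only asked for componentwise and almost everywhere, which fits the Riemann sums
  in \<open>L2_has_integral\<close>.
\<close>

lemma L2_norm_linear_le:
  assumes f: "\<And>j. j < n \<Longrightarrow> sq_int (\<lambda>x. f x $ j)"
    and f': "\<And>i. i < k \<Longrightarrow> AE x in unit_measure. (\<Sum>j<n. A $$ (i,j) * f x $ j) = f' x $ i"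
  shows "L2_norm k f' \<le> frobenius_norm k n A * L2_norm n f"
proof -
  have c: "sq_int (\<lambda>x. \<Sum>j<n. A $$ (i,j) * f x $ j)" for i using f by (intro sq_int_sum sq_int_cmult) auto
  have s: "sq_int (\<lambda>x. f' x $ i)" if "i < k" for i by (rule sq_int_cong_AE[OF c f'[OF that]])
  have "(\<Sum>i<k. energy (\<lambda>x. f' x $ i)) = (\<Sum>i<k. energy (\<lambda>x. \<Sum>j<n. A $$ (i,j) * f x $ j))"
    by (intro sum.cong energy_cong_AE[OF c f', symmetric]) auto
  also have "\<dots> \<le> (\<Sum>i<k. (\<Sum>j<n. (cmod (A $$ (i,j)))\<^sup>2) * (\<Sum>j<n. energy (\<lambda>x. f x $ j)))"
    by (intro sum_mono energy_linear_combination f)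
  finally have "(\<Sum>i<k. energy (\<lambda>x. f' x $ i)) \<le> (\<Sum>i<k. \<Sum>j<n. (cmod (A $$ (i,j)))\<^sup>2) * (\<Sum>j<n. energy (\<lambda>x. f x $ j))"
    by (simp add: sum_distrib_right)
  moreover have "L2_norm n f = sqrt (\<Sum>j<n. energy (\<lambda>x. f x $ j))" by (rule L2_norm_energy) (rule f)
  moreover have "L2_norm k f' = sqrt (\<Sum>i<k. energy (\<lambda>x. f' x $ i))" by (rule L2_norm_energy) (rule s)
  ultimately show ?thesis unfolding frobenius_norm_def by (simp flip: real_sqrt_mult)
qed

lemma L2_linear:
  assumes A: "A \<in> carrier_mat k n" and f: "f \<in> L2 n" and f': "AE x in unit_measure. f' x = A *\<^sub>v f x"
  shows "f' \<in> L2 k" and "i < k \<Longrightarrow> AE x in unit_measure. (\<Sum>j<n. A $$ (i,j) * f x $ j) = f' x $ i"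
proof -
  show c: "AE x in unit_measure. (\<Sum>j<n. A $$ (i,j) * f x $ j) = f' x $ i" if "i < k" for i
    using f' L2_carrier[OF f] by eventually_elim (simp add: mat_vec_index[OF A _ that])
  show "f' \<in> L2 k"
  proof (rule L2I)
    show "AE x in unit_measure. f' x \<in> carrier_vec k" using f' L2_carrier[OF f] by eventually_elim (use A in simp)
    show "sq_int (\<lambda>x. f' x $ i)" if "i < k" for i
      by (rule sq_int_cong_AE[OF _ c[OF that]]) (intro sq_int_sum sq_int_cmult L2_component[OF f], simp)
  qed
qed

lemma L2_continuous_linear:
  assumes A: "A \<in> carrier_mat k n" and z: "L2_continuous n z"
    and z': "\<And>t. 0 \<le> t \<Longrightarrow> AE x in unit_measure. z' t x = A *\<^sub>v z t x"
  shows "L2_continuous k z'"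
  unfolding L2_continuous_def
proof (intro conjI allI impI)
  have zL: "z t \<in> L2 n" if "0 \<le> t" for t using z that by (simp add: L2_continuous_def)
  show z'L: "z' t \<in> L2 k" if "0 \<le> t" for t by (rule L2_linear(1)[OF A zL z']) (use that in auto)
  fix t :: real assume t: "0 \<le> t"
  have le: "L2_norm k (\<lambda>x. z' s x - z' t x) \<le> frobenius_norm k n A * L2_norm n (\<lambda>x. z s x - z t x)" if s: "0 \<le> s" for s
  proof (rule L2_norm_linear_le)
    have d: "AE x in unit_measure. z s x $ j - z t x $ j = (z s x - z t x) $ j" if "j < n" for j
      using L2_carrier[OF zL[OF t]] by eventually_elim (use that in simp)
    show "sq_int (\<lambda>x. (z s x - z t x) $ j)" if "j < n" for j
      by (rule sq_int_cong_AE[OF _ d[OF that]]) (intro sq_int_diff L2_component[OF zL[OF s] that] L2_component[OF zL[OF t] that])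
    show "AE x in unit_measure. (\<Sum>j<n. A $$ (i,j) * (z s x - z t x) $ j) = (z' s x - z' t x) $ i" if i: "i < k" for i
      using L2_linear(2)[OF A zL[OF s] z'[OF s] i] L2_linear(2)[OF A zL[OF t] z'[OF t] i]
        L2_carrier[OF zL[OF t]] L2_carrier[OF z'L[OF t]]
      by eventually_elim (use i in \<open>simp add: right_diff_distrib sum_subtractf\<close>)
  qed
  have "((\<lambda>s. L2_norm n (\<lambda>x. z s x - z t x)) \<longlongrightarrow> 0) (at t within {0..})"
    using z t by (simp add: L2_continuous_def)
  then have lim: "((\<lambda>s. frobenius_norm k n A * L2_norm n (\<lambda>x. z s x - z t x)) \<longlongrightarrow> 0) (at t within {0..})"
    by (rule tendsto_mult_right_zero)
  have ev: "\<forall>\<^sub>F s in at t within {0..}. L2_norm k (\<lambda>x. z' s x - z' t x) \<le> frobenius_norm k n A * L2_norm n (\<lambda>x. z s x - z t x)"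
    unfolding eventually_at_filter by (intro always_eventually allI impI le) simp
  show "((\<lambda>s. L2_norm k (\<lambda>x. z' s x - z' t x)) \<longlongrightarrow> 0) (at t within {0..})"
    by (rule tendsto_sandwich[OF always_eventually ev tendsto_const lim]) (simp add: L2_norm_nonneg)
qed

lemma L2_has_integral_linear:
  assumes A: "A \<in> carrier_mat k n" and z: "\<And>t. 0 \<le> t \<Longrightarrow> z t \<in> L2 n"
    and z': "\<And>t. 0 \<le> t \<Longrightarrow> AE x in unit_measure. z' t x = A *\<^sub>v z t x"
    and int: "L2_has_integral n z t Z"
  shows "L2_has_integral k z' t (\<lambda>x. A *\<^sub>v Z x)"
  unfolding L2_has_integral_def
proof (intro conjI allI impI)
  have Z: "Z \<in> L2 n" using int by (simp add: L2_has_integral_def)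
  show "(\<lambda>x. A *\<^sub>v Z x) \<in> L2 k" by (rule L2_linear(1)[OF A Z]) simp
  fix \<epsilon> :: real assume \<epsilon>: "\<epsilon> > 0"
  \<comment> \<open>\<open>1\<close> is added since \<open>\<epsilon>\<close> is divided by \<open>C\<close>\<close>
  define C where "C = frobenius_norm k n A + 1"
  have C: "C > 0" "frobenius_norm k n A \<le> C" by (auto simp: C_def frobenius_norm_def sum_nonneg intro: add_nonneg_pos)
  have "\<epsilon> / C > 0" using \<epsilon> C by simp
  then obtain \<delta> where \<delta>: "\<delta> > 0" and small: "\<forall>P. P tagged_division_of {0..t} \<and> (\<forall>(\<tau>, J)\<in>P. diameter J < \<delta>) \<longrightarrow>
      L2_norm n (\<lambda>x. vec n (\<lambda>i. Z x $ i - (\<Sum>(\<tau>, J)\<in>P. of_real (measure lborel J) * z \<tau> x $ i))) < \<epsilon> / C"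
    using int unfolding L2_has_integral_def by blast
  have "L2_norm k (\<lambda>x. vec k (\<lambda>i. (A *\<^sub>v Z x) $ i - (\<Sum>(\<tau>, J)\<in>P. of_real (measure lborel J) * z' \<tau> x $ i))) < \<epsilon>"
    if P: "P tagged_division_of {0..t} \<and> (\<forall>(\<tau>, J)\<in>P. diameter J < \<delta>)" for P
  proof -
    have fin: "finite P" using P by (blast intro: tagged_division_of_finite)
    have tag: "0 \<le> fst p" if "p \<in> P" for p
      using tagged_division_ofD(2,3)[of P "{0..t}" "fst p" "snd p"] P that by fastforce
    have "L2_norm k (\<lambda>x. vec k (\<lambda>i. (A *\<^sub>v Z x) $ i - (\<Sum>(\<tau>, J)\<in>P. of_real (measure lborel J) * z' \<tau> x $ i)))
      \<le> frobenius_norm k n A * L2_norm n (\<lambda>x. vec n (\<lambda>i. Z x $ i - (\<Sum>(\<tau>, J)\<in>P. of_real (measure lborel J) * z \<tau> x $ i)))"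
    proof (rule L2_norm_linear_le)
      show "sq_int (\<lambda>x. vec n (\<lambda>i. Z x $ i - (\<Sum>(\<tau>, J)\<in>P. of_real (measure lborel J) * z \<tau> x $ i)) $ j)" if j: "j < n" for j
        unfolding index_vec[OF j] case_prod_beta
        by (intro sq_int_diff sq_int_sum sq_int_cmult L2_component[OF Z] L2_component[OF z] j tag)
      fix i assume i: "i < k"
      have "AE x in unit_measure. \<forall>p\<in>P. (\<Sum>j<n. A $$ (i,j) * z (fst p) x $ j) = z' (fst p) x $ i"
        using L2_linear(2)[OF A z z' i] tag by (intro AE_finite_allI[OF fin]) auto
      moreover have "AE x in unit_measure. (\<Sum>j<n. A $$ (i,j) * Z x $ j) = (A *\<^sub>v Z x) $ i"
        by (rule L2_linear(2)[OF A Z _ i]) simp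
      ultimately show "AE x in unit_measure. (\<Sum>j<n. A $$ (i,j) *
          vec n (\<lambda>i. Z x $ i - (\<Sum>(\<tau>, J)\<in>P. of_real (measure lborel J) * z \<tau> x $ i)) $ j)
          = vec k (\<lambda>i. (A *\<^sub>v Z x) $ i - (\<Sum>(\<tau>, J)\<in>P. of_real (measure lborel J) * z' \<tau> x $ i)) $ i"
      proof eventually_elim
        case (elim x)
        have "(\<Sum>j<n. A $$ (i,j) * vec n (\<lambda>i. Z x $ i - (\<Sum>(\<tau>, J)\<in>P. of_real (measure lborel J) * z \<tau> x $ i)) $ j)
            = (\<Sum>j<n. A $$ (i,j) * Z x $ j) - (\<Sum>j<n. \<Sum>p\<in>P. A $$ (i,j) * (of_real (measure lborel (snd p)) * z (fst p) x $ j))"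
          by (simp add: right_diff_distrib sum_subtractf case_prod_beta sum_distrib_left)
        also have "(\<Sum>j<n. \<Sum>p\<in>P. A $$ (i,j) * (of_real (measure lborel (snd p)) * z (fst p) x $ j))
            = (\<Sum>p\<in>P. of_real (measure lborel (snd p)) * (\<Sum>j<n. A $$ (i,j) * z (fst p) x $ j))"
          by (subst sum.swap) (simp add: sum_distrib_left mult.left_commute)
        also have "\<dots> = (\<Sum>p\<in>P. of_real (measure lborel (snd p)) * z' (fst p) x $ i)"
          using elim(1) by (intro sum.cong) auto
        finally show ?case using elim(2) i by (simp add: case_prod_beta)
      qed
    qed
    also have "\<dots> \<le> C * L2_norm n (\<lambda>x. vec n (\<lambda>i. Z x $ i - (\<Sum>(\<tau>, J)\<in>P. of_real (measure lborel J) * z \<tau> x $ i)))"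
      by (rule mult_right_mono[OF C(2) L2_norm_nonneg])
    also have "\<dots> < C * (\<epsilon> / C)"
    proof (rule mult_strict_left_mono[OF _ C(1)])
      show "L2_norm n (\<lambda>x. vec n (\<lambda>i. Z x $ i - (\<Sum>(\<tau>, J)\<in>P. of_real (measure lborel J) * z \<tau> x $ i))) < \<epsilon> / C"
        using small P by blast
    qed
    finally show ?thesis using C(1) by simp
  qed
  then show "\<exists>\<delta>>0. \<forall>P. P tagged_division_of {0..t} \<and> (\<forall>(\<tau>, J)\<in>P. diameter J < \<delta>) \<longrightarrow>
      L2_norm k (\<lambda>x. vec k (\<lambda>i. (A *\<^sub>v Z x) $ i - (\<Sum>(\<tau>, J)\<in>P. of_real (measure lborel J) * z' \<tau> x $ i))) < \<epsilon>"
    using \<delta> by blast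
qed

lemma sq_int_integrable_initial: "sq_int f \<Longrightarrow> x \<in> {0..1} \<Longrightarrow> integrable (lebesgue_on {0<..<x}) f"
  using sq_int_integrable_on[of f 0 x]
  by (intro absolutely_integrable_imp_integrable) (auto simp: absolutely_integrable_on_def integrable_on_Icc_iff_Ioo)

lemma H1_linear:
  assumes A: "A \<in> carrier_mat k n" and H: "H1 n g gc h" and g': "AE x in unit_measure. g' x = A *\<^sub>v g x"
  shows "H1 k g' (\<lambda>x. A *\<^sub>v gc x) (\<lambda>x. A *\<^sub>v h x)"
  unfolding H1_def
proof (intro conjI ballI allI impI)
  have g: "g \<in> L2 n" and h: "h \<in> L2 n" and gc: "\<And>x. x \<in> {0..1} \<Longrightarrow> gc x \<in> carrier_vec n"
    and gch: "\<And>x i. x \<in> {0..1} \<Longrightarrow> i < n \<Longrightarrow> gc x $ i = gc 0 $ i + (\<integral>y. h y $ i \<partial>lebesgue_on {0<..<x})"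
    and ggc: "AE x in unit_measure. g x = gc x" using H unfolding H1_def by blast+
  show "g' \<in> L2 k" by (rule L2_linear(1)[OF A g g'])
  show "(\<lambda>x. A *\<^sub>v h x) \<in> L2 k" by (rule L2_linear(1)[OF A h]) simp
  show "AE x in unit_measure. g' x = A *\<^sub>v gc x" using g' ggc by eventually_elim simp
  fix x :: real assume x: "x \<in> {0..1}"
  show "A *\<^sub>v gc x \<in> carrier_vec k" using A gc[OF x] by simp
  fix i assume i: "i < k"
  have sub: "AE y in lebesgue_on {0<..<x}. P y" if "AE y in unit_measure. P y" for P
  proof -
    have "AE y in lebesgue. y \<in> {0<..<1} \<longrightarrow> P y" using that by (subst (asm) AE_restrict_space_iff) simp_all
    then have "AE y in lebesgue. y \<in> {0<..<x} \<longrightarrow> P y" by eventually_elim (use x in auto)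
    then show ?thesis by (subst AE_restrict_space_iff) simp_all
  qed
  have hj: "integrable (lebesgue_on {0<..<x}) (\<lambda>y. h y $ j)" if "j < n" for j
    by (rule sq_int_integrable_initial[OF L2_component[OF h that] x])
  have "(A *\<^sub>v gc x) $ i = (\<Sum>j<n. A $$ (i,j) * (gc 0 $ j + (\<integral>y. h y $ j \<partial>lebesgue_on {0<..<x})))"
    unfolding mat_vec_index[OF A gc[OF x] i] by (intro sum.cong refl) (simp only: gch[OF x] lessThan_iff)
  also have "\<dots> = (\<Sum>j<n. A $$ (i,j) * gc 0 $ j) + (\<Sum>j<n. A $$ (i,j) * (\<integral>y. h y $ j \<partial>lebesgue_on {0<..<x}))"
    by (simp add: distrib_left sum.distrib)
  also have "(\<Sum>j<n. A $$ (i,j) * gc 0 $ j) = (A *\<^sub>v gc 0) $ i" using mat_vec_index[OF A gc i, of 0] by simp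
  also have "(\<Sum>j<n. A $$ (i,j) * (\<integral>y. h y $ j \<partial>lebesgue_on {0<..<x}))
      = (\<integral>y. (\<Sum>j<n. A $$ (i,j) * h y $ j) \<partial>lebesgue_on {0<..<x})"
  proof -
    have "(\<integral>y. (\<Sum>j<n. A $$ (i,j) * h y $ j) \<partial>lebesgue_on {0<..<x})
        = (\<Sum>j<n. \<integral>y. A $$ (i,j) * h y $ j \<partial>lebesgue_on {0<..<x})"
      by (rule Bochner_Integration.integral_sum) (intro integrable_mult_right hj, simp)
    then show ?thesis by simp
  qed
  also have "\<dots> = (\<integral>y. (A *\<^sub>v h y) $ i \<partial>lebesgue_on {0<..<x})"
  proof (rule integral_cong_AE)
    show "AE y in lebesgue_on {0<..<x}. (\<Sum>j<n. A $$ (i,j) * h y $ j) = (A *\<^sub>v h y) $ i"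
      by (rule sub, rule L2_linear(2)[OF A h _ i]) simp
    show "(\<lambda>y. \<Sum>j<n. A $$ (i,j) * h y $ j) \<in> borel_measurable (lebesgue_on {0<..<x})"
      by (intro borel_measurable_sum borel_measurable_times borel_measurable_const borel_measurable_integrable hj) simp
    have "sq_int (\<lambda>y. (A *\<^sub>v h y) $ i)" by (rule L2_component[OF L2_linear(1)[OF A h] i]) simp
    then show "(\<lambda>y. (A *\<^sub>v h y) $ i) \<in> borel_measurable (lebesgue_on {0<..<x})"
      by (rule borel_measurable_integrable[OF sq_int_integrable_initial[OF _ x]])
  qed
  finally show "(A *\<^sub>v gc x) $ i = (A *\<^sub>v gc 0) $ i + (\<integral>y. (A *\<^sub>v h y) $ i \<partial>lebesgue_on {0<..<x})" .
qed

text \<open>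
  All components travel with the same speed, so a constant matrix maps mild solutions to mild solutions.
  This is used with \<open>Q\<close>, with its left inverse \<open>P\<close> and with the projection \<open>1 - Q P\<close>.
\<close>

lemma mild_transport_linear:
  assumes A: "A \<in> carrier_mat k n" and mt: "mild_transport n lam0 z B0 B1"
    and z': "\<And>t. 0 \<le> t \<Longrightarrow> AE x in unit_measure. z' t x = A *\<^sub>v z t x"
  shows "mild_transport k lam0 z' (\<lambda>t. A *\<^sub>v B0 t) (\<lambda>t. A *\<^sub>v B1 t)"
  unfolding mild_transport_def
proof (intro conjI allI impI)
  have zc: "L2_continuous n z" using mt by (simp add: mild_transport_def)
  have zL: "z t \<in> L2 n" if "0 \<le> t" for t using zc that by (simp add: L2_continuous_def)
  show "L2_continuous k z'" by (rule L2_continuous_linear[OF A zc z'])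
  fix t :: real assume t: "0 \<le> t"
  obtain Z gc h where Z: "L2_has_integral n z t Z" and H: "H1 n (\<lambda>x. of_real (lam0 x) \<cdot>\<^sub>v Z x) gc h"
    and zh: "AE x in unit_measure. z t x - z 0 x = - h x" and B: "B0 t = gc 0" "B1 t = gc 1"
    using mt t unfolding mild_transport_def by blast
  have hL: "h \<in> L2 n" using H unfolding H1_def by blast
  have "H1 k (\<lambda>x. of_real (lam0 x) \<cdot>\<^sub>v (A *\<^sub>v Z x)) (\<lambda>x. A *\<^sub>v gc x) (\<lambda>x. A *\<^sub>v h x)"
  proof (rule H1_linear[OF A H])
    have "AE x in unit_measure. Z x \<in> carrier_vec n" using Z by (simp add: L2_has_integral_def L2_carrier)
    then show "AE x in unit_measure. of_real (lam0 x) \<cdot>\<^sub>v (A *\<^sub>v Z x) = A *\<^sub>v (of_real (lam0 x) \<cdot>\<^sub>v Z x)"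
      by eventually_elim (simp add: mult_mat_vec[OF A])
  qed
  moreover have "AE x in unit_measure. z' t x - z' 0 x = - (A *\<^sub>v h x)"
    using z'[OF t] z'[of 0, simplified] zh L2_carrier[OF zL[OF t]] L2_carrier[OF zL[of 0, simplified]] L2_carrier[OF hL]
  proof eventually_elim
    case (elim x)
    have h: "h x \<in> carrier_vec n" by (rule elim(6))
    have "z' t x - z' 0 x = A *\<^sub>v (z t x - z 0 x)"
      unfolding elim(1,2) by (rule mult_minus_distrib_mat_vec[OF A elim(4,5), symmetric])
    also have "\<dots> = - (A *\<^sub>v h x)" unfolding elim(3)
      using A h by (intro eq_vecI) (simp_all add: mat_vec_index[OF A] sum_negf)
    finally show ?case .
  qed
  ultimately show "\<exists>Z gc h. L2_has_integral k z' t Z \<and> H1 k (\<lambda>x. of_real (lam0 x) \<cdot>\<^sub>v Z x) gc h \<and>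
      (AE x in unit_measure. z' t x - z' 0 x = - h x) \<and> A *\<^sub>v B0 t = gc 0 \<and> A *\<^sub>v B1 t = gc 1"
    using L2_has_integral_linear[OF A zL z' Z] B
    by (intro exI[of _ "\<lambda>x. A *\<^sub>v Z x"] exI[of _ "\<lambda>x. A *\<^sub>v gc x"] exI[of _ "\<lambda>x. A *\<^sub>v h x"]) simp
qed

lemma mild_transport_component:
  assumes "slowness \<kappa> \<alpha> \<beta>" and lam: "AE x in unit_measure. \<kappa> x * lam0 x = 1"
    and mt: "mild_transport n lam0 z B0 B1" and i: "i < n"
  shows "scalar_transport \<kappa> \<alpha> \<beta> lam0 (\<lambda>t x. z t x $ i) (\<lambda>t. B0 t $ i) (\<lambda>t. B1 t $ i)"
proof (intro scalar_transport.intro scalar_transport_axioms.intro)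
  show "slowness \<kappa> \<alpha> \<beta>" "AE x in unit_measure. \<kappa> x * lam0 x = 1" by fact+
  have zL: "z t \<in> L2 n" if "0 \<le> t" for t using mt that by (simp add: mild_transport_def L2_continuous_def)
  show "sq_int (\<lambda>x. z t x $ i)" if "0 \<le> t" for t by (rule L2_component[OF zL[OF that] i])
  fix t :: real assume t: "0 \<le> t"
  have le: "energy (\<lambda>x. z s x $ i - z t x $ i) \<le> (L2_norm n (\<lambda>x. z s x - z t x))\<^sup>2" if s: "0 \<le> s" for s
  proof -
    have d: "AE x in unit_measure. z s x $ j - z t x $ j = (z s x - z t x) $ j" if "j < n" for j
      using L2_carrier[OF zL[OF t]] by eventually_elim (use that in simp)
    have sq: "sq_int (\<lambda>x. z s x $ j - z t x $ j)" if "j < n" for j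
      by (intro sq_int_diff L2_component[OF zL[OF s] that] L2_component[OF zL[OF t] that])
    have "energy (\<lambda>x. z s x $ i - z t x $ i) = energy (\<lambda>x. (z s x - z t x) $ i)"
      by (rule energy_cong_AE[OF sq[OF i] d[OF i]])
    also have "\<dots> \<le> (L2_norm n (\<lambda>x. z s x - z t x))\<^sup>2"
      by (rule energy_component_le[OF _ i], rule sq_int_cong_AE[OF sq d])
    finally show ?thesis .
  qed
  have "((\<lambda>s. L2_norm n (\<lambda>x. z s x - z t x)) \<longlongrightarrow> 0) (at t within {0..})"
    using mt t by (simp add: mild_transport_def L2_continuous_def)
  then have lim: "((\<lambda>s. (L2_norm n (\<lambda>x. z s x - z t x))\<^sup>2) \<longlongrightarrow> 0) (at t within {0..})"
    using tendsto_power[of _ 0 _ 2] by simp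
  have ev: "\<forall>\<^sub>F s in at t within {0..}. energy (\<lambda>x. z s x $ i - z t x $ i) \<le> (L2_norm n (\<lambda>x. z s x - z t x))\<^sup>2"
    unfolding eventually_at_filter by (intro always_eventually allI impI le) simp
  show "((\<lambda>s. energy (\<lambda>x. z s x $ i - z t x $ i)) \<longlongrightarrow> 0) (at t within {0..})"
    by (rule tendsto_sandwich[OF always_eventually ev tendsto_const lim]) (simp add: energy_nonneg)
  obtain Z gc h where Z: "L2_has_integral n z t Z" and H: "H1 n (\<lambda>x. of_real (lam0 x) \<cdot>\<^sub>v Z x) gc h"
    and zh: "AE x in unit_measure. z t x - z 0 x = - h x" and B: "B0 t = gc 0" "B1 t = gc 1"
    using mt t unfolding mild_transport_def by blast
  have ZL: "Z \<in> L2 n" using Z by (simp add: L2_has_integral_def)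
  have hL: "h \<in> L2 n" using H unfolding H1_def by blast
  have "\<exists>\<delta>>0. \<forall>P. P tagged_division_of {0..t} \<and> (\<forall>(s, J)\<in>P. diameter J < \<delta>) \<longrightarrow>
      energy (\<lambda>x. Z x $ i - (\<Sum>(s, J)\<in>P. of_real (measure lborel J) * z s x $ i)) < \<epsilon>" if \<epsilon>: "\<epsilon> > 0" for \<epsilon>
  proof -
    have "sqrt \<epsilon> > 0" using \<epsilon> by simp
    then obtain \<delta> where \<delta>: "\<delta> > 0" and small: "\<forall>P. P tagged_division_of {0..t} \<and> (\<forall>(\<tau>, J)\<in>P. diameter J < \<delta>) \<longrightarrow>
      L2_norm n (\<lambda>x. vec n (\<lambda>i. Z x $ i - (\<Sum>(\<tau>, J)\<in>P. of_real (measure lborel J) * z \<tau> x $ i))) < sqrt \<epsilon>"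
      using Z unfolding L2_has_integral_def by blast
    have "energy (\<lambda>x. Z x $ i - (\<Sum>(s, J)\<in>P. of_real (measure lborel J) * z s x $ i)) < \<epsilon>"
      if P: "P tagged_division_of {0..t} \<and> (\<forall>(s, J)\<in>P. diameter J < \<delta>)" for P
    proof -
      let ?v = "\<lambda>x. vec n (\<lambda>i. Z x $ i - (\<Sum>(\<tau>, J)\<in>P. of_real (measure lborel J) * z \<tau> x $ i))"
      have tag: "0 \<le> fst p" if "p \<in> P" for p
        using tagged_division_ofD(2,3)[of P "{0..t}" "fst p" "snd p"] P that by fastforce
      have sq: "sq_int (\<lambda>x. ?v x $ j)" if j: "j < n" for j
        unfolding index_vec[OF j] case_prod_beta
        by (intro sq_int_diff sq_int_sum sq_int_cmult L2_component[OF ZL] L2_component[OF zL] j tag)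
      have "energy (\<lambda>x. ?v x $ i) \<le> (L2_norm n ?v)\<^sup>2" by (rule energy_component_le[OF sq i])
      also have "\<dots> < (sqrt \<epsilon>)\<^sup>2"
      proof (rule power_strict_mono)
        show "L2_norm n ?v < sqrt \<epsilon>" using small P by blast
      qed (simp_all add: L2_norm_nonneg)
      finally show ?thesis using \<epsilon> i by simp
    qed
    then show ?thesis using \<delta> by blast
  qed
  moreover have "AE x in unit_measure. of_real (lam0 x) * Z x $ i = gc x $ i"
  proof -
    have "AE x in unit_measure. of_real (lam0 x) \<cdot>\<^sub>v Z x = gc x" using H unfolding H1_def by blast
    with L2_carrier[OF ZL] show ?thesis
    proof eventually_elim
      case (elim x)
      have "of_real (lam0 x) * Z x $ i = (of_real (lam0 x) \<cdot>\<^sub>v Z x) $ i" using elim(1) i by simp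
      then show ?case unfolding elim(2) .
    qed
  qed
  moreover have "AE x in unit_measure. z t x $ i - z 0 x $ i = - h x $ i"
    using zh L2_carrier[OF zL[of 0, simplified]] L2_carrier[OF hL]
  proof eventually_elim
    case (elim x)
    have "z t x $ i - z 0 x $ i = (z t x - z 0 x) $ i" using elim(2) i by simp
    also have "\<dots> = - h x $ i" unfolding elim(1) using elim(3) i by simp
    finally show ?case .
  qed
  moreover have "\<forall>x\<in>{0..1}. gc x $ i = gc 0 $ i + (\<integral>y. h y $ i \<partial>lebesgue_on {0<..<x})"
  proof
    fix x :: real assume x: "x \<in> {0..1}"
    have "\<forall>i<n. gc x $ i = gc 0 $ i + (\<integral>y. h y $ i \<partial>lebesgue_on {0<..<x})"
      using H x unfolding H1_def by blast
    then show "gc x $ i = gc 0 $ i + (\<integral>y. h y $ i \<partial>lebesgue_on {0<..<x})" using i by blast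
  qed
  moreover have "B0 t $ i = gc 0 $ i" "B1 t $ i = gc 1 $ i" using B by simp_all
  moreover note L2_component[OF ZL i] L2_component[OF hL i]
  ultimately show "\<exists>Z g h. sq_int Z \<and> sq_int h \<and>
      (\<forall>\<epsilon>>0. \<exists>\<delta>>0. \<forall>P. P tagged_division_of {0..t} \<and> (\<forall>(s, J)\<in>P. diameter J < \<delta>) \<longrightarrow>
        energy (\<lambda>x. Z x - (\<Sum>(s, J)\<in>P. of_real (measure lborel J) * z s x $ i)) < \<epsilon>) \<and>
      (\<forall>x\<in>{0..1}. g x = g 0 + (\<integral>y. h y \<partial>lebesgue_on {0<..<x})) \<and>
      (AE x in unit_measure. of_real (lam0 x) * Z x = g x) \<and>
      (AE x in unit_measure. z t x $ i - z 0 x $ i = - h x) \<and> B0 t $ i = g 0 \<and> B1 t $ i = g 1"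
    by (intro exI[of _ "\<lambda>x. Z x $ i"] exI[of _ "\<lambda>x. gc x $ i"] exI[of _ "\<lambda>x. h x $ i"] conjI) (assumption | blast)+
qed

section \<open>Boundary traces of mild solutions\<close>

text \<open>
  \<open>b\<close> is the primitive, vanishing at \<open>0\<close>, of the locally square integrable function \<open>f\<close>. A Borel
  representative on the whole line lets densities be shifted in time.
\<close>

definition l2_density :: "(real \<Rightarrow> complex) \<Rightarrow> (real \<Rightarrow> complex) \<Rightarrow> bool" where
  "l2_density f b \<longleftrightarrow> f \<in> borel_measurable borel \<and>
     (\<forall>T\<ge>0. (\<lambda>s. (cmod (f s))\<^sup>2) integrable_on {0..T}) \<and> (\<forall>t\<ge>0. (f has_integral b t) {0..t})"

lemma borel_on_interval: "f \<in> borel_measurable borel \<Longrightarrow> f \<in> borel_measurable (lebesgue_on S)"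
  by (intro measurable_restrict_space1 measurable_completion) simp

lemma l2_density_cmult: "l2_density f b \<Longrightarrow> l2_density (\<lambda>s. c * f s) (\<lambda>t. c * b t)"
  unfolding l2_density_def
  by (auto simp: norm_mult power_mult_distrib intro!: has_integral_mult_right integrable_on_mult_right)

lemma l2_density_add:
  assumes f: "l2_density f b" and g: "l2_density g c"
  shows "l2_density (\<lambda>s. f s + g s) (\<lambda>t. b t + c t)"
  unfolding l2_density_def
proof (intro conjI allI impI)
  have [measurable]: "f \<in> borel_measurable borel" "g \<in> borel_measurable borel"
    using f g by (auto simp: l2_density_def)
  show fg: "(\<lambda>s. f s + g s) \<in> borel_measurable borel" by measurable
  show "((\<lambda>s. f s + g s) has_integral b t + c t) {0..t}" if "0 \<le> t" for t
    using f g that by (intro has_integral_add) (auto simp: l2_density_def)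
  fix T :: real assume T: "0 \<le> T"
  show "(\<lambda>s. (cmod (f s + g s))\<^sup>2) integrable_on {0..T}"
  proof (rule measurable_bounded_by_integrable_imp_integrable)
    show "(\<lambda>s. (cmod (f s + g s))\<^sup>2) \<in> borel_measurable (lebesgue_on {0..T})"
      by (rule borel_on_interval) measurable
    show "(\<lambda>s. 2 * (cmod (f s))\<^sup>2 + 2 * (cmod (g s))\<^sup>2) integrable_on {0..T}"
      using f g T by (intro integrable_add integrable_on_mult_right) (auto simp: l2_density_def)
    show "norm ((cmod (f s + g s))\<^sup>2) \<le> 2 * (cmod (f s))\<^sup>2 + 2 * (cmod (g s))\<^sup>2" for s
      using cmod_add_squared_le[of "f s" "g s"] by simp
  qed simp
qed

lemma l2_density_zero: "l2_density (\<lambda>s. 0) (\<lambda>t. 0)"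
  by (auto simp: l2_density_def intro: integrable_0)

lemma l2_density_sum:
  assumes "\<And>i. i \<in> I \<Longrightarrow> l2_density (f i) (b i)"
  shows "l2_density (\<lambda>s. \<Sum>i\<in>I. f i s) (\<lambda>t. \<Sum>i\<in>I. b i t)"
  using assms
proof (induct I rule: infinite_finite_induct)
  case (insert x F)
  then show ?case using l2_density_add[of "f x" "b x" "\<lambda>s. \<Sum>i\<in>F. f i s" "\<lambda>t. \<Sum>i\<in>F. b i t"] by simp
qed (simp_all add: l2_density_zero)

lemma l2_density_shift:
  assumes f: "l2_density f b" and p: "0 \<le> p"
  shows "l2_density (\<lambda>s. f (s + p)) (\<lambda>t. b (t + p) - b p)"
  unfolding l2_density_def
proof (intro conjI allI impI)
  have [measurable]: "f \<in> borel_measurable borel" using f by (simp add: l2_density_def)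
  show "(\<lambda>s. f (s + p)) \<in> borel_measurable borel" by measurable
  have int: "(f has_integral b t) {0..t}" if "0 \<le> t" for t using f that by (simp add: l2_density_def)
  have shift: "((\<lambda>s. F (s + p)) has_integral I) {0..t} \<longleftrightarrow> (F has_integral I) {p..t + p}"
    for F :: "real \<Rightarrow> 'b::euclidean_space" and I t
    using has_integral_shift_Icc_real[of F p I 0 t] by (simp add: o_def add.commute)
  show "((\<lambda>s. f (s + p)) has_integral b (t + p) - b p) {0..t}" if t: "0 \<le> t" for t
  proof -
    have i: "f integrable_on {0..t + p}" using int[of "t + p"] t p by auto
    have "integral {0..p} f + integral {p..t + p} f = integral {0..t + p} f"
      using t p i by (intro Henstock_Kurzweil_Integration.integral_combine) auto
    then have "integral {p..t + p} f = b (t + p) - b p"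
      using integral_unique[OF int[of p]] integral_unique[OF int[of "t + p"]] t p by (simp add: algebra_simps)
    moreover have "f integrable_on {p..t + p}" by (rule integrable_on_subinterval[OF i]) (use p in auto)
    ultimately show ?thesis unfolding shift by (simp add: has_integral_integrable_integral)
  qed
  fix T :: real assume T: "0 \<le> T"
  have "(\<lambda>s. (cmod (f s))\<^sup>2) integrable_on {0..T + p}" using f T p by (simp add: l2_density_def)
  then have "(\<lambda>s. (cmod (f s))\<^sup>2) integrable_on {p..T + p}" by (rule integrable_on_subinterval) (use p in auto)
  then show "(\<lambda>s. (cmod (f (s + p)))\<^sup>2) integrable_on {0..T}"
    using shift[of "\<lambda>s. (cmod (f s))\<^sup>2"] unfolding integrable_on_def by simp
qed

lemma l2_density_L2_loc:
  assumes f: "l2_density f b"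
  shows "f \<in> L2_loc" and "0 \<le> t \<Longrightarrow> (\<integral>s. f s \<partial>lebesgue_on {0<..<t}) = b t"
proof -
  have fm: "f \<in> borel_measurable borel" using f by (simp add: l2_density_def)
  have sq: "integrable (lebesgue_on {0<..<T}) (\<lambda>s. (cmod (f s))\<^sup>2)" if "0 \<le> T" for T
  proof (rule absolutely_integrable_imp_integrable)
    show "(\<lambda>s. (cmod (f s))\<^sup>2) absolutely_integrable_on {0<..<T}"
      using f that by (intro nonnegative_absolutely_integrable_1) (auto simp: l2_density_def simp flip: integrable_on_Icc_iff_Ioo)
  qed simp
  then show "f \<in> L2_loc" using borel_on_interval[OF fm] by (simp add: L2_loc_def)
  show "(\<integral>s. f s \<partial>lebesgue_on {0<..<t}) = b t" if t: "0 \<le> t"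
  proof -
    interpret finite_measure "lebesgue_on {0<..<t}" by (rule finite_measure_lebesgue_on) simp
    have "integrable (lebesgue_on {0<..<t}) f"
    proof (rule Bochner_Integration.integrable_bound[where f = "\<lambda>s. 1 + (cmod (f s))\<^sup>2"])
      show "integrable (lebesgue_on {0<..<t}) (\<lambda>s. 1 + (cmod (f s))\<^sup>2)" using sq[OF t] by simp
      show "AE s in lebesgue_on {0<..<t}. norm (f s) \<le> norm (1 + (cmod (f s))\<^sup>2)"
        by (rule AE_I2) (rule cmod_le_one_plus_squared)
    qed (rule borel_on_interval[OF fm])
    then have "(\<integral>s. f s \<partial>lebesgue_on {0<..<t}) = integral {0..t} f"
      by (subst lebesgue_integral_eq_integral) (auto simp: integral_open_interval_real)
    also have "\<dots> = b t" using f t by (intro integral_unique) (simp add: l2_density_def)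
    finally show ?thesis .
  qed
qed

lemma mild_transport_traces_carrier:
  assumes "mild_transport n lam0 z B0 B1" "0 \<le> t"
  shows "B0 t \<in> carrier_vec n" "B1 t \<in> carrier_vec n"
proof -
  obtain Z gc h where H: "H1 n (\<lambda>x. of_real (lam0 x) \<cdot>\<^sub>v Z x) gc h" and B: "B0 t = gc 0" "B1 t = gc 1"
    using assms unfolding mild_transport_def by blast
  have "gc x \<in> carrier_vec n" if "x \<in> {0..1}" for x using H that unfolding H1_def by blast
  then show "B0 t \<in> carrier_vec n" "B1 t \<in> carrier_vec n" using B by simp_all
qed

context slowness begin

context
  fixes lam0 :: "real \<Rightarrow> real" and n :: nat and z B0 B1
  assumes lam: "AE x in unit_measure. \<kappa> x * lam0 x = 1"
    and mt: "mild_transport n lam0 z B0 B1"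
begin

lemma tau1_nonneg: "0 \<le> \<tau> 1" using tau_le_iff[of 0 1] by simp

lemma component_transport: "i < n \<Longrightarrow> scalar_transport \<kappa> \<alpha> \<beta> lam0 (\<lambda>t x. z t x $ i) (\<lambda>t. B0 t $ i) (\<lambda>t. B1 t $ i)"
  by (rule mild_transport_component[OF _ lam mt]) unfold_locales

lemma outflow_starts_zero: "B1 0 = 0\<^sub>v n"
  using mild_transport_traces_carrier[OF mt, of 0] scalar_transport.B1_zero[OF component_transport]
  by (intro eq_vecI) auto

lemma inflow_is_advanced_outflow: "0 \<le> t \<Longrightarrow> B0 t = B1 (t + \<tau> 1) - B1 (\<tau> 1)"
  using mild_transport_traces_carrier[OF mt, of t] mild_transport_traces_carrier[OF mt, of "t + \<tau> 1"]
    mild_transport_traces_carrier[OF mt, of "\<tau> 1"] scalar_transport.B0_advanced[OF component_transport, of _ t] tau1_nonneg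
  by (intro eq_vecI) auto

text \<open>Everything in the domain leaves it eventually, so a state that is never seen at \<open>x = 1\<close> is zero.\<close>

lemma zero_outflow_imp_zero_state:
  assumes B1: "\<And>t. 0 \<le> t \<Longrightarrow> B1 t = 0\<^sub>v n" and t: "0 \<le> t"
  shows "AE x in unit_measure. z t x = 0\<^sub>v n"
proof -
  have zL: "z t \<in> L2 n" using mt t by (simp add: mild_transport_def L2_continuous_def)
  have "AE x in unit_measure. z t x $ i = 0" if i: "i < n" for i
  proof (rule zero_primitive_imp_AE_zero)
    show "sq_int (\<lambda>x. z t x $ i)" by (rule L2_component[OF zL i])
    fix x :: real assume x: "x \<in> {0..1}"
    have "\<tau> x \<le> \<tau> 1" using x by simp
    then have "0 \<le> t + \<tau> 1 - \<tau> x" using t by linarith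
    then show "integral {0..x} (\<lambda>x. z t x $ i) = 0"
      using scalar_transport.state_primitive[OF component_transport[OF i] t x] B1 i tau1_nonneg t by simp
  qed
  then have "AE x in unit_measure. \<forall>i\<in>{..<n}. z t x $ i = 0" by (intro AE_finite_allI) auto
  with L2_carrier[OF zL] show ?thesis
    by eventually_elim (intro eq_vecI, auto)
qed

text \<open>
  With it, every combination of the boundary values serves as an input: the inflow inherits its density
  from the outflow, one travel time later.
\<close>

lemma boundary_functional_density:
  assumes K: "K \<in> carrier_mat 1 n" and L: "L \<in> carrier_mat 1 n"
  shows "\<exists>u\<in>L2_loc. \<forall>t\<ge>0. (\<integral>s. u s \<partial>lebesgue_on {0<..<t}) = (K *\<^sub>v B0 t + L *\<^sub>v B1 t) $ 0"
proof -
  have "\<exists>f. l2_density f (\<lambda>t. B1 t $ i)" if "i < n" for i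
  proof (rule scalar_transport.outflow_trace_density[OF component_transport[OF that]])
    fix f assume "f \<in> borel_measurable borel" "\<And>T. 0 \<le> T \<Longrightarrow> (\<lambda>s. (cmod (f s))\<^sup>2) integrable_on {0..T}"
      "\<And>t. 0 \<le> t \<Longrightarrow> (f has_integral B1 t $ i) {0..t}"
    then have "l2_density f (\<lambda>t. B1 t $ i)" by (simp add: l2_density_def)
    then show "\<exists>f. l2_density f (\<lambda>t. B1 t $ i)" by blast
  qed
  then obtain f where f: "\<And>i. i < n \<Longrightarrow> l2_density (f i) (\<lambda>t. B1 t $ i)" by metis
  define u where "u s = (\<Sum>i<n. K $$ (0,i) * f i (s + \<tau> 1)) + (\<Sum>i<n. L $$ (0,i) * f i s)" for s
  define b where "b t = (\<Sum>i<n. K $$ (0,i) * (B1 (t + \<tau> 1) $ i - B1 (\<tau> 1) $ i)) + (\<Sum>i<n. L $$ (0,i) * B1 t $ i)" for t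
  have ub: "l2_density u b" unfolding u_def[abs_def] b_def[abs_def]
    by (intro l2_density_add l2_density_sum l2_density_cmult l2_density_shift[OF f tau1_nonneg] f) auto
  have b: "b t = (K *\<^sub>v B0 t + L *\<^sub>v B1 t) $ 0" if t: "0 \<le> t" for t
  proof -
    note c = mild_transport_traces_carrier[OF mt]
    have "B0 t $ i = B1 (t + \<tau> 1) $ i - B1 (\<tau> 1) $ i" if "i < n" for i
      using scalar_transport.B0_advanced[OF component_transport[OF that] t] .
    then have "b t = (\<Sum>i<n. K $$ (0,i) * B0 t $ i) + (\<Sum>i<n. L $$ (0,i) * B1 t $ i)" unfolding b_def by simp
    also have "\<dots> = (K *\<^sub>v B0 t) $ 0 + (L *\<^sub>v B1 t) $ 0"
      using mat_vec_index[OF K c(1)[OF t], of 0] mat_vec_index[OF L c(2)[OF t], of 0] by simp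
    also have "\<dots> = (K *\<^sub>v B0 t + L *\<^sub>v B1 t) $ 0" using K L by simp
    finally show ?thesis .
  qed
  show ?thesis using l2_density_L2_loc[OF ub] b by (intro bexI[of _ u]) simp_all
qed

text \<open>
  The outflow increments \<open>B1 (t + j p) - B1 (j p)\<close> over one travel time after the other solve the difference
  equation, with initial value \<open>B1 t\<close>. In the application \<open>N\<close> projects along the forward space.
\<close>

lemma traces_in_forward_space:
  assumes K: "K \<in> carrier_mat n n" and L: "L \<in> carrier_mat n n"
    and bc: "\<And>t. 0 \<le> t \<Longrightarrow> K *\<^sub>v B0 t + L *\<^sub>v B1 t = 0\<^sub>v n"
    and proj: "\<And>d. (\<And>j. d j \<in> carrier_vec n) \<Longrightarrow> (\<And>j. K *\<^sub>v d (Suc j) + L *\<^sub>v d j = 0\<^sub>v n) \<Longrightarrow> N *\<^sub>v d 0 = 0\<^sub>v n"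
    and N: "N \<in> carrier_mat n n"
    and t: "0 \<le> t"
  shows "N *\<^sub>v B1 t = 0\<^sub>v n" and "N *\<^sub>v B0 t = 0\<^sub>v n"
proof -
  define p where "p = \<tau> 1"
  have p: "0 \<le> p" using tau1_nonneg by (simp add: p_def)
  have c: "B1 t \<in> carrier_vec n" "B0 t \<in> carrier_vec n" if "0 \<le> t" for t
    using mild_transport_traces_carrier[OF mt that] by auto
  have B0: "B0 t = B1 (t + p) - B1 p" if "0 \<le> t" for t
    unfolding p_def by (rule inflow_is_advanced_outflow[OF that])
  have N1: "N *\<^sub>v B1 t = 0\<^sub>v n" if t: "0 \<le> t" for t
  proof -
    define d where "d j = B1 (t + real j * p) - B1 (real j * p)" for j
    have jp: "0 \<le> real j * p" for j using p by simp
    have dc: "d j \<in> carrier_vec n" for j unfolding d_def using c jp t by simp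
    have "K *\<^sub>v d (Suc j) + L *\<^sub>v d j = 0\<^sub>v n" for j
    proof -
      have tj: "0 \<le> t + real j * p" using t jp by simp
      have dS: "d (Suc j) = B0 (t + real j * p) - B0 (real j * p)"
        using B0[OF tj] B0[OF jp, of j] c(1)[OF p] c(1)[of "t + real j * p + p"] c(1)[of "real j * p + p"] tj jp[of j] p
        unfolding d_def by (intro eq_vecI) (simp_all add: algebra_simps)
      have "K *\<^sub>v d (Suc j) + L *\<^sub>v d j
          = (K *\<^sub>v B0 (t + real j * p) + L *\<^sub>v B1 (t + real j * p)) - (K *\<^sub>v B0 (real j * p) + L *\<^sub>v B1 (real j * p))"
        unfolding dS unfolding d_def
        using mult_minus_distrib_mat_vec[OF K c(2)[OF tj] c(2)[OF jp]] mult_minus_distrib_mat_vec[OF L c(1)[OF tj] c(1)[OF jp]] K L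
        by (intro eq_vecI) simp_all
      also have "\<dots> = 0\<^sub>v n" using bc[OF tj] bc[OF jp] by simp
      finally show ?thesis .
    qed
    then have "N *\<^sub>v d 0 = 0\<^sub>v n" by (rule proj[OF dc])
    moreover have "d 0 = B1 t" unfolding d_def using outflow_starts_zero c(1)[OF t] by (intro eq_vecI) simp_all
    ultimately show ?thesis by simp
  qed
  show "N *\<^sub>v B1 t = 0\<^sub>v n" by (rule N1[OF t])
  show "N *\<^sub>v B0 t = 0\<^sub>v n"
    using mult_minus_distrib_mat_vec[OF N c(1)[of "t + p"] c(1)[OF p]] N1[of "t + p"] N1[of p] B0[OF t] t p by simp
qed

end

end

section \<open>The characteristic pencil and the transfer function\<close>

context slowness begin

lemma substitute_tau:
  fixes F :: "real \<Rightarrow> complex"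
  assumes F: "continuous_on UNIV F" and x: "0 \<le> x"
  shows "((\<lambda>y. \<kappa> y *\<^sub>R F (\<tau> y)) has_integral integral {0..\<tau> x} F) {0..x}"
proof -
  have [measurable]: "F \<in> borel_measurable borel" by (rule borel_measurable_continuous_onI[OF F])
  define H where "H r = indicator {0..\<tau> x} r *\<^sub>R F r" for r
  have Hm [measurable]: "H \<in> borel_measurable borel" unfolding H_def by measurable
  have "set_integrable lborel {0..\<tau> x} F"
    by (rule borel_integrable_atLeastAtMost') (rule continuous_on_subset[OF F], simp)
  then have iH: "integrable lborel H" by (simp add: set_integrable_def H_def[abs_def])
  have "(H has_integral integral\<^sup>L lborel H) UNIV" by (rule has_integral_integral_lborel[OF iH])
  then have "((\<lambda>r. if r \<in> {0..\<tau> x} then F r else 0) has_integral integral\<^sup>L lborel H) UNIV"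
    by (rule has_integral_eq[rotated]) (simp add: H_def indicator_def)
  then have e: "integral {0..\<tau> x} F = integral\<^sup>L lborel H"
    unfolding has_integral_restrict_UNIV by (rule integral_unique)
  have ind: "indicator {0..\<tau> x} (\<tau> y) = (indicator {0..x} y :: real)" for y
    using tau_le_iff[of 0 y] by (auto simp: indicator_def)
  have "((\<lambda>y. \<kappa> y *\<^sub>R H (\<tau> y)) has_integral (\<integral>y. \<kappa> y *\<^sub>R H (\<tau> y) \<partial>lborel)) UNIV"
    using iH lborel_integral_tau(2)[OF Hm] by (intro has_integral_integral_lborel) simp
  then have "((\<lambda>y. if y \<in> {0..x} then \<kappa> y *\<^sub>R F (\<tau> y) else 0) has_integral (\<integral>y. \<kappa> y *\<^sub>R H (\<tau> y) \<partial>lborel)) UNIV"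
    by (rule has_integral_eq[rotated]) (unfold H_def ind, auto simp: indicator_def)
  then show ?thesis unfolding has_integral_restrict_UNIV lborel_integral_tau(1)[OF Hm] e .
qed

lemma exponential_profile:
  fixes s :: complex
  assumes x: "0 \<le> x"
  shows "((\<lambda>y. - s * of_real (\<kappa> y) * exp (- s * of_real (\<tau> y))) has_integral exp (- s * of_real (\<tau> x)) - 1) {0..x}"
proof -
  have tx: "0 \<le> \<tau> x" using tau_le_iff[of 0 x] x by simp
  have "((\<lambda>r::real. exp (- s * of_real r)) has_vector_derivative - s * exp (- s * of_real r)) (at r within {0..\<tau> x})" for r
    by (rule has_vector_derivative_real_field) (auto intro!: derivative_eq_intros)
  then have "((\<lambda>r::real. - s * exp (- s * of_real r)) has_integral exp (- s * of_real (\<tau> x)) - exp (- s * of_real 0)) {0..\<tau> x}"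
    by (rule fundamental_theorem_of_calculus[OF tx])
  then have "integral {0..\<tau> x} (\<lambda>r. - s * exp (- s * of_real r)) = exp (- s * of_real (\<tau> x)) - 1"
    by (auto dest: integral_unique)
  moreover have "continuous_on UNIV (\<lambda>r::real. - s * exp (- s * of_real r))" by (intro continuous_intros)
  from substitute_tau[OF this x]
  have "((\<lambda>y. \<kappa> y *\<^sub>R (- s * exp (- s * of_real (\<tau> y)))) has_integral integral {0..\<tau> x} (\<lambda>r. - s * exp (- s * of_real r))) {0..x}" .
  ultimately show ?thesis by (simp add: scaleR_conv_of_real mult.assoc mult.left_commute)
qed

lemma sq_int_bounded_borel:
  fixes f :: "real \<Rightarrow> complex"
  assumes f: "f \<in> borel_measurable borel" and bd: "\<And>x. x \<in> {0<..<1} \<Longrightarrow> norm (f x) \<le> C"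
  shows "sq_int f"
  unfolding sq_int_def
proof
  show m: "f \<in> borel_measurable unit_measure" by (rule borel_on_interval[OF f])
  interpret finite_measure unit_measure by (rule unit_measure_finite)
  show "integrable unit_measure (\<lambda>x. (cmod (f x))\<^sup>2)"
  proof (rule integrable_const_bound)
    show "AE x in unit_measure. norm ((cmod (f x))\<^sup>2) \<le> C\<^sup>2"
      using bd by (intro AE_I2) (auto intro!: power_mono)
  qed (use m in measurable)
qed

lemma exp_tau_bounds:
  obtains c C where "0 < c" "\<And>x. x \<in> {0..1} \<Longrightarrow> c \<le> cmod (exp (- s * of_real (\<tau> x)))"
    "\<And>x. x \<in> {0..1} \<Longrightarrow> cmod (exp (- s * of_real (\<tau> x))) \<le> C"
proof -
  define b where "b = \<bar>Re s\<bar> * \<tau> 1"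
  have "\<bar>Re s * \<tau> x\<bar> \<le> b" if "x \<in> {0..1}" for x
    using that tau_le_iff[of 0 x] by (auto simp: b_def abs_mult intro!: mult_left_mono)
  then have "exp (- b) \<le> exp (- (Re s * \<tau> x))" "exp (- (Re s * \<tau> x)) \<le> exp b" if "x \<in> {0..1}" for x
    using that by (force simp: abs_le_iff)+
  then show ?thesis using that[of "exp (- b)" "exp b"] by simp
qed

text \<open>
  If \<open>v\<close> solves the characteristic equation, then \<open>\<kappa>(x) exp(-s \<tau>(x)) v\<close> is an eigenfunction of the generator
  for \<open>s\<close>. The lower bound for \<open>s I - A\<close> on the resolvent set makes it vanish.
\<close>

lemma resolvent_characteristic_injective:
  assumes lam: "AE x in unit_measure. \<kappa> x * lam0 x = 1"
    and s: "s \<in> resolvent_set n lam0 K0 L0 Ku Lu"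
    and v: "v \<in> carrier_vec n"
    and char: "0\<^sub>v n = (K0 @\<^sub>r Ku) *\<^sub>v v + (L0 @\<^sub>r Lu) *\<^sub>v (exp (- s * of_real (\<tau> 1)) \<cdot>\<^sub>v v)"
  shows "v = 0\<^sub>v n"
proof (rule eq_vecI)
  define e where "e x = exp (- s * of_real (\<tau> x))" for x
  have em [measurable]: "e \<in> borel_measurable borel" unfolding e_def by measurable
  obtain c C where cC: "0 < c" "\<And>x. x \<in> {0..1} \<Longrightarrow> c \<le> cmod (e x)" "\<And>x. x \<in> {0..1} \<Longrightarrow> cmod (e x) \<le> C"
    unfolding e_def using exp_tau_bounds by blast
  have e_sq: "sq_int e" by (rule sq_int_bounded_borel[OF em, of C]) (use cC in auto)
  have ke_sq: "sq_int (\<lambda>x. of_real (\<kappa> x) * e x)"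
  proof (rule sq_int_bounded_borel)
    show "norm (of_real (\<kappa> x) * e x) \<le> \<beta> * C" if "x \<in> {0<..<1}" for x
      using mult_mono[OF kappa_le[of x] cC(3)[of x]] that kappa_pos[of x] beta_pos by (simp add: norm_mult)
  qed measurable
  define f where "f x = (of_real (\<kappa> x) * e x) \<cdot>\<^sub>v v" for x
  define h where "h x = (- s * (of_real (\<kappa> x) * e x)) \<cdot>\<^sub>v v" for x
  have fL: "f \<in> L2 n"
  proof (rule L2I)
    show "AE x in unit_measure. f x \<in> carrier_vec n" using v by (simp add: f_def)
    show "sq_int (\<lambda>x. f x $ i)" if "i < n" for i
      using sq_int_cmult[OF ke_sq, of "v $ i"] that v by (simp add: f_def mult.commute)
  qed
  have hL: "h \<in> L2 n"
  proof (rule L2I)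
    show "AE x in unit_measure. h x \<in> carrier_vec n" using v by (simp add: h_def)
    show "sq_int (\<lambda>x. h x $ i)" if "i < n" for i
      using sq_int_cmult[OF ke_sq, of "- s * v $ i"] that v by (simp add: h_def ac_simps)
  qed
  have lf: "AE x in unit_measure. of_real (lam0 x) \<cdot>\<^sub>v f x = e x \<cdot>\<^sub>v v"
    using lam
  proof eventually_elim
    case (elim x)
    have "of_real (lam0 x) \<cdot>\<^sub>v f x = (of_real (\<kappa> x * lam0 x) * e x) \<cdot>\<^sub>v v"
      by (simp add: f_def smult_smult_assoc ac_simps)
    then show ?case using elim by simp
  qed
  have lfL: "(\<lambda>x. of_real (lam0 x) \<cdot>\<^sub>v f x) \<in> L2 n"
  proof (rule L2I)
    show "AE x in unit_measure. of_real (lam0 x) \<cdot>\<^sub>v f x \<in> carrier_vec n" using v by (simp add: f_def)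
    show "sq_int (\<lambda>x. (of_real (lam0 x) \<cdot>\<^sub>v f x) $ i)" if "i < n" for i
    proof (rule sq_int_cong_AE)
      show "sq_int (\<lambda>x. v $ i * e x)" by (rule sq_int_cmult[OF e_sq])
      show "AE x in unit_measure. v $ i * e x = (of_real (lam0 x) \<cdot>\<^sub>v f x) $ i"
        using lf by eventually_elim (use that v in simp)
    qed
  qed
  have prim: "(\<integral>y. h y $ i \<partial>lebesgue_on {0<..<x}) = (e x - 1) * v $ i" if x: "x \<in> {0..1}" and i: "i < n" for x i
  proof -
    have "(\<integral>y. h y $ i \<partial>lebesgue_on {0<..<x}) = integral {0..x} (\<lambda>y. h y $ i)"
      by (rule integral_open_unit[OF L2_component[OF hL i] x])
    also have "\<dots> = (e x - 1) * v $ i"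
      using has_integral_mult_left[OF exponential_profile[of x s], of "v $ i"] x v i
      by (intro integral_unique) (simp add: h_def e_def mult.assoc)
    finally show ?thesis .
  qed
  have H1: "H1 n (\<lambda>x. of_real (lam0 x) \<cdot>\<^sub>v f x) (\<lambda>x. e x \<cdot>\<^sub>v v) h"
    unfolding H1_def
  proof (intro conjI ballI allI impI)
    show "(\<lambda>x. of_real (lam0 x) \<cdot>\<^sub>v f x) \<in> L2 n" "h \<in> L2 n" by (rule lfL, rule hL)
    show "e x \<cdot>\<^sub>v v \<in> carrier_vec n" for x using v by simp
    show "(e x \<cdot>\<^sub>v v) $ i = (e 0 \<cdot>\<^sub>v v) $ i + (\<integral>y. h y $ i \<partial>lebesgue_on {0<..<x})"
      if "x \<in> {0..1}" "i < n" for x i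
      using prim[OF that] that v by (simp add: e_def algebra_simps)
  qed (rule lf)
  have gen: "generator n lam0 K0 L0 Ku Lu f (\<lambda>x. s \<cdot>\<^sub>v f x)"
    unfolding generator_def
  proof (intro conjI exI)
    show "f \<in> L2 n" by (rule fL)
    show "H1 n (\<lambda>x. of_real (lam0 x) \<cdot>\<^sub>v f x) (\<lambda>x. e x \<cdot>\<^sub>v v) h" by (rule H1)
    show "AE x in unit_measure. s \<cdot>\<^sub>v f x = - h x"
      by (intro AE_I2 eq_vecI) (simp_all add: f_def h_def mult.assoc)
    show "0\<^sub>v n = (K0 @\<^sub>r Ku) *\<^sub>v (e 0 \<cdot>\<^sub>v v) + (L0 @\<^sub>r Lu) *\<^sub>v (e 1 \<cdot>\<^sub>v v)"
      using char by (simp add: e_def)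
  qed
  then obtain Cs where "L2_norm n f \<le> Cs * L2_norm n (\<lambda>x. s \<cdot>\<^sub>v f x - s \<cdot>\<^sub>v f x)"
    using s unfolding resolvent_set_def by blast
  moreover have "L2_norm n (\<lambda>x. s \<cdot>\<^sub>v f x - s \<cdot>\<^sub>v f x) = 0"
    unfolding L2_norm_def using v by (simp add: f_def)
  ultimately have n0: "L2_norm n f = 0" using L2_norm_nonneg[of n f] by simp
  fix i assume "i < dim_vec (0\<^sub>v n :: complex vec)"
  then have i: "i < n" by simp
  have "energy (\<lambda>x. f x $ i) = 0"
    using energy_component_le[OF L2_component[OF fL] i] n0 energy_nonneg[of "\<lambda>x. f x $ i"] by simp
  then have "AE x in unit_measure. (cmod (f x $ i))\<^sup>2 = 0"
    unfolding energy_def using L2_component[OF fL i]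
    by (subst (asm) integral_nonneg_eq_0_iff_AE) (auto simp: sq_int_def)
  then have neg: "negligible {x \<in> {0<..<1}. (cmod (f x $ i))\<^sup>2 \<noteq> 0}" unfolding unit_AE_iff_negligible .
  have "v $ i = 0"
  proof (rule ccontr)
    assume "v $ i \<noteq> 0"
    then have "(cmod (f x $ i))\<^sup>2 \<noteq> 0" for x
      using kappa_pos[of x] i v by (simp add: f_def e_def)
    then have "{x \<in> {0<..<1}. (cmod (f x $ i))\<^sup>2 \<noteq> 0} = box 0 1" unfolding box_real by blast
    then have "negligible (box 0 (1::real))" using neg by (simp only:)
    then show False unfolding negligible_interval by simp
  qed
  then show "v $ i = 0\<^sub>v n $ i" using i by simp
qed (use v in simp)

end

lemma append_rows_boundary_zero_iff:
  fixes A B C D :: "complex mat"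
  assumes n: "n \<ge> 1" and A: "A \<in> carrier_mat (n - 1) n" and B: "B \<in> carrier_mat 1 n"
    and C: "C \<in> carrier_mat (n - 1) n" and D: "D \<in> carrier_mat 1 n"
    and v: "v \<in> carrier_vec n" and w: "w \<in> carrier_vec n"
  shows "(A @\<^sub>r B) *\<^sub>v v + (C @\<^sub>r D) *\<^sub>v w = 0\<^sub>v n \<longleftrightarrow>
    A *\<^sub>v v + C *\<^sub>v w = 0\<^sub>v (n - 1) \<and> (B *\<^sub>v v + D *\<^sub>v w) $ 0 = 0"
proof -
  have AB: "(A @\<^sub>r B) *\<^sub>v v = (A *\<^sub>v v) @\<^sub>v (B *\<^sub>v v)" by (rule mat_mult_append[OF A B v])
  have CD: "(C @\<^sub>r D) *\<^sub>v w = (C *\<^sub>v w) @\<^sub>v (D *\<^sub>v w)" by (rule mat_mult_append[OF C D w])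
  have z: "0\<^sub>v n = (0\<^sub>v (n - 1) :: complex vec) @\<^sub>v 0\<^sub>v 1" using n by (intro eq_vecI) auto
  have "(A @\<^sub>r B) *\<^sub>v v + (C @\<^sub>r D) *\<^sub>v w = (A *\<^sub>v v + C *\<^sub>v w) @\<^sub>v (B *\<^sub>v v + D *\<^sub>v w)"
    unfolding AB CD using A B C D by (intro eq_vecI) auto
  also have "\<dots> = 0\<^sub>v n \<longleftrightarrow> A *\<^sub>v v + C *\<^sub>v w = 0\<^sub>v (n - 1) \<and> B *\<^sub>v v + D *\<^sub>v w = 0\<^sub>v 1"
    unfolding z
    by (rule append_vec_eq[OF add_carrier_vec[OF mult_mat_vec_carrier[OF A v] mult_mat_vec_carrier[OF C w]] zero_carrier_vec])
  also have "B *\<^sub>v v + D *\<^sub>v w = 0\<^sub>v 1 \<longleftrightarrow> (B *\<^sub>v v + D *\<^sub>v w) $ 0 = 0"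
    using B D by (auto simp: vec_eq_iff)
  finally show ?thesis .
qed

lemma pencil_mult_vec:
  fixes K L :: "complex mat"
  assumes K: "K \<in> carrier_mat m n" and L: "L \<in> carrier_mat m n" and v: "v \<in> carrier_vec n"
  shows "(K + q \<cdot>\<^sub>m L) *\<^sub>v v = K *\<^sub>v v + L *\<^sub>v (q \<cdot>\<^sub>v v)"
proof -
  have "(K + q \<cdot>\<^sub>m L) *\<^sub>v v = K *\<^sub>v v + (q \<cdot>\<^sub>m L) *\<^sub>v v"
    using K L v by (intro add_mult_distrib_mat_vec) auto
  also have "(q \<cdot>\<^sub>m L) *\<^sub>v v = L *\<^sub>v (q \<cdot>\<^sub>v v)"
    using L v mult_mat_vec[OF L v, of q] by (intro eq_vecI) (auto simp: scalar_prod_def sum_distrib_left ac_simps)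
  finally show ?thesis .
qed

text \<open>
  Let \<open>x\<close> be the vector that defines \<open>G(s)u\<close>. If \<open>v\<close> satisfies the characteristic equations with output \<open>0\<close>
  and has input \<open>c\<close>, then \<open>c x\<close> and \<open>u v\<close> have the same input and hence are equal; comparing outputs gives
  \<open>c G(s)u = 0\<close>. So \<open>c = 0\<close>, and \<open>v = 0\<close>.
\<close>

lemma output_pencil_regular:
  fixes K0 L0 Ku Lu Ky Ly :: "complex mat"
  assumes n: "n \<ge> 1" and K0: "K0 \<in> carrier_mat (n - 1) n" and L0: "L0 \<in> carrier_mat (n - 1) n"
    and Ku: "Ku \<in> carrier_mat 1 n" and Lu: "Lu \<in> carrier_mat 1 n"
    and Ky: "Ky \<in> carrier_mat 1 n" and Ly: "Ly \<in> carrier_mat 1 n"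
    and inj: "\<And>v. v \<in> carrier_vec n \<Longrightarrow> ((K0 @\<^sub>r Ku) + q \<cdot>\<^sub>m (L0 @\<^sub>r Lu)) *\<^sub>v v = 0\<^sub>v n \<Longrightarrow> v = 0\<^sub>v n"
    and q: "q = exp (- s * of_real (travel_time lam0))"
    and G: "transfer_function n lam0 K0 L0 Ku Lu Ky Ly s u \<noteq> 0"
    and v: "v \<in> carrier_vec n" and vz: "((K0 @\<^sub>r Ky) + q \<cdot>\<^sub>m (L0 @\<^sub>r Ly)) *\<^sub>v v = 0\<^sub>v n"
  shows "v = 0\<^sub>v n"
proof -
  let ?A = "K0 + q \<cdot>\<^sub>m L0" let ?B = "Ku + q \<cdot>\<^sub>m Lu" let ?C = "Ky + q \<cdot>\<^sub>m Ly"
  let ?M = "(K0 @\<^sub>r Ku) + q \<cdot>\<^sub>m (L0 @\<^sub>r Lu)"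
  have n1: "n - 1 + 1 = n" using n by simp
  have A: "?A \<in> carrier_mat (n - 1) n" and B: "?B \<in> carrier_mat 1 n" and C: "?C \<in> carrier_mat 1 n"
    using K0 L0 Ku Lu Ky Ly by auto
  have Cz: "(?C *\<^sub>v 0\<^sub>v n) $ 0 = 0" using mat_vec_index[OF C zero_carrier_vec, of 0] by simp
  have KL: "K0 @\<^sub>r Ku \<in> carrier_mat n n" "L0 @\<^sub>r Lu \<in> carrier_mat n n"
    "K0 @\<^sub>r Ky \<in> carrier_mat n n" "L0 @\<^sub>r Ly \<in> carrier_mat n n"
    using carrier_append_rows[OF K0 Ku] carrier_append_rows[OF L0 Lu] carrier_append_rows[OF K0 Ky] carrier_append_rows[OF L0 Ly] n1 by auto
  have M: "?M \<in> carrier_mat n n" using KL by auto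
  have iff_u: "?M *\<^sub>v w = 0\<^sub>v n \<longleftrightarrow> ?A *\<^sub>v w = 0\<^sub>v (n - 1) \<and> (?B *\<^sub>v w) $ 0 = 0" if w: "w \<in> carrier_vec n" for w
    unfolding pencil_mult_vec[OF KL(1,2) w] pencil_mult_vec[OF K0 L0 w] pencil_mult_vec[OF Ku Lu w]
    by (rule append_rows_boundary_zero_iff[OF n K0 Ku L0 Lu w]) (use w in simp)
  have iff_y: "((K0 @\<^sub>r Ky) + q \<cdot>\<^sub>m (L0 @\<^sub>r Ly)) *\<^sub>v w = 0\<^sub>v n \<longleftrightarrow> ?A *\<^sub>v w = 0\<^sub>v (n - 1) \<and> (?C *\<^sub>v w) $ 0 = 0" if w: "w \<in> carrier_vec n" for w
    unfolding pencil_mult_vec[OF KL(3,4) w] pencil_mult_vec[OF K0 L0 w] pencil_mult_vec[OF Ky Ly w]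
    by (rule append_rows_boundary_zero_iff[OF n K0 Ky L0 Ly w]) (use w in simp)
  have vA: "?A *\<^sub>v v = 0\<^sub>v (n - 1)" and vC: "(?C *\<^sub>v v) $ 0 = 0" using vz iff_y[OF v] by auto
  have comb: "(X *\<^sub>v (a \<cdot>\<^sub>v x - b \<cdot>\<^sub>v y)) $ i = a * (X *\<^sub>v x) $ i - b * (X *\<^sub>v y) $ i"
    if "X \<in> carrier_mat r n" "x \<in> carrier_vec n" "y \<in> carrier_vec n" "i < r" for X :: "complex mat" and r a x b y i
    using that mult_minus_distrib_mat_vec[of X r n "a \<cdot>\<^sub>v x" "b \<cdot>\<^sub>v y"] mult_mat_vec[of X r n x a] mult_mat_vec[of X r n y b]
    by simp
  obtain Mi where Mi: "Mi \<in> carrier_mat n n" "?M * Mi = 1\<^sub>m n"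
    using injective_imp_right_inverse[OF M inj] by blast
  \<comment> \<open>the solution of the characteristic system for the input \<open>u\<close>\<close>
  define x where "x = Mi *\<^sub>v (u \<cdot>\<^sub>v unit_vec n (n - 1))"
  have x: "x \<in> carrier_vec n" unfolding x_def using Mi by simp
  have Mx: "?M *\<^sub>v x = u \<cdot>\<^sub>v unit_vec n (n - 1)"
    unfolding x_def using assoc_mult_mat_vec[OF M Mi(1), of "u \<cdot>\<^sub>v unit_vec n (n - 1)"] Mi(2) by simp
  have Msplit: "?M *\<^sub>v x = (?A *\<^sub>v x) @\<^sub>v (?B *\<^sub>v x)"
  proof -
    have "?M *\<^sub>v x = ((K0 *\<^sub>v x) @\<^sub>v (Ku *\<^sub>v x)) + ((L0 *\<^sub>v (q \<cdot>\<^sub>v x)) @\<^sub>v (Lu *\<^sub>v (q \<cdot>\<^sub>v x)))"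
      unfolding pencil_mult_vec[OF KL(1,2) x] using mat_mult_append[OF K0 Ku x] mat_mult_append[OF L0 Lu, of "q \<cdot>\<^sub>v x"] x by simp
    also have "\<dots> = (?A *\<^sub>v x) @\<^sub>v (?B *\<^sub>v x)"
      unfolding pencil_mult_vec[OF K0 L0 x] pencil_mult_vec[OF Ku Lu x] using K0 L0 Ku Lu by (intro eq_vecI) auto
    finally show ?thesis .
  qed
  have xA: "?A *\<^sub>v x = 0\<^sub>v (n - 1)"
  proof (rule eq_vecI)
    fix i assume "i < dim_vec (0\<^sub>v (n - 1) :: complex vec)"
    then have i: "i < n - 1" by simp
    have "(?A *\<^sub>v x) $ i = (?M *\<^sub>v x) $ i" unfolding Msplit using i A K0 L0 B by simp
    also have "\<dots> = 0" unfolding Mx using i by simp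
    finally show "(?A *\<^sub>v x) $ i = 0\<^sub>v (n - 1) $ i" using i by simp
  qed (use K0 L0 in simp)
  have xB: "(?B *\<^sub>v x) $ 0 = u"
  proof -
    have "(?B *\<^sub>v x) $ 0 = (?M *\<^sub>v x) $ (n - 1)" unfolding Msplit using A K0 L0 Ku Lu n by simp
    also have "\<dots> = u" unfolding Mx using n by simp
    finally show ?thesis .
  qed
  have "transfer_function n lam0 K0 L0 Ku Lu Ky Ly s u = (?C *\<^sub>v x) $ 0"
    unfolding transfer_function_def Let_def q[symmetric]
  proof (rule the_equality)
    show "\<exists>v\<in>carrier_vec n. 0\<^sub>v (n - 1) = ?A *\<^sub>v v \<and> u = (?B *\<^sub>v v) $ 0 \<and> (?C *\<^sub>v x) $ 0 = (?C *\<^sub>v v) $ 0"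
      using x xA xB by (intro bexI[of _ x]) simp_all
  next
    fix y assume "\<exists>v\<in>carrier_vec n. 0\<^sub>v (n - 1) = ?A *\<^sub>v v \<and> u = (?B *\<^sub>v v) $ 0 \<and> y = (?C *\<^sub>v v) $ 0"
    then obtain w where w: "w \<in> carrier_vec n" "?A *\<^sub>v w = 0\<^sub>v (n - 1)" "(?B *\<^sub>v w) $ 0 = u" "y = (?C *\<^sub>v w) $ 0" by auto
    define d where "d = 1 \<cdot>\<^sub>v w - 1 \<cdot>\<^sub>v x"
    have d: "d \<in> carrier_vec n" using w x by (simp add: d_def)
    have "?A *\<^sub>v d = 0\<^sub>v (n - 1)"
      using comb[OF A w(1) x, of _ 1 1] w(2) xA K0 L0 unfolding d_def by (intro eq_vecI) simp_all
    moreover have "(?B *\<^sub>v d) $ 0 = 0" using comb[OF B w(1) x, of 0 1 1] w(3) xB unfolding d_def by simp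
    ultimately have "d = 0\<^sub>v n" using inj[OF d] iff_u[OF d] by simp
    then have "(?C *\<^sub>v d) $ 0 = 0" using Cz by simp
    then show "y = (?C *\<^sub>v x) $ 0" using comb[OF C w(1) x, of 0 1 1] w(4) unfolding d_def by simp
  qed
  then have y0: "(?C *\<^sub>v x) $ 0 \<noteq> 0" using G by simp
  define c where "c = (?B *\<^sub>v v) $ 0"
  define d where "d = c \<cdot>\<^sub>v x - u \<cdot>\<^sub>v v"
  have d: "d \<in> carrier_vec n" using x v by (simp add: d_def)
  have "?A *\<^sub>v d = 0\<^sub>v (n - 1)"
    using comb[OF A x v, of _ c u] vA xA K0 L0 unfolding d_def by (intro eq_vecI) simp_all
  moreover have "(?B *\<^sub>v d) $ 0 = 0" using comb[OF B x v, of 0 c u] xB unfolding d_def c_def by simp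
  ultimately have "d = 0\<^sub>v n" using inj[OF d] iff_u[OF d] by simp
  then have "(?C *\<^sub>v d) $ 0 = 0" using Cz by simp
  then have "c * (?C *\<^sub>v x) $ 0 = 0" using comb[OF C x v, of 0 c u] vC unfolding d_def by simp
  then have "(?B *\<^sub>v v) $ 0 = 0" using y0 by (simp add: c_def)
  then show ?thesis using inj[OF v] iff_u[OF v] vA by simp
qed

lemma obtain_slowness:
  fixes m M :: real
  assumes lm: "lam0 \<in> borel_measurable unit_measure" and m: "0 < m" and M: "0 < M"
    and bd: "AE x in unit_measure. m \<le> lam0 x \<and> lam0 x \<le> M"
  obtains \<kappa> \<alpha> \<beta> where "slowness \<kappa> \<alpha> \<beta>" "AE x in unit_measure. \<kappa> x * lam0 x = 1"
proof -
  define l0 where "l0 x = (if x \<in> {0<..<1} then lam0 x else 0)" for x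
  have "l0 \<in> borel_measurable lebesgue" unfolding l0_def using lm by (intro borel_measurable_if_I) auto
  then obtain l where l: "l \<in> borel_measurable lborel" "AE x in lborel. l0 x = l x"
    using completion_ex_borel_measurable_real by blast
  have [measurable]: "l \<in> borel_measurable borel" using l by simp
  \<comment> \<open>clamping makes the bounds hold everywhere and does not change the value where \<open>m \<le> lam0 x \<le> M\<close>\<close>
  define \<kappa> where "\<kappa> x = max (1 / M) (min (1 / m) (1 / l x))" for x
  have "slowness \<kappa> (1 / M) (max (1 / M) (1 / m))"
  proof
    show "\<kappa> \<in> borel_measurable borel" unfolding \<kappa>_def by measurable
  qed (use M in \<open>auto simp: \<kappa>_def\<close>)
  moreover have "AE x in unit_measure. \<kappa> x * lam0 x = 1"
  proof -
    have "AE x in lebesgue. l0 x = l x" using l(2) by (rule AE_completion)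
    then have "AE x in lebesgue. x \<in> {0<..<1} \<longrightarrow> lam0 x = l x" by eventually_elim (auto simp: l0_def)
    then have "AE x in unit_measure. lam0 x = l x" by (subst AE_restrict_space_iff) simp_all
    with bd show ?thesis
    proof eventually_elim
      case (elim x)
      then have "1 / M \<le> 1 / l x" "1 / l x \<le> 1 / m" using m by (auto intro!: divide_left_mono mult_pos_pos)
      then have "\<kappa> x = 1 / l x" by (simp add: \<kappa>_def)
      then show ?case using elim m by simp
    qed
  qed
  ultimately show ?thesis using that by blast
qed

lemma (in slowness) travel_time_tau:
  assumes lm: "lam0 \<in> borel_measurable unit_measure" and lam: "AE x in unit_measure. \<kappa> x * lam0 x = 1"
  shows "travel_time lam0 = \<tau> 1"
proof -
  have "travel_time lam0 = (\<integral>x. \<kappa> x \<partial>unit_measure)"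
    unfolding travel_time_def
  proof (rule integral_cong_AE)
    show "(\<lambda>x. 1 / lam0 x) \<in> borel_measurable unit_measure" using lm by measurable
    show "\<kappa> \<in> borel_measurable unit_measure" by (intro measurable_restrict_space1 measurable_completion) simp
    show "AE x in unit_measure. 1 / lam0 x = \<kappa> x" using lam
      by eventually_elim (metis mult_zero_right nonzero_eq_divide_eq zero_neq_one)
  qed
  also have "\<dots> = integral {0<..<1} \<kappa>"
  proof (rule lebesgue_integral_eq_integral)
    have "\<kappa> absolutely_integrable_on {0<..<1}"
      using kappa_abs_integrable[of 0 1] by (simp add: absolutely_integrable_on_def integrable_on_Icc_iff_Ioo)
    then show "integrable unit_measure \<kappa>" by (rule absolutely_integrable_imp_integrable) simp
  qed simp
  also have "\<dots> = \<tau> 1" using tau_diff[of 0 1] by (simp add: integral_open_interval_real)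
  finally show ?thesis .
qed

section \<open>Zero dynamics\<close>

theorem theorem4p2:
  fixes n :: nat and lam0 :: "real \<Rightarrow> real" and m M :: real
    and K0 L0 Ku Lu Ky Ly :: "complex mat"
  assumes "n \<ge> 1"
    and "K0 \<in> carrier_mat (n - 1) n" and "L0 \<in> carrier_mat (n - 1) n"
    and "Ku \<in> carrier_mat 1 n" and "Lu \<in> carrier_mat 1 n"
    and "Ky \<in> carrier_mat 1 n" and "Ly \<in> carrier_mat 1 n"
    and "lam0 \<in> borel_measurable unit_measure"
    and "0 < m" and "0 < M"
    and "AE x in unit_measure. m \<le> lam0 x \<and> lam0 x \<le> M"
    and well_posed: "invertible_mat (K0 @\<^sub>r Ku)"
    and "\<exists>s\<in>resolvent_set n lam0 K0 L0 Ku Lu. \<exists>u. transfer_function n lam0 K0 L0 Ku Lu Ky Ly s u \<noteq> 0"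
  shows "\<exists>k\<le>n. \<exists>Kw\<in>carrier_mat k k. \<exists>Lw\<in>carrier_mat k k. \<exists>Q\<in>carrier_mat n k.
           invertible_mat Kw \<and>
           inj_on (\<lambda>v. Q *\<^sub>v v) (carrier_vec k) \<and>
           zero_dynamics_trajectories n lam0 K0 L0 Ku Lu Ky Ly =
             {z. \<exists>w. autonomous_mild_solution k lam0 Kw Lw w \<and>
                     (\<forall>t\<ge>0. AE x in unit_measure. z t x = Q *\<^sub>v w t x)}"
proof -
  note n = assms(1) and K0 = assms(2) and L0 = assms(3) and Ku = assms(4) and Lu = assms(5)
    and Ky = assms(6) and Ly = assms(7)
  obtain \<kappa> \<alpha> \<beta> where trv: "slowness \<kappa> \<alpha> \<beta>" and lam: "AE x in unit_measure. \<kappa> x * lam0 x = 1"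
    using obtain_slowness[OF assms(8-11)] by blast
  interpret slowness \<kappa> \<alpha> \<beta> by (rule trv)
  obtain s u where s: "s \<in> resolvent_set n lam0 K0 L0 Ku Lu"
    and G: "transfer_function n lam0 K0 L0 Ku Lu Ky Ly s u \<noteq> 0" using assms(13) by blast
  define q where "q = exp (- s * of_real (travel_time lam0))"
  have q: "q = exp (- s * of_real (\<tau> 1))" unfolding q_def travel_time_tau[OF assms(8) lam] ..
  define K where "K = K0 @\<^sub>r Ky"
  define L where "L = L0 @\<^sub>r Ly"
  have n1: "n - 1 + 1 = n" using n by simp
  have K: "K \<in> carrier_mat n n" and L: "L \<in> carrier_mat n n"
    and KL: "K0 @\<^sub>r Ku \<in> carrier_mat n n" "L0 @\<^sub>r Lu \<in> carrier_mat n n"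
    using carrier_append_rows[OF K0 Ky] carrier_append_rows[OF L0 Ly] carrier_append_rows[OF K0 Ku]
      carrier_append_rows[OF L0 Lu] n1 unfolding K_def L_def by auto
  have inj_u: "v = 0\<^sub>v n" if v: "v \<in> carrier_vec n" "((K0 @\<^sub>r Ku) + q \<cdot>\<^sub>m (L0 @\<^sub>r Lu)) *\<^sub>v v = 0\<^sub>v n" for v
    by (rule resolvent_characteristic_injective[OF lam s v(1)])
      (use v(2) in \<open>simp add: pencil_mult_vec[OF KL v(1)] q\<close>)
  have regular: "v = 0\<^sub>v n" if v: "v \<in> carrier_vec n" "(K + q \<cdot>\<^sub>m L) *\<^sub>v v = 0\<^sub>v n" for v
    using output_pencil_regular[OF n K0 L0 Ku Lu Ky Ly inj_u q_def G v(1)] v(2) unfolding K_def L_def by blast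
  obtain k P Q R where k: "k \<le> n" and P: "P \<in> carrier_mat k n" and Q: "Q \<in> carrier_mat n k"
    and R: "R \<in> carrier_mat k k" and PQ: "P * Q = 1\<^sub>m k" and LQ: "L * Q = K * Q * R"
    and KQ_inj: "\<And>c. c \<in> carrier_vec k \<Longrightarrow> (K * Q) *\<^sub>v c = 0\<^sub>v n \<Longrightarrow> c = 0\<^sub>v k"
    and forward: "\<And>d. (\<And>j. d j \<in> carrier_vec n) \<Longrightarrow> (\<And>j. K *\<^sub>v d (Suc j) + L *\<^sub>v d j = 0\<^sub>v n) \<Longrightarrow>
        Q *\<^sub>v (P *\<^sub>v d 0) = d 0"
  proof (rule regular_pencil_forward_space[where q = q, OF K L])
    show "v = 0\<^sub>v n" if "v \<in> carrier_vec n" "(K + q \<cdot>\<^sub>m L) *\<^sub>v v = 0\<^sub>v n" for v by (rule regular[OF that])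
  qed blast
  have KQ: "K * Q \<in> carrier_mat n k" using K Q by simp
  have PQv: "P *\<^sub>v (Q *\<^sub>v c) = c" if "c \<in> carrier_vec k" for c
    using assoc_mult_mat_vec[OF P Q that] PQ that by simp
  have reduced: "K *\<^sub>v (Q *\<^sub>v c) + L *\<^sub>v (Q *\<^sub>v d) = (K * Q) *\<^sub>v (c + R *\<^sub>v d)"
    if c: "c \<in> carrier_vec k" and d: "d \<in> carrier_vec k" for c d
  proof -
    have Rd: "R *\<^sub>v d \<in> carrier_vec k" using R d by simp
    have "L *\<^sub>v (Q *\<^sub>v d) = (K * Q) *\<^sub>v (R *\<^sub>v d)"
      using assoc_mult_mat_vec[OF L Q d] assoc_mult_mat_vec[OF KQ R d] LQ by simp
    then show ?thesis
      using assoc_mult_mat_vec[OF K Q c] mult_add_distrib_mat_vec[OF KQ c Rd] by simp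
  qed
  have "zero_dynamics_trajectories n lam0 K0 L0 Ku Lu Ky Ly =
      {z. \<exists>w. autonomous_mild_solution k lam0 (1\<^sub>m k) R w \<and> (\<forall>t\<ge>0. AE x in unit_measure. z t x = Q *\<^sub>v w t x)}"
    (is "?Z = ?W")
  proof (intro equalityI subsetI)
    fix z assume "z \<in> ?Z"
    then obtain z0 u' where "mild_solution n lam0 K0 L0 Ku Lu Ky Ly z0 u' z (\<lambda>t. 0)"
      unfolding zero_dynamics_trajectories_def by blast
    then obtain B0 B1 where mt: "mild_transport n lam0 z B0 B1"
      and bc: "\<forall>t\<ge>0. 0\<^sub>v (n - 1) = K0 *\<^sub>v B0 t + L0 *\<^sub>v B1 t \<and>
         (\<integral>\<tau>. u' \<tau> \<partial>lebesgue_on {0<..<t}) = (Ku *\<^sub>v B0 t + Lu *\<^sub>v B1 t) $ 0 \<and>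
         (\<integral>\<tau>. 0 \<partial>lebesgue_on {0<..<t}) = (Ky *\<^sub>v B0 t + Ly *\<^sub>v B1 t) $ 0"
      unfolding mild_solution_def by blast
    have B: "B0 t \<in> carrier_vec n" "B1 t \<in> carrier_vec n" if "0 \<le> t" for t
      using mild_transport_traces_carrier[OF mt that] by auto
    have bc': "K *\<^sub>v B0 t + L *\<^sub>v B1 t = 0\<^sub>v n" if t: "0 \<le> t" for t
      unfolding K_def L_def append_rows_boundary_zero_iff[OF n K0 Ky L0 Ly B[OF t]]
      using bc[rule_format, OF t] by simp
    \<comment> \<open>\<open>N v = 0\<close> holds exactly for \<open>v\<close> in the range of \<open>Q\<close>\<close>
    define N where "N = 1\<^sub>m n - Q * P"
    have N: "N \<in> carrier_mat n n" unfolding N_def using P Q by auto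
    have Nv: "N *\<^sub>v v = v - Q *\<^sub>v (P *\<^sub>v v)" if "v \<in> carrier_vec n" for v
    proof -
      have "N *\<^sub>v v = 1\<^sub>m n *\<^sub>v v - (Q * P) *\<^sub>v v"
        unfolding N_def using P Q that by (intro minus_mult_distrib_mat_vec) auto
      then show ?thesis using assoc_mult_mat_vec[OF Q P that] that by simp
    qed
    have fixed: "v = Q *\<^sub>v (P *\<^sub>v v)" if v: "v \<in> carrier_vec n" and "N *\<^sub>v v = 0\<^sub>v n" for v
    proof (rule eq_vecI)
      fix i assume "i < dim_vec (Q *\<^sub>v (P *\<^sub>v v))"
      then have i: "i < n" using Q by simp
      have "(v - Q *\<^sub>v (P *\<^sub>v v)) $ i = 0" unfolding Nv[OF v, symmetric] that(2) using i by simp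
      then show "v $ i = (Q *\<^sub>v (P *\<^sub>v v)) $ i" using i Q v by simp
    qed (use v Q in simp)
    have Nd: "N *\<^sub>v d 0 = 0\<^sub>v n"
      if d: "\<And>j. d j \<in> carrier_vec n" "\<And>j. K *\<^sub>v d (Suc j) + L *\<^sub>v d j = 0\<^sub>v n" for d
    proof -
      have "Q *\<^sub>v (P *\<^sub>v d 0) = d 0" by (rule forward) (rule d)+
      then show ?thesis using Nv[OF d(1), of 0] d(1)[of 0] by simp
    qed
    have NB: "N *\<^sub>v B1 t = 0\<^sub>v n" "N *\<^sub>v B0 t = 0\<^sub>v n" if "0 \<le> t" for t
      by (rule traces_in_forward_space[OF lam mt K L _ _ N that], simp add: bc', rule Nd, blast+)+
    have zL: "z t \<in> L2 n" if "0 \<le> t" for t using mt that by (simp add: mild_transport_def L2_continuous_def)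
    have mtN: "mild_transport n lam0 (\<lambda>t x. N *\<^sub>v z t x) (\<lambda>t. N *\<^sub>v B0 t) (\<lambda>t. N *\<^sub>v B1 t)"
      by (rule mild_transport_linear[OF N mt]) simp
    have zN: "AE x in unit_measure. N *\<^sub>v z t x = 0\<^sub>v n" if "0 \<le> t" for t
      by (rule zero_outflow_imp_zero_state[OF lam mtN NB(1) that])
    define w where "w t x = P *\<^sub>v z t x" for t x
    have mtw: "mild_transport k lam0 w (\<lambda>t. P *\<^sub>v B0 t) (\<lambda>t. P *\<^sub>v B1 t)"
      by (rule mild_transport_linear[OF P mt]) (simp add: w_def)
    have "0\<^sub>v k = 1\<^sub>m k *\<^sub>v (P *\<^sub>v B0 t) + R *\<^sub>v (P *\<^sub>v B1 t)" if t: "0 \<le> t" for t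
    proof -
      have c: "P *\<^sub>v B0 t \<in> carrier_vec k" "P *\<^sub>v B1 t \<in> carrier_vec k" using P B[OF t] by auto
      have "(K * Q) *\<^sub>v (P *\<^sub>v B0 t + R *\<^sub>v (P *\<^sub>v B1 t)) = 0\<^sub>v n"
        using reduced[OF c] fixed[OF B(1)[OF t] NB(2)[OF t]] fixed[OF B(2)[OF t] NB(1)[OF t]] bc'[OF t] by simp
      then have "P *\<^sub>v B0 t + R *\<^sub>v (P *\<^sub>v B1 t) = 0\<^sub>v k" using c R by (intro KQ_inj) auto
      then show ?thesis using c by simp
    qed
    then have "autonomous_mild_solution k lam0 (1\<^sub>m k) R w"
      unfolding autonomous_mild_solution_def using mtw by blast
    moreover have "AE x in unit_measure. z t x = Q *\<^sub>v w t x" if t: "0 \<le> t" for t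
      using L2_carrier[OF zL[OF t]] zN[OF t] unfolding w_def by eventually_elim (rule fixed)
    ultimately show "z \<in> ?W" by blast
  next
    fix z assume "z \<in> ?W"
    then obtain w B0 B1 where mt: "mild_transport k lam0 w B0 B1"
      and bc: "\<And>t. 0 \<le> t \<Longrightarrow> 0\<^sub>v k = 1\<^sub>m k *\<^sub>v B0 t + R *\<^sub>v B1 t"
      and zw: "\<And>t. 0 \<le> t \<Longrightarrow> AE x in unit_measure. z t x = Q *\<^sub>v w t x"
      unfolding autonomous_mild_solution_def by blast
    have mtz: "mild_transport n lam0 z (\<lambda>t. Q *\<^sub>v B0 t) (\<lambda>t. Q *\<^sub>v B1 t)"
      by (rule mild_transport_linear[OF Q mt zw])
    have bcz: "0\<^sub>v (n - 1) = K0 *\<^sub>v (Q *\<^sub>v B0 t) + L0 *\<^sub>v (Q *\<^sub>v B1 t)"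
      "(Ky *\<^sub>v (Q *\<^sub>v B0 t) + Ly *\<^sub>v (Q *\<^sub>v B1 t)) $ 0 = 0" if t: "0 \<le> t" for t
    proof -
      have B: "B0 t \<in> carrier_vec k" "B1 t \<in> carrier_vec k" using mild_transport_traces_carrier[OF mt t] by auto
      have QB: "Q *\<^sub>v B0 t \<in> carrier_vec n" "Q *\<^sub>v B1 t \<in> carrier_vec n" using Q B by auto
      have "K *\<^sub>v (Q *\<^sub>v B0 t) + L *\<^sub>v (Q *\<^sub>v B1 t) = (K * Q) *\<^sub>v 0\<^sub>v k"
        unfolding reduced[OF B] using bc[OF t] B by simp
      also have "\<dots> = 0\<^sub>v n" using K by (intro eq_vecI) (simp_all add: scalar_prod_def)
      finally have "K0 *\<^sub>v (Q *\<^sub>v B0 t) + L0 *\<^sub>v (Q *\<^sub>v B1 t) = 0\<^sub>v (n - 1) \<and>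
          (Ky *\<^sub>v (Q *\<^sub>v B0 t) + Ly *\<^sub>v (Q *\<^sub>v B1 t)) $ 0 = 0"
        unfolding K_def L_def append_rows_boundary_zero_iff[OF n K0 Ky L0 Ly QB] .
      then show "0\<^sub>v (n - 1) = K0 *\<^sub>v (Q *\<^sub>v B0 t) + L0 *\<^sub>v (Q *\<^sub>v B1 t)"
        "(Ky *\<^sub>v (Q *\<^sub>v B0 t) + Ly *\<^sub>v (Q *\<^sub>v B1 t)) $ 0 = 0" by simp_all
    qed
    obtain u' where u': "u' \<in> L2_loc" "\<And>t. 0 \<le> t \<Longrightarrow> (\<integral>s. u' s \<partial>lebesgue_on {0<..<t}) = (Ku *\<^sub>v (Q *\<^sub>v B0 t) + Lu *\<^sub>v (Q *\<^sub>v B1 t)) $ 0"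
      using boundary_functional_density[OF lam mtz Ku Lu] by blast
    have z0: "z 0 \<in> L2 n" using mtz by (simp add: mild_transport_def L2_continuous_def)
    have "mild_solution n lam0 K0 L0 Ku Lu Ky Ly (z 0) u' z (\<lambda>t. 0)"
      unfolding mild_solution_def
    proof (intro conjI exI allI impI)
      show "(\<lambda>t. 0) \<in> L2_loc" by (simp add: L2_loc_def)
      show "mild_transport n lam0 z (\<lambda>t. Q *\<^sub>v B0 t) (\<lambda>t. Q *\<^sub>v B1 t)" by (rule mtz)
    qed (use z0 u' bcz in simp_all)
    then show "z \<in> ?Z" unfolding zero_dynamics_trajectories_def zero_dynamics_def by blast
  qed
  moreover have "invertible_mat (1\<^sub>m k :: complex mat)"
    unfolding invertible_mat_def inverts_mat_def by (auto intro!: exI[of _ "1\<^sub>m k"])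
  moreover have "inj_on (\<lambda>v. Q *\<^sub>v v) (carrier_vec k)" by (rule inj_on_inverseI[where g = "\<lambda>v. P *\<^sub>v v"]) (rule PQv)
  ultimately show ?thesis using k Q R one_carrier_mat by blast
qed

end
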